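(* Let $n\geq 3$. (1) For any $x\in\mathbb{B}^{n}$ and $l\in\mathbb{S}^{n-1}$, $$\mathbf{C}_{\mathbb{B}^{n},\frac{n}{n-1}}(x)\equiv\mathbf{C}_{\mathbb{B}^{n},\frac{n}{n-1}}(x;l)\equiv\frac{2(n-1)}{(1-|x|^2)^{\frac{2n-1}{n}}}\left(\frac{\Gamma(\frac{n}{2})\,\Gamma(\frac{2n-1}{2n-2})}{\sqrt{\pi}\,\Gamma(\frac{n^{2}}{2n-2})}(1+|x|^2)\right)^{\frac{n-1}{n}}$$ and $$\mathbf{C}_{\mathbb{B}^{n},1}(x)\equiv\mathbf{C}_{\mathbb{B}^{n},1}(x;l)\equiv\frac{2(n-1)\Gamma(\frac{n}{2})}{\sqrt{\pi}\,\Gamma(\frac{n+1}{2})(1-|x|^2)}.$$ (2) For any $x\in\mathbb{H}^{n}$ and $l\in\mathbb{S}^{n-1}$, $$\mathbf{C}_{\mathbb{H}^{n},\frac{n}{n-1}}(x)\equiv\mathbf{C}_{\mathbb{H}^{n},\frac{n}{n-1}}(x;l)\equiv\frac{(n-1)\Gamma(\frac{n}{2})}{2^{n+1}\sqrt{\pi}\,x_{n}^{\frac{2n-1}{n}}}\left(\frac{\Gamma(\frac{2n-1}{2n-2})}{\Gamma(\frac{n^{2}}{2n-2})}\right)^{\frac{n-1}{n}}$$ and $$\mathbf{C}_{\mathbb{H}^{n},1}(x;l)\equiv\mathbf{C}_{\mathbb{H}^{n},1}(x)\equiv\frac{2\Gamma(\frac{n}{2})}{\sqrt{\pi}\,\G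amma(\frac{n-1}{2})\,x_{n}}.$$
   Context: $\langle\cdot,\cdot\rangle$ and $|\cdot|$ are the Euclidean inner product and norm on $\mathbb{R}^n$; $\mathbb{B}^n=\{|x|<1\}$, $\mathbb{S}^{n-1}=\{|x|=1\}$, $\mathbb{H}^n=\{x=(x',x_n): x'\in\mathbb{R}^{n-1},\,x_n>0\}$; $\partial\mathbb{H}^n$ is identified with $\mathbb{R}^{n-1}$. $\Gamma$ is the Gamma function. $\sigma$ is the surface measure on $\mathbb{S}^{n-1}$ normalized so that $\sigma(\mathbb{S}^{n-1})=1$, and $V_{n-1}$ is Lebesgue measure on $\mathbb{R}^{n-1}$. $L^p(\mathbb{S}^{n-1},\mathbb{R})$ and $L^p(\mathbb{R}^{n-1},\mathbb{R})$ are taken with respect to $\sigma$ and $V_{n-1}$ respectively. For $\phi\in L^p(\mathbb{S}^{n-1},\mathbb{R})$, $p\in[1,\infty]$, the Poisson–Szegő integral (for the hyperbolic Laplacian) is $$\mathcal{P}_{\mathbb{B}^n}[\phi](x)=\int_{\mathbb{S}^{n-1}}\Big(\frac{1-|x|^2}{|x-\zeta|^2}\Big)^{n-1}\phi(\zeta)\,d\sigma(\zeta),\quad x\in\mathbb{B}^n.$$ For $\phi\in L^p(\mathbb{R}^{n-1},\mathbb{R})$, $$\mathcal{P}_{\mathbb{H}^n}[\phi](x)=c_n\int_{\mathbb{R}^{n-1}}\Big(\frac{x_n}{|x'-y'|^2+x_n^2}\Big)^{n-1}\phi(y')\,dV_{n-1}(y'),\quad x\in\mathbb{H}^n,\qquad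 c_n=\frac{2^{n-2}\Gamma(n/2)}{\pi^{n/2}}.$$ Let $\Omega=\mathbb{B}^n$ or $\mathbb{H}^n$, $q\in[1,\infty]$ and $p$ its conjugate exponent ($1/p+1/q=1$, $1/\infty=0$). For $x\in\Omega$ and $l\in\mathbb{S}^{n-1}$, $\mathbf{C}_{\Omega,q}(x)$ and $\mathbf{C}_{\Omega,q}(x;l)$ denote the optimal (smallest) constants such that $$|\nabla u(x)|\leq \mathbf{C}_{\Omega,q}(x)\|\phi\|_{L^p(\partial\Omega,\mathbb{R})},\qquad |\langle\nabla u(x),l\rangle|\leq \mathbf{C}_{\Omega,q}(x;l)\|\phi\|_{L^p(\partial\Omega,\mathbb{R})}$$ hold for all $\phi\in L^p(\partial\Omega,\mathbb{R})$ with $u=\mathcal{P}_\Omega[\phi]$.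
   Formalization: In part (2), the printed formula for the constant with q = n/(n−1) is false for every n ≥ 3 (too small); the factor 2^{n+1}√π in its denominator is replaced by the correct 2^{1/n} π^{(2n−1)/(2n)}. All other formulas are as printed. *)

theory Defs
  imports
    "HOL-Analysis.Analysis"
    "HOL-Probability.Essential_Supremum"
begin

section \<open>Measures\<close>

text \<open>
  The normalized surface measure on the unit sphere, via polar coordinates:
  \<open>\<sigma>(A)\<close> is the proportion of the volume of the unit ball that lies in the cone
  \<open>{r\<zeta> | 0 < r < 1, \<zeta> \<in> A}\<close>.
  The point \<open>0\<close>, which is sent to \<open>0\<close> by \<open>x \<mapsto> x / |x|\<close>, is a null set.
\<close>

definition sphere_measure :: "'a::euclidean_space measure" where
  "sphere_measure =
     restrict_space
       (distr (uniform_measure lborel (ball 0 1)) borel (\<lambda>x. x /\<^sub>R norm x))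
       (sphere 0 1)"

lemma space_sphere_measure [simp]: "space sphere_measure = sphere 0 1"
  by (simp add: sphere_measure_def space_restrict_space)

lemma emeasure_sphere_measure:
  "emeasure (sphere_measure :: 'a::euclidean_space measure) (sphere 0 1) = 1"
proof -
  let ?U = "uniform_measure lborel (ball 0 1) :: 'a measure"
  let ?f = "\<lambda>x::'a. x /\<^sub>R norm x"
  have f: "?f \<in> ?U \<rightarrow>\<^sub>M borel"
    by measurable
  have pos: "emeasure lborel (ball 0 1 :: 'a set) \<noteq> 0"
    by (simp add: emeasure_lborel_ball_finite emeasure_ball unit_ball_vol_pos less_imp_neq[symmetric])
  have fin: "emeasure lborel (ball 0 1 :: 'a set) \<noteq> \<infinity>"
    using emeasure_lborel_ball_finite[of "0::'a" 1] by simp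
  have pre: "?f -` sphere 0 1 \<inter> space ?U = - {0}"
    by auto
  have "emeasure (sphere_measure :: 'a measure) (sphere 0 1) = emeasure (distr ?U borel ?f) (sphere 0 1)"
    unfolding sphere_measure_def by (subst emeasure_restrict_space) auto
  also have "\<dots> = emeasure ?U (- {0})"
    by (subst emeasure_distr[OF f]) (simp_all only: pre, auto)
  also have "\<dots> = emeasure lborel (ball 0 1 \<inter> - {0} :: 'a set) / emeasure lborel (ball 0 1 :: 'a set)"
    by (subst emeasure_uniform_measure) auto
  also have "ball 0 1 \<inter> - {0} = ball 0 1 - {0::'a}"
    by auto
  also have "emeasure lborel (ball 0 1 - {0::'a}) = emeasure lborel (ball 0 1 :: 'a set)"
    by (rule emeasure_Diff_null_set) auto
  also have "emeasure lborel (ball 0 1 :: 'a set) / emeasure lborel (ball 0 1 :: 'a set) = 1"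
    using pos fin by (simp add: ennreal_divide_self less_top)
  finally show ?thesis .
qed


section \<open>Lebesgue spaces with extended exponents\<close>

text \<open>
  Elements of \<open>L\<^sup>p\<close> are represented by Borel functions; every class contains one.
  The exponent lives in \<open>ennreal\<close>, so that \<open>\<infinity>\<close> is allowed.
\<close>

definition Lp_space :: "ennreal \<Rightarrow> 'b measure \<Rightarrow> ('b \<Rightarrow> real) set" where
  "Lp_space p M =
     {\<phi> \<in> borel_measurable M.
        if p = \<infinity> then esssup M (\<lambda>y. ennreal \<bar>\<phi> y\<bar>) < \<infinity>
        else integrable M (\<lambda>y. \<bar>\<phi> y\<bar> powr enn2real p)}"

definition Lp_norm :: "ennreal \<Rightarrow> 'b measure \<Rightarrow> ('b \<Rightarrow> real) \<Rightarrow> real" where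
  "Lp_norm p M \<phi> =
     (if p = \<infinity> then enn2real (esssup M (\<lambda>y. ennreal \<bar>\<phi> y\<bar>))
      else (LINT y|M. \<bar>\<phi> y\<bar> powr enn2real p) powr (1 / enn2real p))"

text \<open>
  In \<open>ennreal\<close> we have \<open>inverse 0 = \<infinity>\<close> and \<open>inverse \<infinity> = 0\<close>, so the formula
  also covers the endpoints.
\<close>

definition conjugate_exponent :: "ennreal \<Rightarrow> ennreal" where
  "conjugate_exponent q = inverse (1 - inverse q)"

lemma conjugate_exponent_iff:
  assumes "1 \<le> q"
  shows "inverse p + inverse q = 1 \<longleftrightarrow> p = conjugate_exponent q"
proof -
  have inv_le: "inverse q \<le> 1"
  proof (cases q)
    case (real r)
    then have "1 \<le> r"
      using assms by (simp add: ennreal_1[symmetric] del: ennreal_1)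
    then show ?thesis
      using real by (simp add: inverse_ennreal field_simps ennreal_1[symmetric] del: ennreal_1)
  qed simp
  have fin: "inverse q \<noteq> top"
    using inv_le by (auto simp: top_unique)
  have invinv: "inverse (inverse x) = x" for x :: ennreal
    by (cases x; cases "x = 0")
      (auto simp: inverse_ennreal ennreal_zero_less_top zero_less_iff_neq_zero less_le)
  have "inverse p + inverse q = 1 \<longleftrightarrow> inverse p = 1 - inverse q"
    using inv_le fin by (metis diff_add_cancel_ennreal ennreal_add_diff_cancel_right)
  also have "\<dots> \<longleftrightarrow> p = conjugate_exponent q"
    unfolding conjugate_exponent_def by (metis invinv)
  finally show ?thesis .
qed


section \<open>Poisson--Szego integrals\<close>

definition poisson_ball :: "('a::euclidean_space \<Rightarrow> real) \<Rightarrow> 'a \<Rightarrow> real" where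
  "poisson_ball \<phi> x =
     (LINT \<zeta>|sphere_measure.
        ((1 - (norm x)\<^sup>2) / (norm (x - \<zeta>))\<^sup>2) ^ (DIM('a) - 1) * \<phi> \<zeta>)"

text \<open>
  A point of the upper half-space is a pair \<open>(x', x\<^sub>n)\<close>, so the ambient space is the
  product \<open>'b \<times> real\<close> (with its Euclidean norm), and its dimension is \<open>n = DIM('b) + 1\<close>.
  With \<open>c\<^sub>n\<close> as below the kernel has total mass \<open>1\<close>.

  Pitfall: for \<open>q = n/(n-1)\<close> the optimal half-space constant has the factor
  \<open>c\<^sub>n powr (1/n) * (Gamma (n/2) / (2 * sqrt pi)) powr ((n-1)/n)\<close>, which equals
  \<open>Gamma (n/2) / (2 powr (1/n) * pi powr ((2*n-1)/(2*n)))\<close>. It is misprinted in the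
  literature as \<open>Gamma (n/2) / (2 ^ (n+1) * sqrt pi)\<close>, which is strictly smaller, so
  that the gradient estimate fails with the printed constant.
\<close>

definition half_space :: "('b::euclidean_space \<times> real) set" where
  "half_space = {x. snd x > 0}"

definition half_space_const :: "nat \<Rightarrow> real" where
  "half_space_const n = 2 ^ (n - 2) * Gamma (real n / 2) / pi powr (real n / 2)"

definition poisson_half_space :: "('b::euclidean_space \<Rightarrow> real) \<Rightarrow> 'b \<times> real \<Rightarrow> real" where
  "poisson_half_space \<phi> x =
     half_space_const DIM('b \<times> real) *
     (LINT y|lborel.
        (snd x / ((norm (fst x - y))\<^sup>2 + (snd x)\<^sup>2)) ^ (DIM('b \<times> real) - 1) * \<phi> y)"


section \<open>Optimal constants in the gradient estimates\<close>

definition gradient :: "('a::real_inner \<Rightarrow> real) \<Rightarrow> 'a \<Rightarrow> 'a" where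
  "gradient u x = (THE D. GDERIV u x :> D)"

lemma gradient_eq:
  assumes "GDERIV u x :> D"
  shows "gradient u x = D"
  unfolding gradient_def
proof (rule the_equality)
  show "GDERIV u x :> D"
    by (fact assms)
next
  fix E assume "GDERIV u x :> E"
  then have "(\<lambda>h. h \<bullet> E) = (\<lambda>h. h \<bullet> D)"
    using assms unfolding gderiv_def by (rule has_derivative_unique)
  then have "(E - D) \<bullet> E = (E - D) \<bullet> D"
    by meson
  then show "E = D"
    by (metis eq_iff_diff_eq_0 inner_diff_right inner_eq_zero_iff)
qed

text \<open>
  \<open>M\<close> is the measure on the boundary of the domain and \<open>P\<close> the Poisson--Szego operator.
  The infimum is taken in \<open>ennreal\<close>: it is \<open>\<infinity>\<close> when no finite constant is
  admissible, and otherwise it is itself admissible (\<open>Inf_const_attained\<close>), i.e. it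
  is the smallest constant.
\<close>

definition optimal_const ::
  "'b measure \<Rightarrow> (('b \<Rightarrow> real) \<Rightarrow> 'a::real_inner \<Rightarrow> real) \<Rightarrow> ennreal \<Rightarrow> 'a \<Rightarrow> ennreal" where
  "optimal_const M P q x =
     Inf {C. \<forall>\<phi> \<in> Lp_space (conjugate_exponent q) M.
            ennreal (norm (gradient (P \<phi>) x))
              \<le> C * ennreal (Lp_norm (conjugate_exponent q) M \<phi>)}"

definition optimal_const_dir ::
  "'b measure \<Rightarrow> (('b \<Rightarrow> real) \<Rightarrow> 'a::real_inner \<Rightarrow> real) \<Rightarrow> ennreal \<Rightarrow> 'a \<Rightarrow> 'a \<Rightarrow> ennreal" where
  "optimal_const_dir M P q x l =
     Inf {C. \<forall>\<phi> \<in> Lp_space (conjugate_exponent q) M.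
            ennreal \<bar>gradient (P \<phi>) x \<bullet> l\<bar>
              \<le> C * ennreal (Lp_norm (conjugate_exponent q) M \<phi>)}"

lemma Inf_const_attained:
  fixes a b :: "'c \<Rightarrow> real" and A :: "'c set"
  defines "S \<equiv> {C. \<forall>\<phi> \<in> A. ennreal (a \<phi>) \<le> C * ennreal (b \<phi>)}"
  assumes "S \<noteq> {}"
  shows "Inf S \<in> S"
proof -
  have "ennreal (a \<phi>) \<le> Inf S * ennreal (b \<phi>)" if "\<phi> \<in> A" for \<phi>
  proof (cases "b \<phi> \<le> 0")
    case True
    then show ?thesis
      using assms that by (auto simp: ennreal_neg)
  next
    case False
    have "ennreal (a \<phi>) / ennreal (b \<phi>) \<le> Inf S"
    proof (rule Inf_greatest)
      fix C assume "C \<in> S"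
      then have "ennreal (a \<phi>) \<le> C * ennreal (b \<phi>)"
        using that by (simp add: S_def)
      then show "ennreal (a \<phi>) / ennreal (b \<phi>) \<le> C"
        using False by (intro divide_le_posI_ennreal) (auto simp: mult.commute)
    qed
    then have "ennreal (a \<phi>) / ennreal (b \<phi>) * ennreal (b \<phi>) \<le> Inf S * ennreal (b \<phi>)"
      by (rule mult_right_mono) simp
    then show ?thesis
      using False by (simp add: ennreal_divide_times ennreal_mult_divide_eq)
  qed
  then show ?thesis
    by (simp add: S_def)
qed

abbreviation C_ball :: "ennreal \<Rightarrow> 'a::euclidean_space \<Rightarrow> ennreal" where
  "C_ball \<equiv> optimal_const sphere_measure poisson_ball"

abbreviation C_ball_dir :: "ennreal \<Rightarrow> 'a::euclidean_space \<Rightarrow> 'a \<Rightarrow> ennreal" where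
  "C_ball_dir \<equiv> optimal_const_dir sphere_measure poisson_ball"

abbreviation C_half_space :: "ennreal \<Rightarrow> 'b::euclidean_space \<times> real \<Rightarrow> ennreal" where
  "C_half_space \<equiv> optimal_const lborel poisson_half_space"

abbreviation C_half_space_dir ::
  "ennreal \<Rightarrow> 'b::euclidean_space \<times> real \<Rightarrow> 'b \<times> real \<Rightarrow> ennreal" where
  "C_half_space_dir \<equiv> optimal_const_dir lborel poisson_half_space"

end

theory Submission
  imports Defs
begin

text \<open>
  For either domain the gradient in \<open>x\<close> of the Poisson--Szego kernel \<open>K\<^sub>x\<close> is
  \<open>A(x) K\<^sub>x w\<^sub>x\<close> with a unit vector field \<open>w\<^sub>x\<close> on the boundary, and \<open>w\<^sub>x\<close> maps the harmonic
  measure \<open>K\<^sub>x\<close> to \<open>\<sigma>\<close>. In the half-space \<open>w\<^sub>x\<close> is a stereographic projection; in the ball it is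
  a Moebius transformation, which becomes one after composition with a stereographic projection.
  By duality \<open>C(x; l)\<close> is the \<open>L\<^sup>q\<close> norm of \<open>A(x) K\<^sub>x \<langle>w\<^sub>x, l\<rangle>\<close>, which turns into the integral of
  \<open>\<bar>\<langle>\<zeta>, l\<rangle>\<bar>\<^sup>q K\<^sub>x\<^sup>q\<^sup>-\<^sup>1\<close> over the sphere. For \<open>q = 1\<close> the kernel disappears, and for
  \<open>q = n/(n-1)\<close> its remaining power is an affine function \<open>\<alpha> + \<beta> \<langle>\<zeta>, e\<rangle>\<close>, whose odd part
  integrates to zero. In both cases the result does not depend on \<open>l\<close>.
\<close>

section \<open>Change of variables in Euclidean spaces\<close>

text \<open>The exponent n/(n-1) is special because the kernel is a constant times
  \<open>u ^ (n - 1)\<close> for a ratio \<open>u\<close>: its q-th power is a constant times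
  \<open>u ^ (n - 1) * u\<close>, the density of harmonic measure with one spare factor
  \<open>u\<close>. That factor is affine in the unit vector w. In the half-space the last
  coordinate of w is 1 - 2 t u at height t; in the ball u runs affinely from 1/t at one pole to t at
  the other, with t = (1 + |x|) / (1 - |x|), and the mean of these two values is (1 + |x|^2) / (1 -
  |x|^2). The obstacle is that \<open>sphere_measure\<close> is defined through volumes of cones, so
  the passage from the boundary to the sphere has to be a statement about volumes. It is made with
  the polar map \<open>(y, s) \<mapsto> s *\<^sub>R stereo a t y\<close>. Stereographic projection
  is conformal, hence the columns of the derivative are pairwise orthogonal and the Jacobian is a
  product of lengths; integrating out the radius contributes only a number. The same map, with the
  ball weighted by a power of the norm, yields the moments in closed form.\<close>

text \<open>
  The library states its change of variables theorems for \<open>real ^ 'n\<close> with a well-ordered index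
  type \<open>'n\<close>. Coordinates indexed by the standard basis carry them over to every Euclidean space.
\<close>

typedef (overloaded) 'a basis_index = "Basis :: 'a::euclidean_space set"
  using nonempty_Basis by blast

lemma bij_Rep_basis_index: "bij_betw Rep_basis_index UNIV Basis"
  unfolding bij_betw_def
  by (simp add: inj_on_def Rep_basis_index_inject
      type_definition.Rep_range[OF type_definition_basis_index])

instantiation basis_index :: (euclidean_space) "{finite, wellorder}"
begin

text \<open>The order is pulled back from a numbering of the finite basis, so that well-foundedness
  is inherited from \<open>nat\<close>.\<close>

definition less_eq_basis_index :: "'a basis_index \<Rightarrow> 'a basis_index \<Rightarrow> bool" where
  "i \<le> j \<longleftrightarrow> to_nat_on Basis (Rep_basis_index i) \<le> to_nat_on Basis (Rep_basis_index j)"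

definition less_basis_index :: "'a basis_index \<Rightarrow> 'a basis_index \<Rightarrow> bool" where
  "i < j \<longleftrightarrow> to_nat_on Basis (Rep_basis_index i) < to_nat_on Basis (Rep_basis_index j)"

instance
proof
  show "finite (UNIV :: 'a basis_index set)"
    using bij_betw_finite[OF bij_Rep_basis_index] by simp
next
  fix i j :: "'a basis_index"
  assume "i \<le> j" "j \<le> i"
  then have "to_nat_on Basis (Rep_basis_index i) = to_nat_on Basis (Rep_basis_index j)"
    by (simp add: less_eq_basis_index_def)
  then have "Rep_basis_index i = Rep_basis_index j"
    by (meson inj_on_to_nat_on inj_onD Rep_basis_index countable_finite finite_Basis)
  then show "i = j"
    by (simp add: Rep_basis_index_inject)
next
  fix P :: "'a basis_index \<Rightarrow> bool" and a
  assume step: "\<And>x. (\<And>y. y < x \<Longrightarrow> P y) \<Longrightarrow> P x"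
  show "P a"
  proof (induction a rule: measure_induct_rule[where f = "\<lambda>i. to_nat_on Basis (Rep_basis_index i)"])
    case (less x)
    show ?case
      by (rule step, rule less) (simp only: less_basis_index_def)
  qed
qed (auto simp: less_eq_basis_index_def less_basis_index_def)

end

text \<open>\<open>lborel\<close> is determined by its values on boxes, and a map that matches basis
  vectors pulls a box back to a box with the same side lengths. General isometries are later reduced
  to this case and to \<open>lborel_distr_orthogonal\<close>.\<close>

lemma lborel_distr_basis_bij:
  fixes T :: "'a::euclidean_space \<Rightarrow> 'b::euclidean_space"
  assumes "linear T" and bij: "bij_betw T Basis Basis"
    and inner: "\<And>x y. T x \<bullet> T y = x \<bullet> y"
  shows "distr lborel borel T = lborel"
proof (rule lborel_eqI[symmetric])
  have [measurable]: "T \<in> borel_measurable borel"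
    by (intro borel_measurable_continuous_onI linear_continuous_on linear_conv_bounded_linear[THEN iffD1] assms)
  have ball: "(\<forall>b\<in>Basis. P b) \<longleftrightarrow> (\<forall>b\<in>Basis. P (T b))" for P
    using bij unfolding bij_betw_def by (metis imageI image_iff)
  fix l u :: 'b
  assume le: "\<And>b. b \<in> Basis \<Longrightarrow> l \<bullet> b \<le> u \<bullet> b"
  define l' u' where "l' = (\<Sum>b\<in>Basis. (l \<bullet> T b) *\<^sub>R b)" and "u' = (\<Sum>b\<in>Basis. (u \<bullet> T b) *\<^sub>R b)"
  have [simp]: "l' \<bullet> b = l \<bullet> T b" "u' \<bullet> b = u \<bullet> T b" if "b \<in> Basis" for b
    using that by (simp_all add: l'_def u'_def)
  have "T -` box l u = box l' u'"
    unfolding box_def ball by (simp add: inner)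
  then have "emeasure (distr lborel borel T) (box l u) = emeasure lborel (box l' u')"
    by (subst emeasure_distr) simp_all
  also have "\<dots> = (\<Prod>b\<in>Basis. (u' - l') \<bullet> b)"
    using le bij_betwE[OF bij] by (intro emeasure_lborel_box) simp
  also have "(\<Prod>b\<in>Basis. (u' - l') \<bullet> b) = (\<Prod>b\<in>Basis. (u - l) \<bullet> T b)"
    by (intro prod.cong) (simp_all add: inner_diff_left)
  also have "\<dots> = (\<Prod>b\<in>Basis. (u - l) \<bullet> b)"
    by (rule prod.reindex_bij_betw[OF bij])
  finally show "emeasure (distr lborel borel T) (box l u) = (\<Prod>b\<in>Basis. (u - l) \<bullet> b)" .
qed simp

text \<open>Gram determinant: the matrix of inner products of the columns is diagonal, and its
  determinant is the square of the one sought. This spares any expansion of a Jacobian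
  determinant.\<close>

lemma abs_det_orthogonal_columns:
  fixes f :: "real^'n \<Rightarrow> real^'n"
  assumes orth: "\<And>i j. f (axis i 1) \<bullet> f (axis j 1) = (if i = j then (c i)\<^sup>2 else 0)"
    and nonneg: "\<And>i. 0 \<le> c i"
  shows "\<bar>det (matrix f)\<bar> = (\<Prod>i\<in>UNIV. c i)"
proof -
  have "transpose (matrix f) ** matrix f = (\<chi> i j. if i = j then (c i)\<^sup>2 else 0)"
    by (simp add: matrix_mult_transpose_dot_column column_def matrix_def vec_lambda_eta orth)
  then have "det (transpose (matrix f) ** matrix f) = (\<Prod>i\<in>UNIV. (c i)\<^sup>2)"
    by (simp add: det_diagonal)
  then have "(det (matrix f))\<^sup>2 = (\<Prod>i\<in>UNIV. c i)\<^sup>2"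
    by (simp add: det_mul power2_eq_square prod.distrib)
  then show ?thesis
    using nonneg by (metis abs_of_nonneg power2_eq_iff abs_minus_cancel prod_nonneg)
qed

text \<open>Boundedness of the image makes its measure finite, as
  \<open>has_measure_differentiable_image\<close> requires, since that theorem speaks of real-valued
  measures. The determinant is then read off from the lengths of the columns.\<close>

lemma emeasure_image_orthogonal_jacobian_vec:
  fixes g :: "real^'n::{finite,wellorder} \<Rightarrow> real^'n::_"
  assumes "S \<in> sets borel"
    and der: "\<And>x. x \<in> S \<Longrightarrow> (g has_derivative D x) (at x within S)"
    and "inj_on g S" "g ` S \<in> sets borel" "bounded (g ` S)"
    and orth: "\<And>x i j. x \<in> S \<Longrightarrow>
       D x (axis i 1) \<bullet> D x (axis j 1) = (if i = j then (c x i)\<^sup>2 else 0)"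
    and nonneg: "\<And>x i. x \<in> S \<Longrightarrow> 0 \<le> c x i"
  shows "emeasure lborel (g ` S) = (\<integral>\<^sup>+x. indicator S x * ennreal (\<Prod>i\<in>UNIV. c x i) \<partial>lborel)"
proof -
  have meas: "g ` S \<in> lmeasurable"
    using assms by (simp add: bounded_set_imp_lmeasurable)
  have S: "S \<in> sets lebesgue"
    using assms by simp
  have "((\<lambda>x. \<bar>det (matrix (D x))\<bar>) has_integral measure lebesgue (g ` S)) S"
    using has_measure_differentiable_image[OF S der \<open>inj_on g S\<close>] meas by blast
  then have "((\<lambda>x. \<Prod>i\<in>UNIV. c x i) has_integral measure lebesgue (g ` S)) S"
    by (rule has_integral_eq[rotated]) (use orth nonneg in \<open>simp add: abs_det_orthogonal_columns\<close>)
  then have "(\<integral>\<^sup>+x. ennreal (indicator S x * (\<Prod>i\<in>UNIV. c x i)) \<partial>lborel) = measure lebesgue (g ` S)"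
    by (rule nn_integral_has_integral_lebesgue[rotated]) (simp add: nonneg prod_nonneg)
  also have "(\<lambda>x. ennreal (indicator S x * (\<Prod>i\<in>UNIV. c x i))) =
      (\<lambda>x. indicator S x * ennreal (\<Prod>i\<in>UNIV. c x i))"
    by (auto simp: fun_eq_iff indicator_def)
  also have "ennreal (measure lebesgue (g ` S)) = emeasure lborel (g ` S)"
    using emeasure_eq_measure2[OF meas] \<open>g ` S \<in> sets borel\<close>
    by (simp add: main_part_sets)
  finally show ?thesis
    by simp
qed

definition basis_vec :: "'a::euclidean_space \<Rightarrow> real^'a basis_index" where
  "basis_vec x = (\<chi> i. x \<bullet> Rep_basis_index i)"

definition of_basis_vec :: "real^'a::euclidean_space basis_index \<Rightarrow> 'a" where
  "of_basis_vec v = (\<Sum>i\<in>UNIV. v $ i *\<^sub>R Rep_basis_index i)"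

lemma of_basis_vec_basis_vec [simp]: "of_basis_vec (basis_vec x) = x"
  unfolding of_basis_vec_def basis_vec_def
  using sum.reindex_bij_betw[OF bij_Rep_basis_index, of "\<lambda>b. (x \<bullet> b) *\<^sub>R b"]
  by (simp add: euclidean_representation)

lemma basis_vec_of_basis_vec [simp]: "basis_vec (of_basis_vec v) = v"
proof -
  have *: "Rep_basis_index i \<bullet> Rep_basis_index j = (if i = j then 1 else 0)" for i j :: "'a basis_index"
    using Rep_basis_index[of i] Rep_basis_index[of j]
    by (simp add: inner_Basis Rep_basis_index_inject)
  show ?thesis
    by (simp add: basis_vec_def of_basis_vec_def inner_sum_left vec_eq_iff * if_distrib[where f = "\<lambda>c. _ * c"] cong: if_cong)
qed

lemma linear_basis_vec: "linear basis_vec"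
  by (rule linearI) (simp_all add: basis_vec_def vec_eq_iff inner_add_left)

lemma linear_of_basis_vec: "linear of_basis_vec"
  by (rule linearI) (simp_all add: of_basis_vec_def scaleR_add_left sum.distrib scaleR_sum_right)

lemma of_basis_vec_axis: "of_basis_vec (axis i 1) = Rep_basis_index i"
  by (simp add: of_basis_vec_def axis_def if_distrib[where f = "\<lambda>c. c *\<^sub>R _"] cong: if_cong)

lemma inner_basis_vec [simp]: "basis_vec x \<bullet> basis_vec y = x \<bullet> y"
proof -
  have "basis_vec x \<bullet> basis_vec y = (\<Sum>b\<in>Basis. (x \<bullet> b) * (y \<bullet> b))"
    unfolding inner_vec_def basis_vec_def
    using sum.reindex_bij_betw[OF bij_Rep_basis_index, of "\<lambda>b. (x \<bullet> b) * (y \<bullet> b)"] by simp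
  then show ?thesis
    by (simp add: euclidean_inner[of x y])
qed

lemma inner_of_basis_vec [simp]: "of_basis_vec v \<bullet> of_basis_vec w = v \<bullet> w"
  by (metis inner_basis_vec basis_vec_of_basis_vec)

lemma bij_of_basis_vec: "bij_betw of_basis_vec Basis (Basis :: 'a::euclidean_space set)"
proof -
  have B: "Basis = range (\<lambda>i. axis i (1::real) :: real^'a basis_index)"
    by (auto simp: Basis_vec_def)
  have "of_basis_vec ` Basis = (Basis :: 'a set)"
    using bij_Rep_basis_index[where 'a = 'a]
    by (simp add: B image_image of_basis_vec_axis bij_betw_def)
  moreover have "inj_on of_basis_vec (Basis :: (real^'a basis_index) set)"
    by (metis basis_vec_of_basis_vec inj_onI)
  ultimately show ?thesis
    by (simp add: bij_betw_def)
qed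

lemma measurable_of_basis_vec [measurable]: "of_basis_vec \<in> borel_measurable borel"
  by (intro borel_measurable_continuous_onI linear_continuous_on linear_conv_bounded_linear[THEN iffD1] linear_of_basis_vec)

lemma lborel_distr_of_basis_vec: "distr lborel borel of_basis_vec = lborel"
  by (rule lborel_distr_basis_bij[OF linear_of_basis_vec bij_of_basis_vec]) simp

lemma nn_integral_of_basis_vec:
  "f \<in> borel_measurable borel \<Longrightarrow> (\<integral>\<^sup>+v. f (of_basis_vec v) \<partial>lborel) = (\<integral>\<^sup>+x. f x \<partial>lborel)"
  by (subst lborel_distr_of_basis_vec[symmetric], subst nn_integral_distr) simp_all

text \<open>The coordinate version is applied to \<open>g\<close> conjugated with
  \<open>basis_vec\<close>. Coordinates preserve inner products and \<open>lborel\<close> and match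
  the axes with the standard basis, so the orthogonality relations and the lengths \<open>c\<close>
  carry over unchanged.\<close>

lemma emeasure_image_orthogonal_jacobian:
  fixes g :: "'a::euclidean_space \<Rightarrow> 'a"
  assumes [measurable]: "S \<in> sets borel"
    and der: "\<And>x. x \<in> S \<Longrightarrow> (g has_derivative D x) (at x within S)"
    and inj: "inj_on g S" and gS [measurable]: "g ` S \<in> sets borel" and bdd: "bounded (g ` S)"
    and orth: "\<And>x i j. x \<in> S \<Longrightarrow> i \<in> Basis \<Longrightarrow> j \<in> Basis \<Longrightarrow>
       D x i \<bullet> D x j = (if i = j then (c x i)\<^sup>2 else 0)"
    and nonneg: "\<And>x i. x \<in> S \<Longrightarrow> i \<in> Basis \<Longrightarrow> 0 \<le> c x i"
    and [measurable]: "(\<lambda>x. \<Prod>i\<in>Basis. c x i) \<in> borel_measurable borel"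
  shows "emeasure lborel (g ` S) = (\<integral>\<^sup>+x. indicator S x * ennreal (\<Prod>i\<in>Basis. c x i) \<partial>lborel)"
proof -
  let ?S = "of_basis_vec -` S" and ?g = "\<lambda>v. basis_vec (g (of_basis_vec v))"
  have img: "?g ` ?S = of_basis_vec -` (g ` S)"
  proof
    show "?g ` ?S \<subseteq> of_basis_vec -` g ` S"
      by auto
    show "of_basis_vec -` g ` S \<subseteq> ?g ` ?S"
    proof
      fix v assume "v \<in> of_basis_vec -` g ` S"
      then obtain x where "x \<in> S" "of_basis_vec v = g x"
        by auto
      then have "basis_vec x \<in> ?S" "v = ?g (basis_vec x)"
        by (simp, metis basis_vec_of_basis_vec of_basis_vec_basis_vec)
      then show "v \<in> ?g ` ?S"
        by blast
    qed
  qed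
  have pre: "of_basis_vec -` A \<in> sets borel" if "A \<in> sets borel" for A :: "'a set"
    using measurable_sets[OF measurable_of_basis_vec that] by simp
  have "emeasure lborel (g ` S) = (\<integral>\<^sup>+x. indicator (g ` S) x \<partial>lborel)"
    by simp
  also have "\<dots> = (\<integral>\<^sup>+v. indicator (g ` S) (of_basis_vec v) \<partial>lborel)"
    by (rule nn_integral_of_basis_vec[symmetric]) simp
  also have "\<dots> = (\<integral>\<^sup>+v. indicator (?g ` ?S) v \<partial>lborel)"
    unfolding img by (intro nn_integral_cong) (simp add: indicator_def)
  also have "\<dots> = emeasure lborel (?g ` ?S)"
    by (rule nn_integral_indicator) (simp only: img, simp add: pre gS)
  also have "\<dots> = (\<integral>\<^sup>+v. indicator ?S v * ennreal (\<Prod>i\<in>UNIV. c (of_basis_vec v) (Rep_basis_index i)) \<partial>lborel)"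
  proof (rule emeasure_image_orthogonal_jacobian_vec
      [where D = "\<lambda>v h. basis_vec (D (of_basis_vec v) (of_basis_vec h))"])
    show "?S \<in> sets borel" "?g ` ?S \<in> sets borel"
      unfolding img by (simp_all add: pre gS)
    show "bounded (?g ` ?S)"
      using bounded_linear_image[OF bdd linear_conv_bounded_linear[THEN iffD1, OF linear_basis_vec]]
      by (rule bounded_subset) auto
    show "inj_on ?g ?S"
      by (rule inj_onI) (metis basis_vec_of_basis_vec of_basis_vec_basis_vec inj inj_onD vimageE)
    show "(?g has_derivative (\<lambda>h. basis_vec (D (of_basis_vec v) (of_basis_vec h)))) (at v within ?S)"
      if "v \<in> ?S" for v
    proof -
      have "(of_basis_vec has_derivative of_basis_vec) (at v within ?S)"
        by (rule linear_imp_has_derivative[OF linear_of_basis_vec])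
      moreover have "(g has_derivative D (of_basis_vec v)) (at (of_basis_vec v) within of_basis_vec ` ?S)"
        using der[of "of_basis_vec v"] that by (auto intro: has_derivative_subset)
      ultimately have "((\<lambda>v. g (of_basis_vec v)) has_derivative (\<lambda>h. D (of_basis_vec v) (of_basis_vec h))) (at v within ?S)"
        by (rule has_derivative_in_compose)
      from bounded_linear.has_derivative[OF linear_conv_bounded_linear[THEN iffD1, OF linear_basis_vec] this]
      show ?thesis .
    qed
  qed (use orth nonneg in \<open>auto simp: of_basis_vec_axis Rep_basis_index_inject Rep_basis_index[where 'a = 'a]\<close>)
  also have "\<dots> = (\<integral>\<^sup>+v. indicator S (of_basis_vec v) * ennreal (\<Prod>i\<in>Basis. c (of_basis_vec v) i) \<partial>lborel)"
    by (intro nn_integral_cong) (simp add: indicator_def prod.reindex_bij_betw[OF bij_Rep_basis_index])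
  also have "\<dots> = (\<integral>\<^sup>+x. indicator S x * ennreal (\<Prod>i\<in>Basis. c x i) \<partial>lborel)"
    by (rule nn_integral_of_basis_vec) measurable
  finally show ?thesis .
qed

theorem nn_integral_orthogonal_jacobian:
  fixes g :: "'a::euclidean_space \<Rightarrow> 'a"
  assumes S [measurable]: "S \<in> sets borel"
    and der: "\<And>x. x \<in> S \<Longrightarrow> (g has_derivative D x) (at x within S)"
    and inj: "inj_on g S" and gS [measurable]: "g ` S \<in> sets borel" and bdd: "bounded (g ` S)"
    and g [measurable]: "g \<in> borel_measurable borel"
    and orth: "\<And>x i j. x \<in> S \<Longrightarrow> i \<in> Basis \<Longrightarrow> j \<in> Basis \<Longrightarrow>
       D x i \<bullet> D x j = (if i = j then (c x i)\<^sup>2 else 0)"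
    and nonneg: "\<And>x i. x \<in> S \<Longrightarrow> i \<in> Basis \<Longrightarrow> 0 \<le> c x i"
    and [measurable]: "(\<lambda>x. \<Prod>i\<in>Basis. c x i) \<in> borel_measurable borel"
    and [measurable]: "f \<in> borel_measurable borel"
  shows "(\<integral>\<^sup>+x. indicator (g ` S) x * f x \<partial>lborel) =
    (\<integral>\<^sup>+x. indicator S x * (ennreal (\<Prod>i\<in>Basis. c x i) * f (g x)) \<partial>lborel)"
proof -
  let ?J = "\<lambda>x. indicator S x * ennreal (\<Prod>i\<in>Basis. c x i)"
  let ?M = "distr (density lborel ?J) borel g"
  have "density lborel (indicator (g ` S)) = ?M"
  proof (rule measure_eqI)
    fix A assume "A \<in> sets (density lborel (indicator (g ` S)))"
    then have A [measurable]: "A \<in> sets borel"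
      by simp
    have gA: "g -` A \<in> sets borel"
      using measurable_sets[OF g A] by simp
    have img: "g ` (S \<inter> g -` A) = g ` S \<inter> A"
      by auto
    have "emeasure (density lborel (indicator (g ` S))) A = emeasure lborel (g ` (S \<inter> g -` A))"
      unfolding img by (subst emeasure_density) (auto simp: nn_integral_indicator[symmetric] indicator_inter_arith simp del: nn_integral_indicator)
    also have "\<dots> = (\<integral>\<^sup>+x. indicator (S \<inter> g -` A) x * ennreal (\<Prod>i\<in>Basis. c x i) \<partial>lborel)"
    proof (rule emeasure_image_orthogonal_jacobian)
      show "(g has_derivative D x) (at x within S \<inter> g -` A)" if "x \<in> S \<inter> g -` A" for x
        using der that by (auto intro: has_derivative_subset)
      show "inj_on g (S \<inter> g -` A)"
        using inj by (auto intro: inj_on_subset)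
      show "bounded (g ` (S \<inter> g -` A))"
        using bdd by (rule bounded_subset) auto
      show "g ` (S \<inter> g -` A) \<in> sets borel"
        unfolding img by simp
    qed (use gA orth nonneg in auto)
    also have "\<dots> = emeasure ?M A"
      using gA
      by (subst emeasure_distr, simp, simp, subst emeasure_density)
        (auto intro!: nn_integral_cong simp: indicator_def)
    finally show "emeasure (density lborel (indicator (g ` S))) A = emeasure ?M A" .
  qed simp
  then have "(\<integral>\<^sup>+x. indicator (g ` S) x * f x \<partial>lborel) = integral\<^sup>N ?M f"
    by (subst nn_integral_density[symmetric]) simp_all
  also have "\<dots> = (\<integral>\<^sup>+x. f (g x) \<partial>density lborel ?J)"
    by (rule nn_integral_distr) simp_all
  also have "\<dots> = (\<integral>\<^sup>+x. indicator S x * (ennreal (\<Prod>i\<in>Basis. c x i) * f (g x)) \<partial>lborel)"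
    by (subst nn_integral_density) (simp_all add: mult.assoc)
  finally show ?thesis .
qed


section \<open>Isometries and the surface measure\<close>

text \<open>A linear map is its own derivative and the images of the basis are orthonormal, so the
  Jacobian factor is 1. Working with the preimage of a box keeps the image bounded.\<close>

lemma lborel_distr_orthogonal:
  fixes R :: "'a::euclidean_space \<Rightarrow> 'a"
  assumes R: "orthogonal_transformation R"
  shows "distr lborel borel R = lborel"
proof (rule lborel_eqI[symmetric])
  have lin: "linear R"
    using R by (rule orthogonal_transformation_linear)
  have [measurable]: "R \<in> borel_measurable borel"
    by (intro borel_measurable_continuous_onI linear_continuous_on linear_conv_bounded_linear[THEN iffD1] lin)
  fix l u :: 'a
  assume le: "\<And>b. b \<in> Basis \<Longrightarrow> l \<bullet> b \<le> u \<bullet> b"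
  let ?S = "R -` box l u"
  have S [measurable]: "?S \<in> sets borel"
    using measurable_sets[of R borel borel "box l u"] by simp
  have img: "R ` ?S = box l u"
    using orthogonal_transformation_surj[OF R] by (simp add: surj_image_vimage_eq)
  have "emeasure lborel (R ` ?S) = (\<integral>\<^sup>+x. indicator ?S x * ennreal (\<Prod>i\<in>(Basis :: 'a set). 1) \<partial>lborel)"
  proof (rule emeasure_image_orthogonal_jacobian[where D = "\<lambda>_. R"])
    show "inj_on R ?S"
      using orthogonal_transformation_inj[OF R] by (rule inj_on_subset) simp
    show "R i \<bullet> R j = (if i = j then 1\<^sup>2 else 0)" if "i \<in> Basis" "j \<in> Basis" for i j
      using R that by (simp add: orthogonal_transformation_def inner_Basis)
  qed (simp_all only: img, simp_all add: linear_imp_has_derivative lin)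
  then have "emeasure lborel (box l u) = emeasure lborel ?S"
    unfolding img by simp
  then show "emeasure (distr lborel borel R) (box l u) = (\<Prod>b\<in>Basis. (u - l) \<bullet> b)"
    using le by (simp add: emeasure_distr)
qed simp

text \<open>The change of variables concerns maps of a space to itself. Hence \<open>T\<close> is
  factored as \<open>V \<circ> (U \<circ> T)\<close>, where \<open>V\<close> carries one standard
  basis to the other, \<open>U\<close> inverts it, and \<open>U \<circ> T\<close> is
  orthogonal.\<close>

lemma lborel_distr_isometry:
  fixes T :: "'a::euclidean_space \<Rightarrow> 'b::euclidean_space"
  assumes lin: "linear T" and inner: "\<And>x y. T x \<bullet> T y = x \<bullet> y"
    and dim: "DIM('a) = DIM('b)"
  shows "distr lborel borel T = lborel"
proof -
  obtain h where h: "bij_betw h (Basis :: 'a set) (Basis :: 'b set)"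
    using dim by (metis finite_same_card_bij finite_Basis)
  define V :: "'a \<Rightarrow> 'b" where "V x = (\<Sum>b\<in>Basis. (x \<bullet> b) *\<^sub>R h b)" for x
  define U :: "'b \<Rightarrow> 'a" where "U y = (\<Sum>b\<in>Basis. (y \<bullet> h b) *\<^sub>R b)" for y
  have [measurable]: "f \<in> borel_measurable borel" if "linear f" for f :: "'c::euclidean_space \<Rightarrow> 'd::euclidean_space"
    by (intro borel_measurable_continuous_onI linear_continuous_on linear_conv_bounded_linear[THEN iffD1] that)
  have linV: "linear V"
    by (rule linearI) (simp_all add: V_def inner_add_left scaleR_add_left sum.distrib scaleR_sum_right)
  have linU: "linear U"
    by (rule linearI) (simp_all add: U_def inner_add_left scaleR_add_left sum.distrib scaleR_sum_right)
  have hh: "h b \<bullet> h b' = (if b = b' then 1 else 0)" if "b \<in> Basis" "b' \<in> Basis" for b b'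
    using that bij_betwE[OF h] bij_betw_imp_inj_on[OF h] by (auto simp: inner_Basis inj_on_def)
  have Vb: "V b = h b" if "b \<in> Basis" for b
  proof -
    have "V b = (\<Sum>b'\<in>Basis. (if b' = b then h b' else 0))"
      unfolding V_def using that by (intro sum.cong) (auto simp: inner_Basis)
    then show ?thesis
      using that by simp
  qed
  have hV: "V x \<bullet> h b = x \<bullet> b" if "b \<in> Basis" for x b
  proof -
    have "V x \<bullet> h b = (\<Sum>b'\<in>Basis. (if b' = b then x \<bullet> b' else 0))"
      unfolding V_def inner_sum_left using that by (intro sum.cong) (auto simp: hh)
    then show ?thesis
      using that by simp
  qed
  have VV: "V x \<bullet> V y = x \<bullet> y" for x y
  proof -
    have "V x \<bullet> V y = (\<Sum>b\<in>Basis. (y \<bullet> b) * (V x \<bullet> h b))"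
      unfolding V_def[of y] by (simp add: inner_sum_right)
    also have "\<dots> = (\<Sum>b\<in>Basis. (x \<bullet> b) * (y \<bullet> b))"
      by (intro sum.cong) (simp_all add: hV)
    finally show ?thesis
      by (simp add: euclidean_inner[of x y])
  qed
  have VU: "V (U y) = y" for y
  proof -
    have "V (U y) = (\<Sum>b\<in>Basis. (y \<bullet> h b) *\<^sub>R h b)"
      unfolding V_def[of "U y"] by (intro sum.cong) (simp_all add: U_def)
    also have "\<dots> = (\<Sum>b\<in>Basis. (y \<bullet> b) *\<^sub>R b)"
      by (rule sum.reindex_bij_betw[OF h])
    finally show ?thesis
      by (simp add: euclidean_representation)
  qed
  have "V ` Basis = Basis" "inj_on V Basis"
    using h by (auto simp: bij_betw_def Vb inj_on_def image_def)
  then have V: "distr lborel borel V = lborel"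
    using linV VV by (intro lborel_distr_basis_bij) (simp_all add: bij_betw_def)
  have "U (T x) \<bullet> U (T y) = x \<bullet> y" for x y
    by (metis VU VV inner)
  then have "orthogonal_transformation (U \<circ> T)"
    unfolding orthogonal_transformation_def using linU lin by (simp add: linear_compose)
  then have R: "distr lborel borel (U \<circ> T) = lborel"
    by (rule lborel_distr_orthogonal)
  have "distr lborel borel T = distr lborel borel (V \<circ> (U \<circ> T))"
    by (simp add: comp_def VU)
  also have "\<dots> = distr (distr lborel borel (U \<circ> T)) borel V"
    using linU linV lin by (subst distr_distr) (auto intro!: measurable_comp)
  finally show ?thesis
    by (simp add: R V)
qed

text \<open>Serves to identify the space of the ball with a product \<open>'b \<times> real\<close>,
  where stereographic coordinates exist. Preservation of inner products follows from that of norms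
  by polarization.\<close>

lemma exists_linear_isometry:
  assumes "DIM('a::euclidean_space) = DIM('b::euclidean_space)"
  shows "\<exists>T :: 'a \<Rightarrow> 'b. linear T \<and> (\<forall>x y. T x \<bullet> T y = x \<bullet> y)"
proof -
  obtain T :: "'a \<Rightarrow> 'b" where "linear T" and norm: "\<And>x. norm (T x) = norm x"
    using isometry_subspaces[of "UNIV :: 'a set" "UNIV :: 'b set"] assms
    by (metis UNIV_I dim_UNIV subspace_UNIV)
  then have "T x \<bullet> T y = x \<bullet> y" for x y
    by (simp add: dot_norm linear_add[symmetric])
  then show ?thesis
    using \<open>linear T\<close> by blast
qed

lemma exists_orthogonal_transformation:
  fixes a b :: "'a::euclidean_space"
  assumes "norm a = norm b"
  shows "\<exists>R. orthogonal_transformation R \<and> R a = b"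
proof (cases "a = b")
  case True
  then show ?thesis
    by (intro exI[of _ id]) (simp add: orthogonal_transformation_def id_def)
next
  case False
  define u where "u = a - b"
  \<comment> \<open>Householder reflection in the hyperplane orthogonal to \<open>a - b\<close>; it
    takes \<open>a\<close> to \<open>b\<close> because equal norms give
    \<open>2 * (u \<bullet> a) = u \<bullet> u\<close>.\<close>
  define R where "R x = x - (2 * (u \<bullet> x) / (u \<bullet> u)) *\<^sub>R u" for x
  have u: "u \<bullet> u \<noteq> 0"
    using False by (simp add: u_def)
  have "linear R"
    by (rule linearI) (simp_all add: R_def inner_add_right scaleR_add_left scaleR_diff_right add_divide_distrib distrib_left)
  moreover have "R x \<bullet> R y = x \<bullet> y" for x y
    using u by (simp add: R_def inner_diff_left inner_diff_right inner_commute[of x u] field_simps)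
  moreover have "R a = b"
  proof -
    have "a \<bullet> a = b \<bullet> b"
      using assms by (simp add: norm_eq)
    then have "2 * (u \<bullet> a) = u \<bullet> u"
      by (simp add: u_def inner_diff_left inner_diff_right inner_commute)
    then show ?thesis
      using u by (simp add: R_def) (simp add: u_def)
  qed
  ultimately show ?thesis
    unfolding orthogonal_transformation_def by blast
qed

lemma nn_integral_sphere_measure:
  fixes f :: "'a::euclidean_space \<Rightarrow> ennreal"
  assumes [measurable]: "f \<in> borel_measurable borel"
  shows "(\<integral>\<^sup>+\<zeta>. f \<zeta> \<partial>sphere_measure) =
    (\<integral>\<^sup>+x. indicator (ball 0 1) x * f (x /\<^sub>R norm x) \<partial>lborel) / ennreal (unit_ball_vol DIM('a))"
proof -
  let ?U = "uniform_measure lborel (ball 0 1) :: 'a measure"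
  let ?g = "\<lambda>x::'a. x /\<^sub>R norm x"
  have null: "AE x in lborel. (x::'a) \<noteq> 0"
    by (rule AE_lborel_singleton)
  have [measurable]: "ball 0 1 \<in> sets (borel :: 'a measure)" "sphere 0 1 \<in> sets (borel :: 'a measure)"
    by (simp_all add: borel_closed)
  have "(\<integral>\<^sup>+\<zeta>. f \<zeta> \<partial>sphere_measure) = (\<integral>\<^sup>+\<zeta>. f \<zeta> * indicator (sphere 0 1) \<zeta> \<partial>distr ?U borel ?g)"
    unfolding sphere_measure_def by (subst nn_integral_restrict_space) auto
  also have "\<dots> = (\<integral>\<^sup>+x. f (?g x) * indicator (sphere 0 1) (?g x) \<partial>?U)"
    by (rule nn_integral_distr) measurable
  also have "\<dots> = (\<integral>\<^sup>+x. f (?g x) * indicator (sphere 0 1) (?g x) * indicator (ball 0 1) x \<partial>lborel)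
      / emeasure lborel (ball 0 1 :: 'a set)"
    by (subst nn_integral_uniform_measure) simp_all
  \<comment> \<open>The radial projection lands on the sphere except at the origin, which it fixes;
    that single point is a null set.\<close>
  also have "(\<integral>\<^sup>+x. f (?g x) * indicator (sphere 0 1) (?g x) * indicator (ball 0 1) x \<partial>lborel)
     = (\<integral>\<^sup>+x. indicator (ball 0 1) x * f (?g x) \<partial>lborel)"
    by (intro nn_integral_cong_AE, use null in eventually_elim) (auto simp: indicator_def)
  finally show ?thesis
    by (simp add: emeasure_ball)
qed

lemma nn_integral_sphere_measure_isometry:
  fixes T :: "'a::euclidean_space \<Rightarrow> 'b::euclidean_space"
  assumes lin: "linear T" and inner: "\<And>x y. T x \<bullet> T y = x \<bullet> y"
    and dim: "DIM('a) = DIM('b)" and [measurable]: "f \<in> borel_measurable borel"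
  shows "(\<integral>\<^sup>+\<zeta>. f (T \<zeta>) \<partial>sphere_measure) = (\<integral>\<^sup>+\<zeta>. f \<zeta> \<partial>sphere_measure)"
proof -
  have [measurable]: "T \<in> borel_measurable borel"
    by (intro borel_measurable_continuous_onI linear_continuous_on linear_conv_bounded_linear[THEN iffD1] lin)
  have norm: "norm (T x) = norm x" for x
    by (simp add: norm_eq_sqrt_inner inner)
  have [measurable]: "ball 0 1 \<in> sets (borel :: 'b measure)"
    by simp
  have "(\<integral>\<^sup>+x. indicator (ball 0 1) x * f (x /\<^sub>R norm x) \<partial>lborel) =
      (\<integral>\<^sup>+x. indicator (ball 0 1) x * f (x /\<^sub>R norm x) \<partial>distr lborel borel T)"
    by (simp add: lborel_distr_isometry[OF lin inner dim])
  also have "\<dots> = (\<integral>\<^sup>+x. indicator (ball 0 1) (T x) * f (T x /\<^sub>R norm (T x)) \<partial>lborel)"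
    by (rule nn_integral_distr) measurable
  also have "\<dots> = (\<integral>\<^sup>+x. indicator (ball 0 1) x * f (T (x /\<^sub>R norm x)) \<partial>lborel)"
    by (intro nn_integral_cong) (simp add: norm indicator_def linear_scale[OF lin])
  finally show ?thesis
    by (simp add: nn_integral_sphere_measure dim)
qed

lemma borel_measurable_sphere_measure:
  "f \<in> borel_measurable borel \<Longrightarrow> f \<in> borel_measurable sphere_measure"
  unfolding sphere_measure_def by (rule measurable_restrict_space1) simp

text \<open>The antipodal map turns \<beta> into -\<beta> without changing the integral, so the
  linear term disappears from the average of the two. The bound on \<beta> keeps both weights
  nonnegative, so that truncation by \<open>ennreal\<close> does not interfere with adding
  them.\<close>

lemma nn_integral_sphere_measure_reflect:
  fixes f :: "'a::euclidean_space \<Rightarrow> ennreal"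
  assumes [measurable]: "f \<in> borel_measurable borel" and even: "\<And>x. f (- x) = f x"
    and "\<bar>\<beta>\<bar> \<le> \<alpha>" "norm e = 1"
  shows "(\<integral>\<^sup>+\<zeta>. f \<zeta> * ennreal (\<alpha> + \<beta> * (\<zeta> \<bullet> e)) \<partial>sphere_measure) =
    ennreal \<alpha> * (\<integral>\<^sup>+\<zeta>. f \<zeta> \<partial>sphere_measure)"
proof -
  let ?I = "\<lambda>\<beta>. \<integral>\<^sup>+\<zeta>. f \<zeta> * ennreal (\<alpha> + \<beta> * (\<zeta> \<bullet> e)) \<partial>sphere_measure"
  have [measurable]: "g \<in> borel_measurable sphere_measure" if "g \<in> borel_measurable borel"
    for g :: "'a \<Rightarrow> ennreal"
    using that by (rule borel_measurable_sphere_measure)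
  have "?I \<beta> = ?I (- \<beta>)"
  proof -
    have "(\<integral>\<^sup>+\<zeta>. f (- \<zeta>) * ennreal (\<alpha> + \<beta> * (- \<zeta> \<bullet> e)) \<partial>sphere_measure) = ?I \<beta>"
      by (rule nn_integral_sphere_measure_isometry[where T = uminus])
        (simp_all add: linear_iff)
    then show ?thesis
      by (simp add: even)
  qed
  then have "2 * ?I \<beta> = ?I \<beta> + ?I (- \<beta>)"
    by (simp add: mult_2)
  also have "\<dots> = (\<integral>\<^sup>+\<zeta>. f \<zeta> * ennreal (\<alpha> + \<beta> * (\<zeta> \<bullet> e)) + f \<zeta> * ennreal (\<alpha> + (- \<beta>) * (\<zeta> \<bullet> e)) \<partial>sphere_measure)"
    by (rule nn_integral_add[symmetric]) simp_all
  also have "\<dots> = (\<integral>\<^sup>+\<zeta>. ennreal (2 * \<alpha>) * f \<zeta> \<partial>sphere_measure)"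
  proof (rule nn_integral_cong)
    fix \<zeta> :: 'a assume "\<zeta> \<in> space sphere_measure"
    then have "\<bar>\<zeta> \<bullet> e\<bar> \<le> 1"
      using Cauchy_Schwarz_ineq2[of \<zeta> e] \<open>norm e = 1\<close> by simp
    then have "\<bar>\<beta> * (\<zeta> \<bullet> e)\<bar> \<le> \<alpha>"
      using mult_mono[OF \<open>\<bar>\<beta>\<bar> \<le> \<alpha>\<close> \<open>\<bar>\<zeta> \<bullet> e\<bar> \<le> 1\<close>] \<open>\<bar>\<beta>\<bar> \<le> \<alpha>\<close>
      by (simp add: abs_mult)
    then have "ennreal (\<alpha> + \<beta> * (\<zeta> \<bullet> e)) + ennreal (\<alpha> + (- \<beta>) * (\<zeta> \<bullet> e)) = ennreal (2 * \<alpha>)"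
      by (subst ennreal_plus[symmetric]) (simp_all add: abs_le_iff)
    then show "f \<zeta> * ennreal (\<alpha> + \<beta> * (\<zeta> \<bullet> e)) + f \<zeta> * ennreal (\<alpha> + (- \<beta>) * (\<zeta> \<bullet> e)) = ennreal (2 * \<alpha>) * f \<zeta>"
      by (metis distrib_left mult.commute)
  qed
  also have "\<dots> = ennreal (2 * \<alpha>) * (\<integral>\<^sup>+\<zeta>. f \<zeta> \<partial>sphere_measure)"
    by (rule nn_integral_cmult) simp
  also have "\<dots> = 2 * (ennreal \<alpha> * (\<integral>\<^sup>+\<zeta>. f \<zeta> \<partial>sphere_measure))"
    using \<open>\<bar>\<beta>\<bar> \<le> \<alpha>\<close> by (simp add: ennreal_mult mult.assoc)
  finally show ?thesis
    by (simp add: ennreal_mult_cancel_left)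
qed


section \<open>Stereographic projection\<close>

text \<open>
  \<open>stereo_denom a t y\<close> is the squared distance between the interior point \<open>(a, t)\<close> and the boundary
  point \<open>(y, 0)\<close>; \<open>stereo a t\<close> projects the boundary from the north pole \<open>(0, 1)\<close>, and
  \<open>(2 * t / stereo_denom a t y) ^ DIM('b)\<close> is its Jacobian.
\<close>

definition stereo_denom :: "'b::euclidean_space \<Rightarrow> real \<Rightarrow> 'b \<Rightarrow> real" where
  "stereo_denom a t y = (norm (y - a))\<^sup>2 + t\<^sup>2"

definition stereo :: "'b::euclidean_space \<Rightarrow> real \<Rightarrow> 'b \<Rightarrow> 'b \<times> real" where
  "stereo a t y =
    ((2 * t / stereo_denom a t y) *\<^sub>R (y - a), 1 - 2 * t\<^sup>2 / stereo_denom a t y)"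

lemma stereo_denom_pos: "0 < t \<Longrightarrow> 0 < stereo_denom a t y"
  unfolding stereo_denom_def by (simp add: add_nonneg_pos)

lemma norm_stereo:
  assumes "0 < t"
  shows "norm (stereo a t y) = 1"
proof -
  have D: "stereo_denom a t y \<noteq> 0"
    using stereo_denom_pos[OF assms] by (metis less_irrefl)
  have "(norm (y - a))\<^sup>2 = stereo_denom a t y - t\<^sup>2"
    by (simp add: stereo_denom_def)
  then have "(norm (stereo a t y))\<^sup>2 = 1"
    using D by (simp add: stereo_def norm_Pair power_mult_distrib power_divide)
      (simp add: field_simps power2_eq_square)
  then show ?thesis
    by (simp add: power2_eq_1_iff) (smt (verit) norm_ge_zero)
qed

lemma continuous_on_stereo_denom [continuous_intros]:
  "continuous_on A f \<Longrightarrow> continuous_on A (\<lambda>x. stereo_denom a t (f x))"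
  unfolding stereo_denom_def by (intro continuous_intros)

lemma continuous_on_stereo [continuous_intros]:
  "0 < t \<Longrightarrow> continuous_on A f \<Longrightarrow> continuous_on A (\<lambda>x. stereo a t (f x))"
  unfolding stereo_def by (intro continuous_intros) (auto simp: stereo_denom_pos less_imp_neq[symmetric])

lemma measurable_stereo [measurable]: "0 < t \<Longrightarrow> stereo a t \<in> borel_measurable borel"
  by (intro borel_measurable_continuous_onI continuous_intros)

lemma measurable_stereo_denom [measurable]: "stereo_denom a t \<in> borel_measurable borel"
  by (intro borel_measurable_continuous_onI continuous_intros)

lemma measurable_fst_borel [measurable]:
  "fst \<in> borel_measurable (borel :: ('a::euclidean_space \<times> 'b::euclidean_space) measure)"
  by (intro borel_measurable_continuous_onI continuous_intros)

lemma measurable_snd_borel [measurable]: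
  "snd \<in> borel_measurable (borel :: ('a::euclidean_space \<times> 'b::euclidean_space) measure)"
  by (intro borel_measurable_continuous_onI continuous_intros)

text \<open>The first summand is radial. In the second, the conformal factor is pulled out, and the
  remaining pair is an isometric image of \<open>fst h\<close> in the tangent space of the sphere at
  \<open>stereo a t (fst z)\<close>.\<close>

definition stereo_polar_deriv ::
    "'b::euclidean_space \<Rightarrow> real \<Rightarrow> 'b \<times> real \<Rightarrow> 'b \<times> real \<Rightarrow> 'b \<times> real" where
  "stereo_polar_deriv a t z h =
    (let v = fst z - a; r = 1 / stereo_denom a t (fst z) in
      snd h *\<^sub>R stereo a t (fst z) + (snd z * 2 * t * r) *\<^sub>R
        (fst h - (2 * r * (v \<bullet> fst h)) *\<^sub>R v, 2 * t * r * (v \<bullet> fst h)))"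

lemma has_derivative_stereo_polar:
  assumes "0 < t"
  shows "((\<lambda>z. snd z *\<^sub>R stereo a t (fst z)) has_derivative stereo_polar_deriv a t z) (at z within S)"
proof -
  let ?D = "\<lambda>z. stereo_denom a t (fst z)"
  have D: "?D z \<noteq> 0" for z
    using stereo_denom_pos[OF assms] by (metis less_irrefl)
  let ?r = "\<lambda>z. inverse (?D z)" and ?rd = "\<lambda>h. - (inverse (?D z) * (2 * ((fst z - a) \<bullet> fst h)) * inverse (?D z))"
  have "(?D has_derivative (\<lambda>h. 2 * ((fst z - a) \<bullet> fst h))) (at z within S)"
    unfolding stereo_denom_def power2_norm_eq_inner
    by (auto intro!: derivative_eq_intros simp: inner_commute)
  from Deriv.has_derivative_inverse[OF D this]
  have r: "(?r has_derivative ?rd) (at z within S)" .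
  have c: "((\<lambda>z. snd z * ?r z) has_derivative (\<lambda>h. snd z * ?rd h + snd h * ?r z)) (at z within S)"
    by (rule has_derivative_mult[OF has_derivative_snd[OF has_derivative_ident] r])
  have v: "((\<lambda>z. fst z - a) has_derivative fst) (at z within S)"
    by (auto intro!: derivative_eq_intros)
  have "((\<lambda>z. ((2 * t) *\<^sub>R (snd z * ?r z) *\<^sub>R (fst z - a), snd z - (2 * t\<^sup>2) * (snd z * ?r z)))
      has_derivative (\<lambda>h. ((2 * t) *\<^sub>R ((snd z * ?r z) *\<^sub>R fst h + (snd z * ?rd h + snd h * ?r z) *\<^sub>R (fst z - a)),
        snd h - (2 * t\<^sup>2) * (snd z * ?rd h + snd h * ?r z)))) (at z within S)"
    by (intro has_derivative_Pair has_derivative_scaleR_right has_derivative_scaleR[OF c v]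
        has_derivative_diff has_derivative_mult_right c has_derivative_snd[OF has_derivative_ident])
  also have "(\<lambda>h. ((2 * t) *\<^sub>R ((snd z * ?r z) *\<^sub>R fst h + (snd z * ?rd h + snd h * ?r z) *\<^sub>R (fst z - a)),
        snd h - (2 * t\<^sup>2) * (snd z * ?rd h + snd h * ?r z))) = stereo_polar_deriv a t z"
    by (rule ext)
      (simp add: stereo_polar_deriv_def Let_def stereo_def divide_inverse algebra_simps power2_eq_square)
  finally show ?thesis
    by (simp add: stereo_def divide_inverse algebra_simps)
qed

text \<open>Conformality of stereographic projection, in the form demanded by
  \<open>nn_integral_orthogonal_jacobian\<close>: \<open>?S\<close> is a unit vector,
  \<open>?R\<close> preserves inner products, and the two are orthogonal. The radial column thus has
  length 1 and all tangential columns are stretched by one common factor.\<close>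

lemma stereo_polar_deriv_inner:
  assumes t: "0 < t" and i: "i \<in> Basis" and j: "j \<in> Basis"
  shows "stereo_polar_deriv a t z i \<bullet> stereo_polar_deriv a t z j =
    (if i = j then (if snd i = 0 then 2 * t * snd z / stereo_denom a t (fst z) else 1)\<^sup>2 else 0)"
proof -
  define v D where "v = fst z - a" and "D = stereo_denom a t (fst z)"
  have D: "D \<noteq> 0"
    using stereo_denom_pos[OF t] unfolding D_def by (metis less_irrefl)
  have vv: "v \<bullet> v = D - t\<^sup>2"
    by (simp add: D_def stereo_denom_def v_def power2_norm_eq_inner)
  let ?S = "stereo a t (fst z)"
  let ?R = "\<lambda>b. (b - (2 * (1/D) * (v \<bullet> b)) *\<^sub>R v, 2 * t * (1/D) * (v \<bullet> b))"
  have der: "stereo_polar_deriv a t z h = snd h *\<^sub>R ?S + (snd z * 2 * t * (1/D)) *\<^sub>R ?R (fst h)" for h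
    by (simp add: stereo_polar_deriv_def Let_def v_def D_def)
  have S: "?S = ((2 * t / D) *\<^sub>R v, 1 - 2 * t\<^sup>2 / D)"
    by (simp add: stereo_def v_def D_def)
  have SS: "?S \<bullet> ?S = 1"
    using norm_stereo[OF t, of a "fst z"] by (simp add: norm_eq_1)
  have SR: "?S \<bullet> ?R b = 0" for b
    using D unfolding S by (simp add: inner_diff_right vv) (simp add: field_simps power2_eq_square)
  have RR: "?R b \<bullet> ?R b' = b \<bullet> b'" for b b'
    using D by (simp add: inner_diff_left inner_diff_right vv inner_commute[of b v])
      (simp add: field_simps power2_eq_square)
  have RS: "?R b \<bullet> ?S = 0" for b
    using SR by (simp only: inner_commute)
  have expand: "(k *\<^sub>R ?S + m *\<^sub>R ?R b) \<bullet> (k' *\<^sub>R ?S + m *\<^sub>R ?R b') = k * k' + m\<^sup>2 * (b \<bullet> b')"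
    for k k' m b b'
    by (simp only: inner_add_left inner_add_right inner_scaleR_left inner_scaleR_right SS SR RS RR)
      (simp add: power2_eq_square)
  show ?thesis
    using i j unfolding der D_def[symmetric] expand
    by (auto simp: Basis_prod_def inner_Basis mult_ac split: if_splits)
qed

lemma prod_Basis_stereo_scale:
  fixes c :: real
  shows "(\<Prod>i\<in>(Basis :: ('b::euclidean_space \<times> real) set). if snd i = 0 then c else 1) = c ^ DIM('b)"
proof -
  have "(\<Prod>i\<in>(Basis :: ('b \<times> real) set). if snd i = 0 then c else 1) =
     (\<Prod>i\<in>(\<lambda>b. (b, 0 :: real)) ` (Basis :: 'b set). if snd i = 0 then c else 1) *
     (\<Prod>i\<in>(\<lambda>r. (0 :: 'b, r)) ` (Basis :: real set). if snd i = 0 then c else 1)"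
    unfolding Basis_prod_def by (rule prod.union_disjoint) auto
  also have "\<dots> = c ^ DIM('b)"
    by (subst prod.reindex) (simp_all add: inj_on_def)
  finally show ?thesis .
qed

text \<open>The removed ray from the origin passes through the north pole, the only point of the
  sphere that the projection misses.\<close>

lemma stereo_polar_image:
  fixes a :: "'b::euclidean_space"
  assumes t: "0 < t"
  shows "(\<lambda>z. snd z *\<^sub>R stereo a t (fst z)) ` (UNIV \<times> {0<..<1}) =
    ball 0 1 - {z. fst z = 0 \<and> 0 \<le> snd z}"
proof
  show "(\<lambda>z. snd z *\<^sub>R stereo a t (fst z)) ` (UNIV \<times> {0<..<1}) \<subseteq> ball 0 1 - {z. fst z = 0 \<and> 0 \<le> snd z}"
  proof clarsimp
    fix y :: 'b and s :: real
    assume s: "0 < s" "s < 1"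
    have "snd (stereo a t y) < 0" if "fst (stereo a t y) = 0"
    proof -
      have "y = a"
        using that t stereo_denom_pos[OF t, of a y] by (simp add: stereo_def)
      then show ?thesis
        using t by (simp add: stereo_def stereo_denom_def)
    qed
    then show "s * norm (stereo a t y) < 1 \<and> (fst (stereo a t y) = 0 \<longrightarrow> \<not> 0 \<le> s * snd (stereo a t y))"
      using s by (auto simp: norm_stereo[OF t] zero_le_mult_iff)
  qed
next
  show "ball 0 1 - {z. fst z = 0 \<and> 0 \<le> snd z} \<subseteq> (\<lambda>z. snd z *\<^sub>R stereo a t (fst z)) ` (UNIV \<times> {0<..<1})"
  proof
    fix z :: "'b \<times> real"
    assume z: "z \<in> ball 0 1 - {z. fst z = 0 \<and> 0 \<le> snd z}"
    define s where "s = norm z"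
    define p r where "p = fst z /\<^sub>R s" and "r = snd z / s"
    have s: "0 < s" "s < 1"
      using z by (auto simp: s_def)
    have pr: "(norm p)\<^sup>2 + r\<^sup>2 = 1"
    proof -
      have "s\<^sup>2 = (norm (fst z))\<^sup>2 + (snd z)\<^sup>2"
        unfolding s_def by (simp add: norm_prod_def)
      moreover have "(norm p)\<^sup>2 + r\<^sup>2 = ((norm (fst z))\<^sup>2 + (snd z)\<^sup>2) / s\<^sup>2"
        using s by (simp add: p_def r_def power_mult_distrib power_divide add_divide_distrib power_inverse inverse_eq_divide)
      ultimately show ?thesis
        using s by (metis divide_self less_irrefl zero_less_power)
    qed
    \<comment> \<open>For \<open>r \<ge> 1\<close> the vector \<open>p\<close> vanishes and
      \<open>z\<close> lies on the excluded ray.\<close>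
    have "r < 1"
    proof (rule ccontr)
      assume "\<not> r < 1"
      then have "1 \<le> r\<^sup>2"
        by simp
      then have "p = 0"
        using pr by (smt (verit) norm_eq_zero zero_le_power2 power2_eq_iff_nonneg power_zero_numeral zero_less_power2)
      then show False
        using z s \<open>\<not> r < 1\<close> by (auto simp: p_def r_def field_simps)
    qed
    \<comment> \<open>Inverse stereographic projection from the north pole, adjusted to the centre
      \<open>a\<close> and the scale \<open>t\<close>.\<close>
    define y where "y = a + (t / (1 - r)) *\<^sub>R p"
    have D: "stereo_denom a t y = 2 * t\<^sup>2 / (1 - r)"
    proof -
      have "(norm p)\<^sup>2 = 1 - r\<^sup>2"
        using pr by simp
      then have "stereo_denom a t y = (t / (1 - r))\<^sup>2 * (1 - r\<^sup>2) + t\<^sup>2"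
        by (simp add: stereo_denom_def y_def power_mult_distrib power_divide)
      also have "\<dots> = 2 * t\<^sup>2 / (1 - r)"
        using \<open>r < 1\<close> by (simp add: power_divide divide_simps) (simp add: power2_eq_square algebra_simps)
      finally show ?thesis .
    qed
    have "stereo a t y = (p, r)"
      using \<open>r < 1\<close> t by (simp add: stereo_def D) (simp add: y_def power2_eq_square)
    then have "z = s *\<^sub>R stereo a t y"
      using s by (simp add: p_def r_def prod_eq_iff)
    then show "z \<in> (\<lambda>z. snd z *\<^sub>R stereo a t (fst z)) ` (UNIV \<times> {0<..<1})"
      using s by (intro image_eqI[where x = "(y, s)"]) auto
  qed
qed

text \<open>The norm recovers the radius, the last coordinate recovers the denominator, and the
  first component then recovers the boundary point.\<close>

lemma stereo_polar_inj:
  assumes t: "0 < t"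
  shows "inj_on (\<lambda>z. snd z *\<^sub>R stereo a t (fst z)) (UNIV \<times> {0<..<1})"
proof (rule inj_onI, clarsimp)
  fix y y' :: 'a and s s' :: real
  assume s: "0 < s" "0 < s'" and eq: "s *\<^sub>R stereo a t y = s' *\<^sub>R stereo a t y'"
  then have "norm (s *\<^sub>R stereo a t y) = norm (s' *\<^sub>R stereo a t y')"
    by simp
  then have "s = s'"
    using s by (simp add: norm_stereo[OF t])
  then have st: "stereo a t y = stereo a t y'"
    using eq s by simp
  then have "2 * t\<^sup>2 / stereo_denom a t y = 2 * t\<^sup>2 / stereo_denom a t y'"
    by (simp add: stereo_def)
  then have D: "stereo_denom a t y = stereo_denom a t y'"
    using t stereo_denom_pos[OF t, of a y] stereo_denom_pos[OF t, of a y'] by (simp add: frac_eq_eq)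
  then have "(2 * t / stereo_denom a t y) *\<^sub>R (y - a) = (2 * t / stereo_denom a t y) *\<^sub>R (y' - a)"
    using st by (simp add: stereo_def)
  then show "y = y' \<and> s = s'"
    using t stereo_denom_pos[OF t, of a y] \<open>s = s'\<close> by simp
qed

lemma nn_integral_stereo_polar:
  fixes a :: "'b::euclidean_space" and f :: "'b \<times> real \<Rightarrow> ennreal"
  assumes t: "0 < t" and [measurable]: "f \<in> borel_measurable borel"
  shows "(\<integral>\<^sup>+z. indicator (ball 0 1) z * f z \<partial>lborel) =
    (\<integral>\<^sup>+y. (\<integral>\<^sup>+s. indicator {0<..<1} s *
       (ennreal ((2 * t * s / stereo_denom a t y) ^ DIM('b)) * f (s *\<^sub>R stereo a t y)) \<partial>lborel) \<partial>lborel)"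
proof -
  let ?g = "\<lambda>z. snd z *\<^sub>R stereo a t (fst z)"
  let ?S = "UNIV \<times> {0<..<1} :: ('b \<times> real) set"
  let ?R = "{z :: 'b \<times> real. fst z = 0 \<and> 0 \<le> snd z}"
  obtain b :: 'b where b: "b \<in> Basis"
    using nonempty_Basis by blast
  \<comment> \<open>The ray missed by the polar map lies in a coordinate hyperplane through the
    origin, hence is a null set.\<close>
  then have "AE z in lborel. z \<bullet> (b, 0 :: real) \<noteq> 0"
    by (intro AE_lborel_inner_neq) (simp add: Basis_prod_def)
  then have null: "AE z in lborel. z \<notin> ?R"
    by eventually_elim (auto simp: inner_prod_def)
  have closed: "closed ?R"
    by (intro closed_Collect_conj closed_Collect_eq closed_Collect_le continuous_intros)
  have S [measurable]: "?S \<in> sets borel"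
    by (intro borel_open open_Times) auto
  have g [measurable]: "?g \<in> borel_measurable borel"
    by (intro borel_measurable_continuous_onI continuous_intros t)
  have [measurable]: "stereo a t \<in> borel_measurable borel"
    using t by simp
  have "(\<integral>\<^sup>+z. indicator (ball 0 1) z * f z \<partial>lborel) = (\<integral>\<^sup>+z. indicator (?g ` ?S) z * f z \<partial>lborel)"
    unfolding stereo_polar_image[OF t]
    by (intro nn_integral_cong_AE, use null in eventually_elim) (auto simp: indicator_def)
  also have "\<dots> = (\<integral>\<^sup>+z. indicator ?S z * (ennreal (\<Prod>i\<in>(Basis :: ('b \<times> real) set).
      if snd i = 0 then 2 * t * snd z / stereo_denom a t (fst z) else 1) * f (?g z)) \<partial>lborel)"
  proof (rule nn_integral_orthogonal_jacobian[where g = ?g and S = ?S and f = f and D = "stereo_polar_deriv a t" and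
        c = "\<lambda>z i. if snd i = 0 then 2 * t * snd z / stereo_denom a t (fst z) else 1"])
    show "(?g has_derivative stereo_polar_deriv a t z) (at z within ?S)" for z
      by (rule has_derivative_stereo_polar[OF t])
    show "inj_on ?g ?S"
      by (rule stereo_polar_inj[OF t])
    show "?g ` ?S \<in> sets borel"
      unfolding stereo_polar_image[OF t] using closed by (intro sets.Diff) (auto simp: borel_closed)
    show "bounded (?g ` ?S)"
      unfolding stereo_polar_image[OF t] by (rule bounded_subset[OF bounded_ball]) auto
    show "0 \<le> (if snd i = 0 then 2 * t * snd z / stereo_denom a t (fst z) else 1)"
      if "z \<in> ?S" for z i
      using that t stereo_denom_pos[OF t, of a "fst z"] by auto
    show "(\<lambda>x. \<Prod>i\<in>(Basis :: ('b \<times> real) set). if snd i = 0 then 2 * t * snd x / stereo_denom a t (fst x) else 1)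
      \<in> borel_measurable borel"
      unfolding prod_Basis_stereo_scale by measurable
    show "stereo_polar_deriv a t z i \<bullet> stereo_polar_deriv a t z j =
      (if i = j then (if snd i = 0 then 2 * t * snd z / stereo_denom a t (fst z) else 1)\<^sup>2 else 0)"
      if "i \<in> Basis" "j \<in> Basis" for z i j
      by (rule stereo_polar_deriv_inner[OF t that])
  qed measurable
  also have "\<dots> = (\<integral>\<^sup>+z. indicator ?S z * (ennreal
      ((2 * t * snd z / stereo_denom a t (fst z)) ^ DIM('b)) * f (?g z)) \<partial>(lborel \<Otimes>\<^sub>M lborel))"
    by (simp only: prod_Basis_stereo_scale lborel_prod)
  also have "\<dots> = (\<integral>\<^sup>+y. (\<integral>\<^sup>+s. indicator ?S (y, s) * (ennreal
      ((2 * t * snd (y, s) / stereo_denom a t (fst (y, s))) ^ DIM('b)) * f (?g (y, s))) \<partial>lborel) \<partial>lborel)"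
    by (rule lborel.nn_integral_fst[symmetric]) (simp only: lborel_prod, measurable)
  finally show ?thesis
    by (simp add: indicator_def)
qed

lemma nn_integral_powr_unit_interval:
  assumes "0 \<le> q"
  shows "(\<integral>\<^sup>+s. indicator {0<..<1} s * ennreal (s powr q) \<partial>lborel) = ennreal (1 / (q + 1))"
proof -
  have "((\<lambda>s. s powr q) has_integral 1 / (q + 1)) {0<..<1::real}"
    using has_integral_powr_from_0[of q 1] assms by (simp add: has_integral_Icc_iff_Ioo)
  from nn_integral_has_integral_lebesgue[OF _ this]
  show ?thesis
    by (simp add: ennreal_mult'' ennreal_indicator)
qed

text \<open>In polar coordinates the radial and the spherical variable separate, and
  \<open>DIM('b) + q\<close> is the total power of the radius. The case \<open>q = 0\<close>
  identifies \<open>sphere_measure\<close>; other values of \<open>q\<close> produce its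
  moments.\<close>

lemma nn_integral_ball_radial:
  fixes f :: "'b::euclidean_space \<times> real \<Rightarrow> ennreal"
  assumes t: "0 < t" and [measurable]: "f \<in> borel_measurable borel" and q: "0 \<le> q"
  shows "(\<integral>\<^sup>+z. indicator (ball 0 1) z * (ennreal (norm z powr q) * f (z /\<^sub>R norm z)) \<partial>lborel) =
    ennreal (1 / (real DIM('b) + q + 1)) *
      (\<integral>\<^sup>+y. ennreal ((2 * t / stereo_denom a t y) ^ DIM('b)) * f (stereo a t y) \<partial>lborel)"
proof -
  have [measurable]: "stereo a t \<in> borel_measurable borel"
    using t by simp
  let ?J = "\<lambda>y. ennreal ((2 * t / stereo_denom a t y) ^ DIM('b)) * f (stereo a t y)"
  have "(\<integral>\<^sup>+z. indicator (ball 0 1) z * (ennreal (norm z powr q) * f (z /\<^sub>R norm z)) \<partial>lborel) =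
    (\<integral>\<^sup>+y. (\<integral>\<^sup>+s. indicator {0<..<1} s * (ennreal ((2 * t * s / stereo_denom a t y) ^ DIM('b)) *
       (ennreal (norm (s *\<^sub>R stereo a t y) powr q) *
         f ((s *\<^sub>R stereo a t y) /\<^sub>R norm (s *\<^sub>R stereo a t y)))) \<partial>lborel) \<partial>lborel)"
    by (rule nn_integral_stereo_polar[OF t]) measurable
  also have "\<dots> = (\<integral>\<^sup>+y. (\<integral>\<^sup>+s. ?J y * (indicator {0<..<1} s * ennreal (s powr (real DIM('b) + q))) \<partial>lborel) \<partial>lborel)"
  proof (intro nn_integral_cong)
    fix y :: 'b and s :: real
    have "ennreal ((2 * t * s / stereo_denom a t y) ^ DIM('b)) * ennreal (s powr q) =
        ennreal ((2 * t / stereo_denom a t y) ^ DIM('b)) * ennreal (s powr (real DIM('b) + q))"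
      if "0 < s"
      using that t stereo_denom_pos[OF t, of a y]
      by (simp add: ennreal_mult[symmetric] powr_add powr_realpow power_mult_distrib power_divide)
    then show "indicator {0<..<1} s * (ennreal ((2 * t * s / stereo_denom a t y) ^ DIM('b)) *
       (ennreal (norm (s *\<^sub>R stereo a t y) powr q) *
         f ((s *\<^sub>R stereo a t y) /\<^sub>R norm (s *\<^sub>R stereo a t y)))) =
       ?J y * (indicator {0<..<1} s * ennreal (s powr (real DIM('b) + q)))"
      by (auto simp: indicator_def norm_stereo[OF t] mult.assoc[symmetric]) (simp_all add: mult_ac)
  qed
  also have "\<dots> = (\<integral>\<^sup>+y. ?J y * ennreal (1 / (real DIM('b) + q + 1)) \<partial>lborel)"
    using q by (subst nn_integral_cmult) (simp_all add: nn_integral_powr_unit_interval)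
  also have "\<dots> = ennreal (1 / (real DIM('b) + q + 1)) * (\<integral>\<^sup>+y. ?J y \<partial>lborel)"
    by (subst nn_integral_multc) (simp_all add: mult.commute)
  finally show ?thesis .
qed


section \<open>Moments of the surface measure\<close>

lemma ennreal_mult_left_cancel: "0 < c \<Longrightarrow> ennreal c * X = ennreal c * Y \<Longrightarrow> X = Y"
  by (auto simp: ennreal_mult_cancel_left)

text \<open>The factor is the area of the unit sphere, n times the volume of the ball, by which
  \<open>sphere_measure\<close> is normalized: the n comes from radial integration and the volume
  from the cone definition.\<close>

lemma nn_integral_stereo:
  fixes f :: "'b::euclidean_space \<times> real \<Rightarrow> ennreal"
  assumes t: "0 < t" and [measurable]: "f \<in> borel_measurable borel"
  shows "(\<integral>\<^sup>+y. ennreal ((2 * t / stereo_denom a t y) ^ DIM('b)) * f (stereo a t y) \<partial>lborel) =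
    ennreal ((real DIM('b) + 1) * unit_ball_vol (real DIM('b) + 1)) * (\<integral>\<^sup>+\<zeta>. f \<zeta> \<partial>sphere_measure)"
proof -
  let ?n = "real DIM('b) + 1"
  let ?I = "\<integral>\<^sup>+y. ennreal ((2 * t / stereo_denom a t y) ^ DIM('b)) * f (stereo a t y) \<partial>lborel"
  let ?J = "\<integral>\<^sup>+z. indicator (ball 0 1) z * f (z /\<^sub>R norm z) \<partial>lborel"
  have null: "AE z in lborel. (z :: 'b \<times> real) \<noteq> 0"
    by (rule AE_lborel_singleton)
  \<comment> \<open>Since \<open>0 powr 0 = 0\<close>, the inserted factor is 1 only away from the
    origin.\<close>
  have "?J = (\<integral>\<^sup>+z. indicator (ball 0 1) z * (ennreal (norm z powr 0) * f (z /\<^sub>R norm z)) \<partial>lborel)"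
    by (intro nn_integral_cong_AE, use null in eventually_elim) simp
  also have "\<dots> = ennreal (1 / ?n) * ?I"
    using nn_integral_ball_radial[OF t assms(2), of 0 a] by simp
  finally have "ennreal ?n * ?J = ennreal ?n * (ennreal (1 / ?n) * ?I)"
    by simp
  also have "\<dots> = ?I"
    by (simp add: mult.assoc[symmetric] ennreal_mult[symmetric] add_pos_nonneg del: ennreal_plus)
  finally have I: "?I = ennreal ?n * ?J" ..
  have "(\<integral>\<^sup>+\<zeta>. f \<zeta> \<partial>sphere_measure) = ?J / ennreal (unit_ball_vol ?n)"
    by (subst nn_integral_sphere_measure) (simp_all add: add.commute)
  then have "?J = ennreal (unit_ball_vol ?n) * (\<integral>\<^sup>+\<zeta>. f \<zeta> \<partial>sphere_measure)"
    using less_imp_neq[OF unit_ball_vol_pos[of ?n], symmetric] ennreal_mult_divide_eq[of "ennreal (unit_ball_vol ?n)" ?J]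
    by (simp add: ennreal_times_divide mult.commute[of "ennreal (unit_ball_vol ?n)"])
  then show ?thesis
    by (simp add: I ennreal_mult mult.assoc)
qed

lemma nn_integral_abs_even:
  fixes h :: "real \<Rightarrow> ennreal"
  assumes [measurable]: "h \<in> borel_measurable borel"
  shows "(\<integral>\<^sup>+s. h \<bar>s\<bar> \<partial>lborel) = 2 * (\<integral>\<^sup>+s. indicator {0..} s * h s \<partial>lborel)"
proof -
  have null: "AE s in lborel. (s :: real) \<noteq> 0"
    by (rule AE_lborel_singleton)
  have "(\<integral>\<^sup>+s. h \<bar>s\<bar> \<partial>lborel) =
      (\<integral>\<^sup>+s. indicator {0..} s * h s + indicator {0..} (- s) * h (- s) \<partial>lborel)"
    by (intro nn_integral_cong_AE, use null in eventually_elim) (auto simp: indicator_def)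
  also have "\<dots> = (\<integral>\<^sup>+s. indicator {0..} s * h s \<partial>lborel) + (\<integral>\<^sup>+s. indicator {0..} (- s) * h (- s) \<partial>lborel)"
    by (rule nn_integral_add) measurable
  also have "(\<integral>\<^sup>+s. indicator {0..} (- s) * h (- s) \<partial>lborel) =
      (\<integral>\<^sup>+s. indicator {0..} s * h s \<partial>distr lborel borel uminus)"
    by (rule nn_integral_distr[symmetric]) measurable
  finally show ?thesis
    by (simp add: lborel_distr_uminus mult_2)
qed

text \<open>Substitution of \<open>s\<^sup>2\<close> in the Beta integral over the unit interval;
  evenness then accounts for the negative half.\<close>

lemma nn_integral_Beta_squared:
  fixes q b :: real
  assumes "0 \<le> q" "0 \<le> b"
  shows "(\<integral>\<^sup>+s. indicator {-1<..<1} s * ennreal (\<bar>s\<bar> powr q * (1 - s\<^sup>2) powr b) \<partial>lborel) =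
    ennreal (Beta ((q + 1) / 2) (b + 1))"
proof -
  let ?f = "\<lambda>u::real. ennreal (u powr ((q - 1) / 2) * (1 - u) powr b)"
  have null: "AE s in lborel. (s :: real) \<noteq> 0" "AE s in lborel. (s :: real) \<noteq> 1"
    by (rule AE_lborel_singleton)+
  have "((\<lambda>u. u powr ((q - 1) / 2) * (1 - u) powr b) has_integral Beta ((q + 1) / 2) (b + 1)) {0..1}"
    using has_integral_Beta_real[of "(q + 1) / 2" "b + 1"] assms by (simp add: field_simps)
  from nn_integral_has_integral_lebesgue[OF _ this]
  have "ennreal (Beta ((q + 1) / 2) (b + 1)) = (\<integral>\<^sup>+u. ?f u * indicator {0..1} u \<partial>lborel)"
    by (simp add: ennreal_mult'' ennreal_indicator mult.commute)
  also have "\<dots> = (\<integral>\<^sup>+u. ?f u * indicator {0\<^sup>2..1\<^sup>2} u \<partial>lborel)"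
    by simp
  also have "\<dots> = (\<integral>\<^sup>+s. ?f (s\<^sup>2) * ennreal (2 * s) * indicator {0..1} s \<partial>lborel)"
    by (rule nn_integral_substitution_aux) (auto intro!: derivative_eq_intros continuous_intros)
  also have "\<dots> = (\<integral>\<^sup>+s. 2 * (indicator {0..} s * (indicator {-1<..<1} s * ennreal (s powr q * (1 - s\<^sup>2) powr b))) \<partial>lborel)"
  proof (intro nn_integral_cong_AE, use null in eventually_elim)
    fix s :: real
    assume "s \<noteq> 0" "s \<noteq> 1"
    have "s\<^sup>2 powr ((q - 1) / 2) * (1 - s\<^sup>2) powr b * (2 * s) = 2 * (s powr q * (1 - s\<^sup>2) powr b)" if "0 < s"
    proof -
      have "s\<^sup>2 powr ((q - 1) / 2) = s powr (q - 1)"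
        using that by (simp add: powr_powr diff_divide_distrib flip: powr_numeral)
      then show ?thesis
        using that by (simp add: powr_diff)
    qed
    then show "?f (s\<^sup>2) * ennreal (2 * s) * indicator {0..1} s =
      2 * (indicator {0..} s * (indicator {-1<..<1} s * ennreal (s powr q * (1 - s\<^sup>2) powr b)))"
      using \<open>s \<noteq> 0\<close> \<open>s \<noteq> 1\<close>
      by (auto simp: indicator_def ennreal_mult[symmetric] simp flip: ennreal_numeral)
  qed
  also have "\<dots> = 2 * (\<integral>\<^sup>+s. indicator {0..} s * (indicator {-1<..<1} s * ennreal (s powr q * (1 - s\<^sup>2) powr b)) \<partial>lborel)"
    by (rule nn_integral_cmult) measurable
  also have "\<dots> = (\<integral>\<^sup>+s. indicator {-1<..<1} \<bar>s\<bar> * ennreal (\<bar>s\<bar> powr q * (1 - \<bar>s\<bar>\<^sup>2) powr b) \<partial>lborel)"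
    by (rule nn_integral_abs_even[symmetric]) measurable
  also have "\<dots> = (\<integral>\<^sup>+s. indicator {-1<..<1} s * ennreal (\<bar>s\<bar> powr q * (1 - s\<^sup>2) powr b) \<partial>lborel)"
    by (intro nn_integral_cong) (auto simp: indicator_def)
  finally show ?thesis ..
qed

text \<open>Fubini by horizontal slices: the slice at height \<open>s\<close> is a ball of radius
  \<open>sqrt (1 - s\<^sup>2)\<close> in \<open>'b\<close>, whose volume supplies the second Beta
  parameter.\<close>

lemma nn_integral_ball_snd:
  fixes q :: real
  assumes q: "0 \<le> q"
  shows "(\<integral>\<^sup>+z. indicator (ball 0 1) z * ennreal (\<bar>snd z\<bar> powr q)
      \<partial>(lborel :: ('b::euclidean_space \<times> real) measure)) =
    ennreal (unit_ball_vol DIM('b) * Beta ((q + 1) / 2) (real DIM('b) / 2 + 1))"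
    (is "(\<integral>\<^sup>+z. ?f z \<partial>_) = _")
proof -
  have [measurable]: "ball 0 1 \<in> sets (borel :: ('b \<times> real) measure)"
    by simp
  have "integral\<^sup>N lborel ?f = integral\<^sup>N (lborel \<Otimes>\<^sub>M lborel) ?f"
    by (simp only: lborel_prod)
  also have "\<dots> = (\<integral>\<^sup>+s. (\<integral>\<^sup>+y. ?f (y, s) \<partial>lborel) \<partial>lborel)"
    by (rule lborel_pair.nn_integral_snd[symmetric]) (simp only: lborel_prod, measurable)
  also have "\<dots> = (\<integral>\<^sup>+s. ennreal (unit_ball_vol DIM('b)) *
      (indicator {-1<..<1} s * ennreal (\<bar>s\<bar> powr q * (1 - s\<^sup>2) powr (real DIM('b) / 2))) \<partial>lborel)"
  proof (rule nn_integral_cong)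
    fix s :: real
    show "(\<integral>\<^sup>+y. ?f (y, s) \<partial>lborel) = ennreal (unit_ball_vol DIM('b)) *
      (indicator {-1<..<1} s * ennreal (\<bar>s\<bar> powr q * (1 - s\<^sup>2) powr (real DIM('b) / 2)))"
    proof (cases "\<bar>s\<bar> < 1")
      case True
      then have s: "0 < 1 - s\<^sup>2"
        by (simp add: abs_square_less_1)
      have "norm (y, s) < 1 \<longleftrightarrow> norm y < sqrt (1 - s\<^sup>2)" for y :: 'b
      proof -
        have "norm y < sqrt (1 - s\<^sup>2) \<longleftrightarrow> sqrt ((norm y)\<^sup>2) < sqrt (1 - s\<^sup>2)"
          by simp
        then show ?thesis
          by (simp only: real_sqrt_less_iff norm_Pair real_sqrt_lt_1_iff) auto
      qed
      then have "(\<integral>\<^sup>+y. ?f (y, s) \<partial>lborel) =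
          (\<integral>\<^sup>+y. ennreal (\<bar>s\<bar> powr q) * indicator (ball 0 (sqrt (1 - s\<^sup>2))) (y :: 'b) \<partial>lborel)"
        by (intro nn_integral_cong) (simp add: indicator_def)
      also have "\<dots> = ennreal (\<bar>s\<bar> powr q) * ennreal (unit_ball_vol DIM('b) * sqrt (1 - s\<^sup>2) ^ DIM('b))"
        using s by (subst nn_integral_cmult_indicator) (simp_all add: emeasure_ball)
      also have "sqrt (1 - s\<^sup>2) ^ DIM('b) = (1 - s\<^sup>2) powr (real DIM('b) / 2)"
        using s by (simp add: powr_half_sqrt[symmetric] powr_powr flip: powr_realpow)
      finally show ?thesis
        using True by (simp add: ennreal_mult[symmetric] indicator_def abs_less_iff mult_ac)
    next
      case False
      then have "\<not> norm (y, s) < 1" for y :: 'b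
        using norm_snd_le[of s y] by simp
      then show ?thesis
        using False by (auto simp: indicator_def abs_less_iff)
    qed
  qed
  also have "\<dots> = ennreal (unit_ball_vol DIM('b)) * ennreal (Beta ((q + 1) / 2) (real DIM('b) / 2 + 1))"
    using q by (subst nn_integral_cmult) (simp_all add: nn_integral_Beta_squared)
  finally show ?thesis
    by (simp add: ennreal_mult')
qed

text \<open>After a rotation that takes the north pole to \<open>l\<close>, the integral of
  \<open>\<bar>snd z\<bar> powr q\<close> over the unit ball is computed twice: by slices as a Beta
  value, and in polar coordinates, where homogeneity of degree \<open>q\<close> leaves a known
  multiple of the moment.\<close>

theorem nn_integral_sphere_measure_abs_inner_powr:
  fixes l :: "'b::euclidean_space \<times> real" and q n :: real
  defines "n \<equiv> real DIM('b) + 1"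
  assumes q: "0 \<le> q" and l: "norm l = 1"
  shows "(\<integral>\<^sup>+\<zeta>. ennreal (\<bar>\<zeta> \<bullet> l\<bar> powr q) \<partial>sphere_measure) =
    ennreal (Gamma (n / 2) * Gamma ((q + 1) / 2) / (sqrt pi * Gamma ((n + q) / 2)))"
proof -
  let ?e = "(0, 1) :: 'b \<times> real"
  let ?F = "\<lambda>z :: 'b \<times> real. ennreal (\<bar>snd z\<bar> powr q)"
  obtain R where R: "orthogonal_transformation R" "R ?e = l"
    using exists_orthogonal_transformation[of ?e l] l by (auto simp: norm_Pair)
  have inner: "R x \<bullet> R y = x \<bullet> y" for x y
    using R(1) unfolding orthogonal_transformation_def by blast
  have "(\<integral>\<^sup>+\<zeta>. ennreal (\<bar>\<zeta> \<bullet> l\<bar> powr q) \<partial>sphere_measure) =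
      (\<integral>\<^sup>+\<zeta>. ennreal (\<bar>R \<zeta> \<bullet> l\<bar> powr q) \<partial>sphere_measure)"
    by (rule nn_integral_sphere_measure_isometry[symmetric])
      (simp_all add: inner orthogonal_transformation_linear R)
  also have "\<dots> = (\<integral>\<^sup>+\<zeta>. ?F \<zeta> \<partial>sphere_measure)"
    by (simp add: R(2)[symmetric] inner) (simp add: inner_prod_def)
  finally have eq: "(\<integral>\<^sup>+\<zeta>. ennreal (\<bar>\<zeta> \<bullet> l\<bar> powr q) \<partial>sphere_measure) = (\<integral>\<^sup>+\<zeta>. ?F \<zeta> \<partial>sphere_measure)" .
  let ?M = "\<integral>\<^sup>+\<zeta>. ?F \<zeta> \<partial>sphere_measure"
  have "ennreal (unit_ball_vol DIM('b) * Beta ((q + 1) / 2) (real DIM('b) / 2 + 1)) =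
      (\<integral>\<^sup>+z. indicator (ball 0 1) z * ?F z \<partial>lborel)"
    by (rule nn_integral_ball_snd[OF q, symmetric])
  also have "\<dots> = (\<integral>\<^sup>+z. indicator (ball 0 1) z * (ennreal (norm z powr q) * ?F (z /\<^sub>R norm z)) \<partial>lborel)"
  proof (rule nn_integral_cong)
    fix z :: "'b \<times> real"
    have "\<bar>snd z\<bar> powr q = norm z powr q * \<bar>snd (z /\<^sub>R norm z)\<bar> powr q"
      by (cases "z = 0") (simp_all add: powr_mult[symmetric] abs_mult mult.assoc[symmetric])
    then show "indicator (ball 0 1) z * ?F z = indicator (ball 0 1) z * (ennreal (norm z powr q) * ?F (z /\<^sub>R norm z))"
      by (simp add: ennreal_mult[symmetric])
  qed
  also have "\<dots> = ennreal (1 / (n + q)) * (ennreal (n * unit_ball_vol n) * ?M)"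
    by (subst nn_integral_ball_radial[OF zero_less_one _ q, where a = 0], simp,
        subst nn_integral_stereo) (simp_all add: n_def algebra_simps)
  also have "\<dots> = ennreal (n * unit_ball_vol n / (n + q)) * ?M"
    using q by (simp add: mult.assoc[symmetric] ennreal_mult[symmetric] n_def)
  finally have *: "ennreal (n * unit_ball_vol n / (n + q)) * ?M =
    ennreal (unit_ball_vol DIM('b) * Beta ((q + 1) / 2) (real DIM('b) / 2 + 1))" ..
  have n: "0 < n"
    by (simp add: n_def)
  have G: "Gamma (n / 2 + 1) = n / 2 * Gamma (n / 2)"
    "Gamma ((n + q) / 2 + 1) = (n + q) / 2 * Gamma ((n + q) / 2)"
    by (intro Gamma_plus1 notI; use n q nonpos_Ints_nonpos in force)+
  have pos: "0 < Gamma (n / 2)" "0 < Gamma ((n + q) / 2)" "0 < Gamma (real DIM('b) / 2 + 1)" "0 < Gamma ((q + 1) / 2)"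
    using n q by (auto intro!: Gamma_real_pos)
  have "unit_ball_vol DIM('b) * Beta ((q + 1) / 2) (real DIM('b) / 2 + 1) =
      n * unit_ball_vol n / (n + q) * (Gamma (n / 2) * Gamma ((q + 1) / 2) / (sqrt pi * Gamma ((n + q) / 2)))"
  proof -
    have e: "(q + 1) / 2 + (real DIM('b) / 2 + 1) = (n + q) / 2 + 1"
      by (simp add: n_def field_simps)
    have B: "Beta ((q + 1) / 2) (real DIM('b) / 2 + 1) =
       Gamma ((q + 1) / 2) * Gamma (real DIM('b) / 2 + 1) / ((n + q) / 2 * Gamma ((n + q) / 2))"
      unfolding Beta_def e G ..
    have V: "unit_ball_vol n = pi powr (real DIM('b) / 2) * sqrt pi / (n / 2 * Gamma (n / 2))"
      by (simp add: unit_ball_vol_def G) (simp add: n_def add_divide_distrib powr_add powr_half_sqrt)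
    have Vm: "unit_ball_vol DIM('b) = pi powr (real DIM('b) / 2) / Gamma (real DIM('b) / 2 + 1)"
      by (simp add: unit_ball_vol_def)
    have alg: "P / a * (b * a / ((n + q) / 2 * c)) = n * (P * s / (n / 2 * d)) / (n + q) * (d * b / (s * c))"
      if "0 < a" "0 < c" "0 < d" "0 < s" for P a b c d s :: real
      using n q that by (simp add: divide_simps)
    show ?thesis
      unfolding B V Vm by (rule alg) (use pos in simp_all)
  qed
  then have "ennreal (n * unit_ball_vol n / (n + q)) * ?M =
    ennreal (n * unit_ball_vol n / (n + q)) *
      ennreal (Gamma (n / 2) * Gamma ((q + 1) / 2) / (sqrt pi * Gamma ((n + q) / 2)))"
    using n q pos unit_ball_vol_pos[of n] unfolding * by (simp add: ennreal_mult[symmetric])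
  moreover have "0 < n * unit_ball_vol n / (n + q)"
    using n q by simp
  ultimately show ?thesis
    unfolding eq by (rule ennreal_mult_left_cancel[rotated])
qed


section \<open>Differentiation under the integral and duality\<close>

text \<open>A Harnack-type bound controls the kernel gradient near \<open>x\<close> by the one at
  \<open>x\<close>, so a multiple of
  \<open>norm (\<phi> \<zeta> *\<^sub>R \<kappa>' x \<zeta>)\<close> dominates all difference
  quotients. Integrability thus has to be known at \<open>x\<close> alone, which is exactly what
  duality will provide.\<close>

lemma gderiv_lebesgue_integral:
  fixes \<kappa> :: "'a::euclidean_space \<Rightarrow> 'b \<Rightarrow> real"
  assumes "0 < \<delta>"
    and der: "\<And>z \<zeta>. z \<in> ball x \<delta> \<Longrightarrow> \<zeta> \<in> space M \<Longrightarrow> GDERIV (\<lambda>z. \<kappa> z \<zeta>) z :> \<kappa>' z \<zeta>"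
    and bound: "\<And>z \<zeta>. z \<in> ball x \<delta> \<Longrightarrow> \<zeta> \<in> space M \<Longrightarrow> norm (\<kappa>' z \<zeta>) \<le> C * norm (\<kappa>' x \<zeta>)"
    and \<kappa> [measurable]: "\<And>z. \<kappa> z \<in> borel_measurable M" and [measurable]: "\<kappa>' x \<in> borel_measurable M"
    and [measurable]: "\<phi> \<in> borel_measurable M"
    and int': "integrable M (\<lambda>\<zeta>. \<phi> \<zeta> *\<^sub>R \<kappa>' x \<zeta>)"
    and int: "integrable M (\<lambda>\<zeta>. \<kappa> x \<zeta> * \<phi> \<zeta>)"
  shows "GDERIV (\<lambda>z. LINT \<zeta>|M. \<kappa> z \<zeta> * \<phi> \<zeta>) x :> (LINT \<zeta>|M. \<phi> \<zeta> *\<^sub>R \<kappa>' x \<zeta>)"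
proof -
  let ?f = "\<lambda>z. LINT \<zeta>|M. \<kappa> z \<zeta> * \<phi> \<zeta>" and ?D = "LINT \<zeta>|M. \<phi> \<zeta> *\<^sub>R \<kappa>' x \<zeta>"
  have x: "x \<in> ball x \<delta>"
    using \<open>0 < \<delta>\<close> by simp
  have lip: "\<bar>\<kappa> z \<zeta> - \<kappa> x \<zeta>\<bar> \<le> C * norm (\<kappa>' x \<zeta>) * norm (z - x)"
    if "z \<in> ball x \<delta>" "\<zeta> \<in> space M" for z \<zeta>
  proof -
    have "norm (\<kappa> z \<zeta> - \<kappa> x \<zeta>) \<le> (C * norm (\<kappa>' x \<zeta>)) * norm (z - x)"
    proof (rule differentiable_bound[where S = "ball x \<delta>"])
      fix w assume w: "w \<in> ball x \<delta>"
      show "((\<lambda>z. \<kappa> z \<zeta>) has_derivative (\<lambda>h. h \<bullet> \<kappa>' w \<zeta>)) (at w within ball x \<delta>)"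
        using der[OF w that(2)] unfolding gderiv_def by (rule has_derivative_at_withinI)
      have "onorm (\<lambda>h. h \<bullet> \<kappa>' w \<zeta>) \<le> norm (\<kappa>' w \<zeta>)"
        by (rule onorm_bound) (simp_all add: Cauchy_Schwarz_ineq2 mult.commute)
      then show "onorm (\<lambda>h. h \<bullet> \<kappa>' w \<zeta>) \<le> C * norm (\<kappa>' x \<zeta>)"
        using bound[OF w that(2)] by simp
    qed (use x that in auto)
    then show ?thesis
      by simp
  qed
  have intz: "integrable M (\<lambda>\<zeta>. \<kappa> z \<zeta> * \<phi> \<zeta>)" if "z \<in> ball x \<delta>" for z
  proof -
    have "integrable M (\<lambda>\<zeta>. (\<kappa> z \<zeta> - \<kappa> x \<zeta>) * \<phi> \<zeta>)"
    proof (rule Bochner_Integration.integrable_bound)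
      show "integrable M (\<lambda>\<zeta>. (C * norm (z - x)) * norm (\<phi> \<zeta> *\<^sub>R \<kappa>' x \<zeta>))"
        by (rule integrable_mult_right[OF integrable_norm[OF int']])
      show "AE \<zeta> in M. norm ((\<kappa> z \<zeta> - \<kappa> x \<zeta>) * \<phi> \<zeta>) \<le> norm ((C * norm (z - x)) * norm (\<phi> \<zeta> *\<^sub>R \<kappa>' x \<zeta>))"
      proof (rule AE_I2)
        fix \<zeta> assume "\<zeta> \<in> space M"
        from mult_right_mono[OF lip[OF that this], of "\<bar>\<phi> \<zeta>\<bar>"]
        show "norm ((\<kappa> z \<zeta> - \<kappa> x \<zeta>) * \<phi> \<zeta>) \<le> norm ((C * norm (z - x)) * norm (\<phi> \<zeta> *\<^sub>R \<kappa>' x \<zeta>))"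
          by (simp add: abs_mult mult_ac) (smt (verit) abs_ge_self abs_mult abs_norm_cancel mult_right_mono norm_ge_zero mult_nonneg_nonneg abs_ge_zero)
      qed
    qed measurable
    from Bochner_Integration.integrable_add[OF this int] show ?thesis
      by (simp add: algebra_simps)
  qed
  have "((\<lambda>z. (?f z - ?f x - (z - x) \<bullet> ?D) / norm (z - x)) \<longlongrightarrow> 0) (at x)"
    unfolding tendsto_at_iff_sequentially
  proof (intro allI impI)
    fix X :: "nat \<Rightarrow> 'a" assume X: "X \<longlonglongrightarrow> x"
    \<comment> \<open>Replacing stray terms by \<open>x\<close> makes the domination hold for every
      index, not just eventually.\<close>
    define Z where "Z i = (if X i \<in> ball x \<delta> then X i else x)" for i
    have Zb: "Z i \<in> ball x \<delta>" for i
      using x by (simp add: Z_def)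
    have "\<forall>\<^sub>F i in sequentially. X i \<in> ball x \<delta>"
      using X x by (intro topological_tendstoD) auto
    then have XZ: "\<forall>\<^sub>F i in sequentially. X i = Z i"
      by eventually_elim (simp add: Z_def)
    then have Z: "Z \<longlonglongrightarrow> x"
      using X by (simp cong: tendsto_cong)
    let ?e = "\<lambda>z \<zeta>. (\<kappa> z \<zeta> - \<kappa> x \<zeta> - (z - x) \<bullet> \<kappa>' x \<zeta>) / norm (z - x)"
    have "(\<lambda>i. LINT \<zeta>|M. ?e (Z i) \<zeta> * \<phi> \<zeta>) \<longlonglongrightarrow> (LINT \<zeta>|M. 0)"
    proof (rule integral_dominated_convergence)
      show "integrable M (\<lambda>\<zeta>. (C + 1) * norm (\<phi> \<zeta> *\<^sub>R \<kappa>' x \<zeta>))"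
        by (rule integrable_mult_right[OF integrable_norm[OF int']])
      show "AE \<zeta> in M. (\<lambda>i. ?e (Z i) \<zeta> * \<phi> \<zeta>) \<longlonglongrightarrow> 0"
      proof (rule AE_I2)
        fix \<zeta> assume "\<zeta> \<in> space M"
        then have "((\<lambda>z. norm (\<kappa> z \<zeta> - \<kappa> x \<zeta> - (z - x) \<bullet> \<kappa>' x \<zeta>) / norm (z - x)) \<longlongrightarrow> 0) (at x)"
          using der[OF x] unfolding gderiv_def has_derivative_iff_norm by simp
        then have "((\<lambda>z. norm (?e z \<zeta>)) \<longlongrightarrow> 0) (at x)"
          by simp
        \<comment> \<open>Division by 0 yields 0, so \<open>?e x \<zeta> = 0\<close>. The limit
          thereby becomes continuity at \<open>x\<close>, and terms with \<open>Z i = x\<close> do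
          no harm.\<close>
        then have "((\<lambda>z. ?e z \<zeta>) \<longlongrightarrow> ?e x \<zeta>) (at x)"
          by (simp only: tendsto_norm_zero_iff) simp
        then have "(\<lambda>i. ?e (Z i) \<zeta>) \<longlonglongrightarrow> ?e x \<zeta>"
          using isCont_tendsto_compose[of x "\<lambda>z. ?e z \<zeta>" Z sequentially] Z by (simp add: isCont_def)
        then show "(\<lambda>i. ?e (Z i) \<zeta> * \<phi> \<zeta>) \<longlonglongrightarrow> 0"
          by (intro tendsto_mult_left_zero) simp
      qed
      show "AE \<zeta> in M. norm (?e (Z i) \<zeta> * \<phi> \<zeta>) \<le> (C + 1) * norm (\<phi> \<zeta> *\<^sub>R \<kappa>' x \<zeta>)" for i
      proof (rule AE_I2)
        fix \<zeta> assume \<zeta>: "\<zeta> \<in> space M"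
        have C: "0 \<le> C * norm (\<kappa>' x \<zeta>)"
          using bound[OF x \<zeta>] norm_ge_zero order_trans by blast
        have "\<bar>\<kappa> (Z i) \<zeta> - \<kappa> x \<zeta> - (Z i - x) \<bullet> \<kappa>' x \<zeta>\<bar> \<le>
            C * norm (\<kappa>' x \<zeta>) * norm (Z i - x) + norm (Z i - x) * norm (\<kappa>' x \<zeta>)"
          using lip[OF Zb \<zeta>, of i] Cauchy_Schwarz_ineq2[of "Z i - x" "\<kappa>' x \<zeta>"] by linarith
        also have "\<dots> = (C + 1) * norm (\<kappa>' x \<zeta>) * norm (Z i - x)"
          by (simp add: algebra_simps)
        finally have "\<bar>?e (Z i) \<zeta>\<bar> \<le> (C + 1) * norm (\<kappa>' x \<zeta>)"
          using C by (cases "Z i = x") (simp_all add: divide_le_eq algebra_simps)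
        from mult_right_mono[OF this, of "\<bar>\<phi> \<zeta>\<bar>"]
        show "norm (?e (Z i) \<zeta> * \<phi> \<zeta>) \<le> (C + 1) * norm (\<phi> \<zeta> *\<^sub>R \<kappa>' x \<zeta>)"
          by (simp add: abs_mult mult_ac)
      qed
    qed measurable
    moreover have e: "(LINT \<zeta>|M. ?e z \<zeta> * \<phi> \<zeta>) = (?f z - ?f x - (z - x) \<bullet> ?D) / norm (z - x)"
      if "z \<in> ball x \<delta>" for z
    proof -
      have inner: "integrable M (\<lambda>\<zeta>. (z - x) \<bullet> (\<phi> \<zeta> *\<^sub>R \<kappa>' x \<zeta>))"
        using int' by (rule integrable_inner_right)
      have "(LINT \<zeta>|M. \<kappa> z \<zeta> * \<phi> \<zeta> - \<kappa> x \<zeta> * \<phi> \<zeta> - (z - x) \<bullet> (\<phi> \<zeta> *\<^sub>R \<kappa>' x \<zeta>)) =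
          ?f z - ?f x - (LINT \<zeta>|M. (z - x) \<bullet> (\<phi> \<zeta> *\<^sub>R \<kappa>' x \<zeta>))"
        by (simp only: Bochner_Integration.integral_diff[OF intz[OF that] int]
            Bochner_Integration.integral_diff[OF Bochner_Integration.integrable_diff[OF intz[OF that] int] inner])
      also have "(LINT \<zeta>|M. (z - x) \<bullet> (\<phi> \<zeta> *\<^sub>R \<kappa>' x \<zeta>)) = (z - x) \<bullet> ?D"
        using int' by (intro integral_inner_right) simp
      finally have "(?f z - ?f x - (z - x) \<bullet> ?D) / norm (z - x) =
        (LINT \<zeta>|M. (\<kappa> z \<zeta> * \<phi> \<zeta> - \<kappa> x \<zeta> * \<phi> \<zeta> - (z - x) \<bullet> (\<phi> \<zeta> *\<^sub>R \<kappa>' x \<zeta>)) / norm (z - x))"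
        by (simp only: integral_divide_zero)
      also have "\<dots> = (LINT \<zeta>|M. ?e z \<zeta> * \<phi> \<zeta>)"
        by (intro Bochner_Integration.integral_cong) (simp_all add: algebra_simps)
      finally show ?thesis ..
    qed
    ultimately have "(\<lambda>i. (?f (Z i) - ?f x - (Z i - x) \<bullet> ?D) / norm (Z i - x)) \<longlonglongrightarrow> 0"
      by (simp only: e[OF Zb] Bochner_Integration.integral_zero)
    then show "((\<lambda>z. (?f z - ?f x - (z - x) \<bullet> ?D) / norm (z - x)) \<circ> X) \<longlonglongrightarrow> 0"
      by (rule Lim_transform_eventually) (use XZ in eventually_elim, simp)
  qed
  then show ?thesis
    unfolding gderiv_def has_derivative_iff_norm
    by (auto simp: bounded_linear_inner_left dest: tendsto_norm)
qed

section \<open>Conjugate exponents, sharp duality pairings and optimal constants\<close>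

lemma conjugate_exponent_1: "conjugate_exponent 1 = \<infinity>"
  by (simp add: conjugate_exponent_def)

lemma conjugate_exponent_ennreal:
  assumes "1 < q"
  shows "conjugate_exponent (ennreal q) = ennreal (q / (q - 1))"
proof -
  have "inverse (ennreal (q / (q - 1))) + inverse (ennreal q) = 1"
    using assms by (simp add: inverse_ennreal ennreal_plus[symmetric] field_simps flip: ennreal_1 del: ennreal_plus)
  moreover have "1 \<le> ennreal q"
    using assms by simp
  ultimately show ?thesis
    using conjugate_exponent_iff by metis
qed

text \<open>Hoelder's inequality with its case of equality; \<open>K\<close> is the norm of
  \<open>h\<close> for the exponent \<open>q\<close>, so the norm of the functional defined by
  \<open>h\<close> is attained.\<close>

lemma Lp_pairing_finite:
  fixes h \<phi> :: "'b \<Rightarrow> real" and q K :: real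
  defines "p \<equiv> ennreal (q / (q - 1))"
  assumes q: "1 < q" and K: "0 < K" and [measurable]: "h \<in> borel_measurable M"
    and h: "(\<integral>\<^sup>+\<zeta>. ennreal (\<bar>h \<zeta>\<bar> powr q) \<partial>M) = ennreal (K powr q)"
  shows Lp_pairing_finite_integrable: "\<phi> \<in> Lp_space p M \<Longrightarrow> integrable M (\<lambda>\<zeta>. \<phi> \<zeta> * h \<zeta>)"
    and Lp_pairing_finite_le: "\<phi> \<in> Lp_space p M \<Longrightarrow> \<bar>LINT \<zeta>|M. \<phi> \<zeta> * h \<zeta>\<bar> \<le> K * Lp_norm p M \<phi>"
    and Lp_pairing_finite_extremal: "\<exists>\<phi>\<in>Lp_space p M. 0 < Lp_norm p M \<phi> \<and> (LINT \<zeta>|M. \<phi> \<zeta> * h \<zeta>) = K * Lp_norm p M \<phi>"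
proof -
  define r where "r = q / (q - 1)"
  have r: "1 < r" "1 / r + 1 / q = 1" "(q - 1) * r = q"
    using q by (simp_all add: r_def field_simps)
  have p: "p = ennreal r" "p \<noteq> \<infinity>" "enn2real p = r"
    using r by (simp_all add: p_def r_def[symmetric])
  have hq: "integrable M (\<lambda>\<zeta>. \<bar>h \<zeta>\<bar> powr q)" "(LINT \<zeta>|M. \<bar>h \<zeta>\<bar> powr q) = K powr q"
    using h by (auto intro!: integrableI_nonneg simp: integral_eq_nn_integral)
  {
    assume "\<phi> \<in> Lp_space p M"
    then have [measurable]: "\<phi> \<in> borel_measurable M" and \<phi>: "integrable M (\<lambda>\<zeta>. \<bar>\<phi> \<zeta>\<bar> powr r)"
      using p(2) by (simp_all add: Lp_space_def p(3))
    have norm: "Lp_norm p M \<phi> = (LINT \<zeta>|M. \<bar>\<phi> \<zeta>\<bar> powr r) powr (1 / r)"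
      using p(2) by (simp add: Lp_norm_def p(3))
    \<comment> \<open>Young's inequality for \<open>\<bar>\<phi> \<zeta>\<bar> / s\<close> and
      \<open>\<bar>h \<zeta>\<bar> / K\<close>. The scale \<open>s\<close> stays free:
      \<open>s = 1\<close> gives integrability, and the norm of \<open>\<phi>\<close> gives the
      sharp bound.\<close>
    have young: "\<bar>\<phi> \<zeta> * h \<zeta>\<bar> \<le> s * K * (\<bar>\<phi> \<zeta>\<bar> powr r / (r * s powr r) + \<bar>h \<zeta>\<bar> powr q / (q * K powr q))"
      if "0 < s" for s \<zeta>
    proof -
      have "\<bar>\<phi> \<zeta>\<bar> / s * (\<bar>h \<zeta>\<bar> / K) \<le> (\<bar>\<phi> \<zeta>\<bar> / s) powr r / r + (\<bar>h \<zeta>\<bar> / K) powr q / q"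
        using r q K that by (intro Youngs_inequality) auto
      from mult_left_mono[OF this, of "s * K"] show ?thesis
        using that K by (simp add: powr_divide abs_mult mult.commute)
    qed
    have bnd_int: "integrable M (\<lambda>\<zeta>. s * K * (\<bar>\<phi> \<zeta>\<bar> powr r / (r * s powr r) + \<bar>h \<zeta>\<bar> powr q / (q * K powr q)))" for s
      using \<phi> hq(1) by simp
    show intg: "integrable M (\<lambda>\<zeta>. \<phi> \<zeta> * h \<zeta>)"
      by (rule Bochner_Integration.integrable_bound[OF bnd_int[of 1]]) (use young[of 1] in \<open>auto intro: order_trans[OF _ abs_ge_self]\<close>)
    have bnd: "\<bar>LINT \<zeta>|M. \<phi> \<zeta> * h \<zeta>\<bar> \<le> s * K * ((LINT \<zeta>|M. \<bar>\<phi> \<zeta>\<bar> powr r) / (r * s powr r) + 1 / q)" if "0 < s" for s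
    proof -
      have "\<bar>LINT \<zeta>|M. \<phi> \<zeta> * h \<zeta>\<bar> \<le> (LINT \<zeta>|M. \<bar>\<phi> \<zeta> * h \<zeta>\<bar>)"
        by (rule integral_abs_bound)
      also have "\<dots> \<le> (LINT \<zeta>|M. s * K * (\<bar>\<phi> \<zeta>\<bar> powr r / (r * s powr r) + \<bar>h \<zeta>\<bar> powr q / (q * K powr q)))"
        using young[OF that] intg bnd_int by (intro integral_mono) auto
      also have "\<dots> = s * K * ((LINT \<zeta>|M. \<bar>\<phi> \<zeta>\<bar> powr r) / (r * s powr r) + 1 / q)"
        using \<phi> hq K by simp
      finally show ?thesis .
    qed
    show "\<bar>LINT \<zeta>|M. \<phi> \<zeta> * h \<zeta>\<bar> \<le> K * Lp_norm p M \<phi>"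
    proof (cases "(LINT \<zeta>|M. \<bar>\<phi> \<zeta>\<bar> powr r) = 0")
      case True
      then have "AE \<zeta> in M. \<phi> \<zeta> = 0"
        using integral_nonneg_eq_0_iff_AE[OF \<phi>] by auto
      then have "AE \<zeta> in M. \<phi> \<zeta> * h \<zeta> = 0"
        by eventually_elim simp
      then have "(LINT \<zeta>|M. \<phi> \<zeta> * h \<zeta>) = 0"
        by (rule integral_eq_zero_AE)
      then show ?thesis
        using K by (simp add: norm)
    next
      case False
      define N where "N = Lp_norm p M \<phi>"
      have pos: "0 < (LINT \<zeta>|M. \<bar>\<phi> \<zeta>\<bar> powr r)"
        using False by (simp add: order_less_le Bochner_Integration.integral_nonneg)
      then have N: "0 < N" "N powr r = (LINT \<zeta>|M. \<bar>\<phi> \<zeta>\<bar> powr r)"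
        using r by (simp_all add: N_def norm powr_powr)
      \<comment> \<open>With \<open>s\<close> equal to the norm of \<open>\<phi>\<close> the bracket
        becomes \<open>1 / r + 1 / q = 1\<close>.\<close>
      from bnd[OF N(1)] show ?thesis
        using pos r unfolding N(2)[symmetric] N_def[symmetric] by (simp add: mult.commute)
    qed
  }
  \<comment> \<open>The extremal function of Hoelder's inequality: both
    \<open>\<bar>?\<phi>\<bar> powr r\<close> and the product with \<open>h\<close> equal
    \<open>\<bar>h\<bar> powr q\<close>.\<close>
  let ?\<phi> = "\<lambda>\<zeta>. sgn (h \<zeta>) * \<bar>h \<zeta>\<bar> powr (q - 1)"
  have abs: "\<bar>?\<phi> \<zeta>\<bar> powr r = \<bar>h \<zeta>\<bar> powr q" for \<zeta>
    using r by (cases "h \<zeta> = 0") (simp_all add: abs_mult powr_powr)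
  have mult: "?\<phi> \<zeta> * h \<zeta> = \<bar>h \<zeta>\<bar> powr q" for \<zeta>
  proof (cases "h \<zeta> = 0")
    case False
    then have "\<bar>h \<zeta>\<bar> powr q = \<bar>h \<zeta>\<bar> powr (q - 1) * \<bar>h \<zeta>\<bar>"
      by (simp add: powr_diff)
    then show ?thesis
      by (simp add: sgn_if)
  qed simp
  have "?\<phi> \<in> Lp_space p M"
    using hq(1) p(2) by (simp add: Lp_space_def p(3) abs)
  moreover have N: "Lp_norm p M ?\<phi> = K powr (q - 1)"
  proof -
    have "q * (1 / r) = q - 1"
      using r(1,3) by (simp add: field_simps)
    then show ?thesis
      using p(2) by (simp add: Lp_norm_def p(3) abs hq(2) powr_powr)
  qed
  moreover have "(LINT \<zeta>|M. ?\<phi> \<zeta> * h \<zeta>) = K * K powr (q - 1)"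
    unfolding mult hq(2) using K by (simp add: powr_diff)
  ultimately show "\<exists>\<phi>\<in>Lp_space p M. 0 < Lp_norm p M \<phi> \<and> (LINT \<zeta>|M. \<phi> \<zeta> * h \<zeta>) = K * Lp_norm p M \<phi>"
    using K by (intro bexI[of _ ?\<phi>]) simp_all
qed

lemma Lp_pairing_infinity:
  fixes h \<phi> :: "'b \<Rightarrow> real" and K :: real
  assumes K: "0 < K" and [measurable]: "h \<in> borel_measurable M"
    and h: "(\<integral>\<^sup>+\<zeta>. ennreal \<bar>h \<zeta>\<bar> \<partial>M) = ennreal K"
  shows Lp_pairing_infinity_integrable: "\<phi> \<in> Lp_space \<infinity> M \<Longrightarrow> integrable M (\<lambda>\<zeta>. \<phi> \<zeta> * h \<zeta>)"
    and Lp_pairing_infinity_le: "\<phi> \<in> Lp_space \<infinity> M \<Longrightarrow> \<bar>LINT \<zeta>|M. \<phi> \<zeta> * h \<zeta>\<bar> \<le> K * Lp_norm \<infinity> M \<phi>"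
    and Lp_pairing_infinity_extremal: "\<exists>\<phi>\<in>Lp_space \<infinity> M. 0 < Lp_norm \<infinity> M \<phi> \<and> (LINT \<zeta>|M. \<phi> \<zeta> * h \<zeta>) = K * Lp_norm \<infinity> M \<phi>"
proof -
  have hi: "integrable M (\<lambda>\<zeta>. \<bar>h \<zeta>\<bar>)" "(LINT \<zeta>|M. \<bar>h \<zeta>\<bar>) = K"
    using h K by (auto intro!: integrableI_nonneg simp: integral_eq_nn_integral)
  show intg: "integrable M (\<lambda>\<zeta>. \<phi> \<zeta> * h \<zeta>)"
    and le: "\<bar>LINT \<zeta>|M. \<phi> \<zeta> * h \<zeta>\<bar> \<le> K * Lp_norm \<infinity> M \<phi>"
    if \<phi>: "\<phi> \<in> Lp_space \<infinity> M" for \<phi>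
  proof -
    define N where "N = Lp_norm \<infinity> M \<phi>"
    have [measurable]: "\<phi> \<in> borel_measurable M" and fin: "esssup M (\<lambda>y. ennreal \<bar>\<phi> y\<bar>) < \<infinity>"
      using \<phi> by (simp_all add: Lp_space_def)
    have "AE \<zeta> in M. ennreal \<bar>\<phi> \<zeta>\<bar> \<le> ennreal N"
      using esssup_AE[of "\<lambda>y. ennreal \<bar>\<phi> y\<bar>" M] fin by (simp add: N_def Lp_norm_def)
    then have bnd: "AE \<zeta> in M. \<bar>\<phi> \<zeta> * h \<zeta>\<bar> \<le> N * \<bar>h \<zeta>\<bar>"
      by eventually_elim (auto simp: abs_mult N_def Lp_norm_def intro!: mult_right_mono)
    show i: "integrable M (\<lambda>\<zeta>. \<phi> \<zeta> * h \<zeta>)"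
      by (rule Bochner_Integration.integrable_bound[of M "\<lambda>\<zeta>. N * \<bar>h \<zeta>\<bar>"])
        (use hi bnd in \<open>auto simp: N_def Lp_norm_def abs_mult\<close>)
    have "\<bar>LINT \<zeta>|M. \<phi> \<zeta> * h \<zeta>\<bar> \<le> (LINT \<zeta>|M. \<bar>\<phi> \<zeta> * h \<zeta>\<bar>)"
      by (rule integral_abs_bound)
    also have "\<dots> \<le> (LINT \<zeta>|M. N * \<bar>h \<zeta>\<bar>)"
      using i hi bnd by (intro integral_mono_AE) auto
    also have "\<dots> = K * N"
      using hi by simp
    finally show "\<bar>LINT \<zeta>|M. \<phi> \<zeta> * h \<zeta>\<bar> \<le> K * Lp_norm \<infinity> M \<phi>"
      by (simp add: N_def)
  qed
  let ?\<phi> = "\<lambda>\<zeta>. sgn (h \<zeta>)"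
  have mult: "?\<phi> \<zeta> * h \<zeta> = \<bar>h \<zeta>\<bar>" for \<zeta>
    by (simp add: sgn_if)
  have ess: "esssup M (\<lambda>y. ennreal \<bar>?\<phi> y\<bar>) \<le> 1"
    by (rule esssup_I) (auto simp: sgn_if)
  then have L: "?\<phi> \<in> Lp_space \<infinity> M"
    by (simp add: Lp_space_def) (metis ennreal_one_less_top order_le_less_trans)
  have N: "Lp_norm \<infinity> M ?\<phi> \<le> 1"
    using ess by (simp add: Lp_norm_def) (metis enn2real_leI ennreal_1 zero_le_one)
  have int: "(LINT \<zeta>|M. ?\<phi> \<zeta> * h \<zeta>) = K"
    unfolding mult by (rule hi)
  \<comment> \<open>The inequality just proved, applied to the sign of \<open>h\<close>, forces its
    norm to be at least 1; no direct lower bound for the essential supremum is needed.\<close>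
  then have "K \<le> K * Lp_norm \<infinity> M ?\<phi>"
    using le[OF L] K by simp
  then have "Lp_norm \<infinity> M ?\<phi> = 1"
    using N K by simp
  then show "\<exists>\<phi>\<in>Lp_space \<infinity> M. 0 < Lp_norm \<infinity> M \<phi> \<and> (LINT \<zeta>|M. \<phi> \<zeta> * h \<zeta>) = K * Lp_norm \<infinity> M \<phi>"
    using L int by (intro bexI[of _ ?\<phi>]) simp_all
qed

text \<open>Because one \<open>K\<close> serves every direction, pairing the gradient with its own
  direction bounds the full norm by \<open>K\<close>. An extremal function for any single direction
  gives the matching lower bound, for the directional and the full constant alike.\<close>

lemma optimal_const_eqI:
  fixes k :: "'b \<Rightarrow> 'a::euclidean_space" and M :: "'b measure" and q :: ennreal
  defines "L \<equiv> Lp_space (conjugate_exponent q) M" and "N \<equiv> Lp_norm (conjugate_exponent q) M"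
  assumes K: "0 < K"
    and grad: "\<And>\<phi>. \<phi> \<in> borel_measurable M \<Longrightarrow> integrable M (\<lambda>\<zeta>. \<phi> \<zeta> *\<^sub>R k \<zeta>) \<Longrightarrow>
      gradient (P \<phi>) x = (LINT \<zeta>|M. \<phi> \<zeta> *\<^sub>R k \<zeta>)"
    and intg: "\<And>\<phi> l. \<phi> \<in> L \<Longrightarrow> norm l = 1 \<Longrightarrow> integrable M (\<lambda>\<zeta>. \<phi> \<zeta> * (k \<zeta> \<bullet> l))"
    and le: "\<And>\<phi> l. \<phi> \<in> L \<Longrightarrow> norm l = 1 \<Longrightarrow> \<bar>LINT \<zeta>|M. \<phi> \<zeta> * (k \<zeta> \<bullet> l)\<bar> \<le> K * N \<phi>"
    and ext: "\<And>l. norm l = 1 \<Longrightarrow> \<exists>\<phi>\<in>L. 0 < N \<phi> \<and> (LINT \<zeta>|M. \<phi> \<zeta> * (k \<zeta> \<bullet> l)) = K * N \<phi>"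
  shows "optimal_const M P q x = ennreal K \<and> (\<forall>l. norm l = 1 \<longrightarrow> optimal_const_dir M P q x l = ennreal K)"
proof -
  have gi: "integrable M (\<lambda>\<zeta>. \<phi> \<zeta> *\<^sub>R k \<zeta>)" if "\<phi> \<in> L" for \<phi>
  proof -
    \<comment> \<open>Basis vectors are unit directions, so the directional hypothesis gives
      integrability of each component.\<close>
    have "integrable M (\<lambda>\<zeta>. \<Sum>b\<in>Basis. (\<phi> \<zeta> * (k \<zeta> \<bullet> b)) *\<^sub>R b)"
      using intg[OF that] by (intro Bochner_Integration.integrable_sum integrable_scaleR_left) auto
    also have "(\<lambda>\<zeta>. \<Sum>b\<in>Basis. (\<phi> \<zeta> * (k \<zeta> \<bullet> b)) *\<^sub>R b) = (\<lambda>\<zeta>. \<phi> \<zeta> *\<^sub>R k \<zeta>)"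
      by (simp flip: scaleR_scaleR scaleR_sum_right add: euclidean_representation)
    finally show ?thesis .
  qed
  have dir: "gradient (P \<phi>) x \<bullet> l = (LINT \<zeta>|M. \<phi> \<zeta> * (k \<zeta> \<bullet> l))" if "\<phi> \<in> L" for \<phi> l
  proof -
    have "\<phi> \<in> borel_measurable M"
      using that by (simp add: L_def Lp_space_def)
    then show ?thesis
      using grad gi[OF that] by (simp flip: integral_inner_left)
  qed
  have nonneg: "0 \<le> N \<phi>" for \<phi>
    by (simp add: N_def Lp_norm_def)
  have upper: "ennreal (norm (gradient (P \<phi>) x)) \<le> ennreal K * ennreal (N \<phi>)" if \<phi>: "\<phi> \<in> L" for \<phi>
  proof -
    define g where "g = gradient (P \<phi>) x"
    have "norm g \<le> K * N \<phi>"
    proof (cases "g = 0")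
      case True
      then show ?thesis
        using K nonneg by simp
    next
      case False
      then have "norm g = g \<bullet> sgn g" "norm (sgn g) = 1"
        by (simp_all add: sgn_div_norm norm_sgn power2_norm_eq_inner[symmetric] power2_eq_square)
      then show ?thesis
        using le[OF \<phi>, of "sgn g"] dir[OF \<phi>, of "sgn g"] by (simp add: g_def)
    qed
    then show ?thesis
      using K nonneg by (simp add: g_def ennreal_mult[symmetric] ennreal_leI)
  qed
  have lower: "ennreal K \<le> C"
    if C: "\<forall>\<phi>\<in>L. ennreal \<bar>gradient (P \<phi>) x \<bullet> l\<bar> \<le> C * ennreal (N \<phi>)" and l: "norm l = 1" for C l
  proof -
    obtain \<phi> where \<phi>: "\<phi> \<in> L" "0 < N \<phi>" "(LINT \<zeta>|M. \<phi> \<zeta> * (k \<zeta> \<bullet> l)) = K * N \<phi>"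
      using ext[OF l] by blast
    have "ennreal K * ennreal (N \<phi>) \<le> C * ennreal (N \<phi>)"
      using C[rule_format, OF \<phi>(1)] K \<phi> by (simp add: dir ennreal_mult[symmetric])
    then show ?thesis
      using \<phi>(2) by (simp add: ennreal_mult_le_mult_iff mult.commute[of _ "ennreal (N \<phi>)"])
  qed
  have dir_le: "ennreal \<bar>gradient (P \<phi>) x \<bullet> l\<bar> \<le> ennreal (norm (gradient (P \<phi>) x))" if "norm l = 1" for \<phi> l
    using Cauchy_Schwarz_ineq2[of "gradient (P \<phi>) x" l] that by (simp add: ennreal_leI)
  obtain l0 :: 'a where l0: "norm l0 = 1"
    using nonempty_Basis norm_Basis by blast
  have "optimal_const M P q x = ennreal K"
    unfolding optimal_const_def L_def[symmetric] N_def[symmetric]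
  proof (rule antisym)
    show "Inf {C. \<forall>\<phi>\<in>L. ennreal (norm (gradient (P \<phi>) x)) \<le> C * ennreal (N \<phi>)} \<le> ennreal K"
      by (rule Inf_lower) (simp add: upper)
    show "ennreal K \<le> Inf {C. \<forall>\<phi>\<in>L. ennreal (norm (gradient (P \<phi>) x)) \<le> C * ennreal (N \<phi>)}"
      by (rule Inf_greatest, rule lower[OF _ l0]) (use dir_le[OF l0] order_trans in blast)
  qed
  moreover have "optimal_const_dir M P q x l = ennreal K" if l: "norm l = 1" for l
    unfolding optimal_const_dir_def L_def[symmetric] N_def[symmetric]
  proof (rule antisym)
    show "Inf {C. \<forall>\<phi>\<in>L. ennreal \<bar>gradient (P \<phi>) x \<bullet> l\<bar> \<le> C * ennreal (N \<phi>)} \<le> ennreal K"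
      by (rule Inf_lower) (use upper dir_le[OF l] order_trans in blast)
    show "ennreal K \<le> Inf {C. \<forall>\<phi>\<in>L. ennreal \<bar>gradient (P \<phi>) x \<bullet> l\<bar> \<le> C * ennreal (N \<phi>)}"
      by (rule Inf_greatest, rule lower[OF _ l]) simp
  qed
  ultimately show ?thesis
    by blast
qed

theorem optimal_const_finite:
  fixes k :: "'b \<Rightarrow> 'a::euclidean_space" and M :: "'b measure"
  assumes q: "1 < q" and K: "0 < K" and [measurable]: "k \<in> borel_measurable M"
    and grad: "\<And>\<phi>. \<phi> \<in> borel_measurable M \<Longrightarrow> integrable M (\<lambda>\<zeta>. \<phi> \<zeta> *\<^sub>R k \<zeta>) \<Longrightarrow>
      gradient (P \<phi>) x = (LINT \<zeta>|M. \<phi> \<zeta> *\<^sub>R k \<zeta>)"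
    and k: "\<And>l. norm l = 1 \<Longrightarrow> (\<integral>\<^sup>+\<zeta>. ennreal (\<bar>k \<zeta> \<bullet> l\<bar> powr q) \<partial>M) = ennreal (K powr q)"
  shows "optimal_const M P (ennreal q) x = ennreal K \<and>
    (\<forall>l. norm l = 1 \<longrightarrow> optimal_const_dir M P (ennreal q) x l = ennreal K)"
  by (rule optimal_const_eqI[where k = k], unfold conjugate_exponent_ennreal[OF q])
    (use K grad Lp_pairing_finite[OF q K _ k] in auto)

theorem optimal_const_one:
  fixes k :: "'b \<Rightarrow> 'a::euclidean_space" and M :: "'b measure"
  assumes K: "0 < K" and [measurable]: "k \<in> borel_measurable M"
    and grad: "\<And>\<phi>. \<phi> \<in> borel_measurable M \<Longrightarrow> integrable M (\<lambda>\<zeta>. \<phi> \<zeta> *\<^sub>R k \<zeta>) \<Longrightarrow>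
      gradient (P \<phi>) x = (LINT \<zeta>|M. \<phi> \<zeta> *\<^sub>R k \<zeta>)"
    and k: "\<And>l. norm l = 1 \<Longrightarrow> (\<integral>\<^sup>+\<zeta>. ennreal \<bar>k \<zeta> \<bullet> l\<bar> \<partial>M) = ennreal K"
  shows "optimal_const M P 1 x = ennreal K \<and>
    (\<forall>l. norm l = 1 \<longrightarrow> optimal_const_dir M P 1 x l = ennreal K)"
  by (rule optimal_const_eqI[where k = k], unfold conjugate_exponent_1)
    (use K grad Lp_pairing_infinity[OF K _ k] in auto)


section \<open>The half-space kernel\<close>

text \<open>In the notation of the overview, \<open>stereo\<close> is the unit field w and
  \<open>DIM('b) / snd z\<close> is the factor A; the rest of the scalar is the kernel
  itself.\<close>

definition half_space_kernel_gradient :: "'b::euclidean_space \<times> real \<Rightarrow> 'b \<Rightarrow> 'b \<times> real" where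
  "half_space_kernel_gradient z y =
    (half_space_const (DIM('b) + 1) * real DIM('b) / snd z *
      (snd z / stereo_denom (fst z) (snd z) y) ^ DIM('b)) *\<^sub>R stereo (fst z) (snd z) y"

lemma half_space_const_pos: "0 < half_space_const (Suc m)"
  unfolding half_space_const_def by (intro divide_pos_pos mult_pos_pos) (auto intro!: Gamma_real_pos)

text \<open>Expresses that the kernel has total mass 1: it is
  \<open>half_space_const (m + 1) / 2 ^ m\<close> times the Jacobian of the stereographic
  projection, and the integral of that Jacobian is the area of the sphere.\<close>

lemma half_space_const_eq:
  assumes "1 \<le> m"
  shows "half_space_const (m + 1) * ((real m + 1) * unit_ball_vol (real m + 1)) = 2 ^ m"
proof -
  \<comment> \<open>The exponent \<open>n - 2\<close> in \<open>half_space_const\<close> is a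
    natural-number difference; with \<open>n = m + 1\<close> it equals \<open>k\<close>.\<close>
  obtain k where k: "m = Suc k"
    using assms by (cases m) auto
  define G P where "G = Gamma ((real m + 1) / 2)" and "P = pi powr ((real m + 1) / 2)"
  have GP: "0 < G" "0 < P"
    by (simp_all add: G_def P_def Gamma_real_pos)
  have "Gamma ((real m + 1) / 2 + 1) = (real m + 1) / 2 * G"
    unfolding G_def by (rule Gamma_plus1) (auto dest!: nonpos_Ints_nonpos)
  then have v: "unit_ball_vol (real m + 1) = P / ((real m + 1) / 2 * G)"
    unfolding unit_ball_vol_def P_def by (simp only:)
  have c: "half_space_const (m + 1) = 2 ^ k * G / P"
    unfolding half_space_const_def G_def P_def by (simp add: k add.commute)
  have "2 ^ k * g / p * (r * (p / (r / 2 * g))) = 2 * 2 ^ k" if "0 < g" "0 < p" "0 < r" for g p r :: real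
    using that by simp
  from this[OF GP, of "real m + 1"] show ?thesis
    unfolding v c by (simp add: k)
qed

text \<open>Here the stereographic projection enters: it arises from differentiating in the interior
  point, with the boundary point fixed.\<close>

lemma gderiv_half_space_ratio:
  fixes z :: "'b::euclidean_space \<times> real"
  assumes "0 < snd z"
  shows "GDERIV (\<lambda>z. snd z / stereo_denom (fst z) (snd z) y) z :>
    (1 / stereo_denom (fst z) (snd z) y) *\<^sub>R stereo (fst z) (snd z) y"
proof -
  let ?D = "\<lambda>z. stereo_denom (fst z) (snd z) y"
  have D: "?D z \<noteq> 0"
    using stereo_denom_pos[OF assms] by (metis less_irrefl)
  have "(?D has_derivative (\<lambda>h. 2 * (snd z * snd h) - 2 * ((y - fst z) \<bullet> fst h))) (at z)"
    unfolding stereo_denom_def power2_norm_eq_inner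
    by (auto intro!: derivative_eq_intros simp: inner_commute algebra_simps)
  from has_derivative_divide'[OF has_derivative_snd[OF has_derivative_ident] this D]
  have "((\<lambda>z. snd z / ?D z) has_derivative
      (\<lambda>h. (snd h * ?D z - snd z * (2 * (snd z * snd h) - 2 * ((y - fst z) \<bullet> fst h))) / (?D z * ?D z))) (at z)" .
  also have "(\<lambda>h. (snd h * ?D z - snd z * (2 * (snd z * snd h) - 2 * ((y - fst z) \<bullet> fst h))) / (?D z * ?D z)) =
      (\<lambda>h. h \<bullet> ((1 / ?D z) *\<^sub>R stereo (fst z) (snd z) y))"
  proof (rule ext)
    fix h :: "'b \<times> real"
    have "h \<bullet> ((1 / ?D z) *\<^sub>R stereo (fst z) (snd z) y) =
      (1 / ?D z) * ((2 * snd z / ?D z) * ((y - fst z) \<bullet> fst h) + snd h * (1 - 2 * (snd z)\<^sup>2 / ?D z))"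
      by (simp only: stereo_def inner_scaleR_right inner_prod_def fst_conv snd_conv inner_real_def inner_commute[of "fst h"])
        (simp add: add_divide_distrib)
    then show "(snd h * ?D z - snd z * (2 * (snd z * snd h) - 2 * ((y - fst z) \<bullet> fst h))) / (?D z * ?D z) =
        h \<bullet> ((1 / ?D z) *\<^sub>R stereo (fst z) (snd z) y)"
      using D by (simp only:) (simp add: field_simps power2_eq_square del: inner_diff_left inner_diff_right)
  qed
  finally show ?thesis
    unfolding gderiv_def .
qed

lemma gderiv_half_space_kernel:
  fixes z :: "'b::euclidean_space \<times> real"
  assumes "0 < snd z"
  shows "GDERIV (\<lambda>z. half_space_const (DIM('b) + 1) * (snd z / stereo_denom (fst z) (snd z) y) ^ DIM('b)) z :>
    half_space_kernel_gradient z y"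
proof -
  let ?c = "half_space_const (DIM('b) + 1)"
  have "DERIV (\<lambda>s. ?c * s ^ DIM('b)) s :> ?c * (real DIM('b) * s ^ (DIM('b) - 1))" for s
    by (auto intro!: derivative_eq_intros)
  from GDERIV_DERIV_compose[OF gderiv_half_space_ratio[OF assms, of y] this]
  have "GDERIV (\<lambda>z. ?c * (snd z / stereo_denom (fst z) (snd z) y) ^ DIM('b)) z :>
    (?c * (real DIM('b) * (snd z / stereo_denom (fst z) (snd z) y) ^ (DIM('b) - 1))) *\<^sub>R
      ((1 / stereo_denom (fst z) (snd z) y) *\<^sub>R stereo (fst z) (snd z) y)" .
  moreover have "s ^ DIM('b) = s * s ^ (DIM('b) - 1)" for s :: real
    by (metis DIM_positive power_eq_if not_gr_zero)
  ultimately show ?thesis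
    using assms by (simp add: half_space_kernel_gradient_def)
qed

text \<open>Moving by less than half the height changes neither the height nor the distance to a
  boundary point by more than a factor, uniformly in \<open>y\<close>. The constants are crude; only
  their independence of \<open>y\<close> and \<open>z\<close> matters.\<close>

lemma stereo_denom_Harnack:
  fixes x z :: "'b::euclidean_space \<times> real"
  assumes "z \<in> ball x (snd x / 2)" "0 < snd x"
  shows "snd x / 2 < snd z" "snd z \<le> 2 * snd x"
    "stereo_denom (fst x) (snd x) y \<le> 6 * stereo_denom (fst z) (snd z) y"
proof -
  have d: "norm (z - x) < snd x / 2"
    using assms(1) by (simp add: dist_norm norm_minus_commute)
  have "\<bar>snd z - snd x\<bar> < snd x / 2"
    using d norm_snd_le[of "snd z - snd x" "fst z - fst x"]
    by (simp add: minus_prod_def)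
  then show z: "snd x / 2 < snd z" "snd z \<le> 2 * snd x"
    using assms(2) by linarith+
  have f: "norm (fst z - fst x) < snd x / 2"
    using d norm_fst_le[of "fst z - fst x" "snd z - snd x"]
    by (simp add: minus_prod_def)
  have "norm (y - fst x) \<le> norm (y - fst z) + snd x / 2"
    using f norm_triangle_ineq[of "y - fst z" "fst z - fst x"] by simp
  then have "(norm (y - fst x))\<^sup>2 \<le> (norm (y - fst z) + snd x / 2)\<^sup>2"
    by (rule power_mono) simp
  also have "\<dots> \<le> 2 * (norm (y - fst z))\<^sup>2 + (snd x)\<^sup>2 / 2"
    using zero_le_power2[of "norm (y - fst z) - snd x / 2"] by (simp add: power2_eq_square algebra_simps)
  finally have "(norm (y - fst x))\<^sup>2 \<le> 2 * (norm (y - fst z))\<^sup>2 + (snd x)\<^sup>2 / 2" .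
  moreover have "(snd x / 2)\<^sup>2 \<le> (snd z)\<^sup>2"
    using z assms by (intro power_mono) auto
  then have "(snd x)\<^sup>2 \<le> 4 * (snd z)\<^sup>2"
    by (simp add: power_divide)
  moreover have "0 \<le> (norm (y - fst z))\<^sup>2"
    by simp
  moreover have "a + b \<le> 6 * (c + d)" if "a \<le> 2 * c + b / 2" "b \<le> 4 * d" "0 \<le> c" for a b c d :: real
  proof -
    have "a + b \<le> 2 * c + 3 / 2 * b"
      using that(1) by simp
    also have "\<dots> \<le> 6 * (c + d)"
      using that(2,3) by simp
    finally show ?thesis .
  qed
  ultimately show "stereo_denom (fst x) (snd x) y \<le> 6 * stereo_denom (fst z) (snd z) y"
    unfolding stereo_denom_def by blast
qed

lemma norm_half_space_kernel_gradient:
  fixes z :: "'b::euclidean_space \<times> real"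
  assumes "0 < snd z"
  shows "norm (half_space_kernel_gradient z y) = half_space_const (DIM('b) + 1) * real DIM('b) / snd z *
    (snd z / stereo_denom (fst z) (snd z) y) ^ DIM('b)"
proof -
  have "0 \<le> half_space_const (DIM('b) + 1) * real DIM('b) / snd z *
    (snd z / stereo_denom (fst z) (snd z) y) ^ DIM('b)"
    using assms half_space_const_pos[of "DIM('b)"] stereo_denom_pos[OF assms, of "fst z" y] by simp
  then show ?thesis
    by (simp only: half_space_kernel_gradient_def norm_scaleR norm_stereo[OF assms] abs_of_nonneg mult_1_right)
qed

text \<open>Supplies the domination for \<open>gderiv_lebesgue_integral\<close>. The 12 combines 2
  from the heights with 6 from the denominators; the leading 2 comes from the division by
  \<open>snd z\<close>.\<close>

lemma half_space_kernel_gradient_Harnack: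
  fixes x z :: "'b::euclidean_space \<times> real"
  assumes z: "z \<in> ball x (snd x / 2)" and x: "0 < snd x"
  shows "norm (half_space_kernel_gradient z y) \<le> 2 * 12 ^ DIM('b) * norm (half_space_kernel_gradient x y)"
proof -
  let ?c = "half_space_const (DIM('b) + 1) * real DIM('b)"
  let ?u = "\<lambda>z. snd z / stereo_denom (fst z) (snd z) y"
  note H = stereo_denom_Harnack[OF z x]
  have z0: "0 < snd z"
    using H(1) x by simp
  have D: "0 < stereo_denom (fst z) (snd z) y" "0 < stereo_denom (fst x) (snd x) y"
    using z0 x by (simp_all add: stereo_denom_pos)
  have c: "0 \<le> ?c"
    using half_space_const_pos[of "DIM('b)"] by simp
  have "?u z \<le> (2 * snd x) / (stereo_denom (fst x) (snd x) y / 6)"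
    using H(1,2) H(3)[of y] D x by (intro frac_le) (auto simp: mult.commute)
  then have "?u z \<le> 12 * ?u x"
    by simp
  then have "?u z ^ DIM('b) \<le> (12 * ?u x) ^ DIM('b)"
    using z0 D by (intro power_mono) auto
  moreover have "?c / snd z \<le> ?c / (snd x / 2)"
    using H(1) x c by (intro divide_left_mono) auto
  ultimately have "?c / snd z * ?u z ^ DIM('b) \<le> ?c / (snd x / 2) * (12 * ?u x) ^ DIM('b)"
    using c x z0 D by (intro mult_mono) auto
  also have "\<dots> = 2 * 12 ^ DIM('b) * (?c / snd x * ?u x ^ DIM('b))"
    unfolding power_mult_distrib by simp
  finally show ?thesis
    by (simp only: norm_half_space_kernel_gradient z0 x)
qed

lemma measurable_half_space_kernel_gradient [measurable]:
  "0 < snd z \<Longrightarrow> half_space_kernel_gradient z \<in> borel_measurable borel"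
  unfolding half_space_kernel_gradient_def by measurable

lemma gradient_poisson_half_space:
  fixes x :: "'b::euclidean_space \<times> real"
  assumes x: "0 < snd x" and [measurable]: "\<phi> \<in> borel_measurable lborel"
    and int: "integrable lborel (\<lambda>y. \<phi> y *\<^sub>R half_space_kernel_gradient x y)"
  shows "gradient (poisson_half_space \<phi>) x = (LINT y|lborel. \<phi> y *\<^sub>R half_space_kernel_gradient x y)"
proof (rule gradient_eq)
  let ?\<kappa> = "\<lambda>z y. half_space_const (DIM('b) + 1) * (snd z / stereo_denom (fst z) (snd z) y) ^ DIM('b)"
  have "poisson_half_space \<phi> = (\<lambda>z. LINT y|lborel. ?\<kappa> z y * \<phi> y)"
    by (simp add: poisson_half_space_def fun_eq_iff stereo_denom_def norm_minus_commute mult.assoc)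
  moreover have "GDERIV (\<lambda>z. LINT y|lborel. ?\<kappa> z y * \<phi> y) x :>
      (LINT y|lborel. \<phi> y *\<^sub>R half_space_kernel_gradient x y)"
  proof (rule gderiv_lebesgue_integral[where \<delta> = "snd x / 2" and C = "2 * 12 ^ DIM('b)"])
    show "GDERIV (\<lambda>z. ?\<kappa> z y) z :> half_space_kernel_gradient z y" if "z \<in> ball x (snd x / 2)" for z y
      using stereo_denom_Harnack(1)[OF that x] x by (intro gderiv_half_space_kernel) simp
    show "norm (half_space_kernel_gradient z y) \<le> 2 * 12 ^ DIM('b) * norm (half_space_kernel_gradient x y)"
      if "z \<in> ball x (snd x / 2)" for z y
      by (rule half_space_kernel_gradient_Harnack[OF that x])
    \<comment> \<open>The gradient is a unit vector times the kernel times
      \<open>DIM('b) / snd x\<close>, so integrability against the gradient already implies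
      integrability against the kernel.\<close>
    show "integrable lborel (\<lambda>y. ?\<kappa> x y * \<phi> y)"
    proof (rule Bochner_Integration.integrable_bound)
      show "integrable lborel (\<lambda>y. (snd x / real DIM('b)) * norm (\<phi> y *\<^sub>R half_space_kernel_gradient x y))"
        by (rule integrable_mult_right[OF integrable_norm[OF int]])
      show "AE y in lborel. norm (?\<kappa> x y * \<phi> y) \<le>
          norm ((snd x / real DIM('b)) * norm (\<phi> y *\<^sub>R half_space_kernel_gradient x y))"
        using x half_space_const_pos[of "DIM('b)"]
        by (intro AE_I2) (simp add: norm_half_space_kernel_gradient abs_mult power_abs abs_of_pos stereo_denom_pos)
    qed measurable
    show "?\<kappa> z \<in> borel_measurable lborel" for z
      by measurable
    show "half_space_kernel_gradient x \<in> borel_measurable lborel"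
      using x by measurable
  qed (use x int in simp_all)
  ultimately show "GDERIV (poisson_half_space \<phi>) x :>
      (LINT y|lborel. \<phi> y *\<^sub>R half_space_kernel_gradient x y)"
    by simp
qed

section \<open>Spherical moments and the norms of the half-space kernel gradient\<close>

text \<open>The mean of \<open>\<bar>\<zeta> \<bullet> l\<bar> powr q\<close> over the unit sphere
  in dimension \<open>n\<close>, for any unit vector \<open>l\<close>; see
  \<open>nn_integral_sphere_moment\<close>.\<close>

definition sphere_moment :: "nat \<Rightarrow> real \<Rightarrow> real" where
  "sphere_moment n q =
    Gamma (real n / 2) * Gamma ((q + 1) / 2) / (sqrt pi * Gamma ((real n + q) / 2))"

lemma sphere_moment_pos: "0 < n \<Longrightarrow> 0 \<le> q \<Longrightarrow> 0 < sphere_moment n q"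
  unfolding sphere_moment_def by (intro divide_pos_pos mult_pos_pos Gamma_real_pos) auto

lemma nn_integral_sphere_moment:
  fixes l :: "'b::euclidean_space \<times> real"
  assumes "0 \<le> q" "norm l = 1"
  shows "(\<integral>\<^sup>+\<zeta>. ennreal (\<bar>\<zeta> \<bullet> l\<bar> powr q) \<partial>sphere_measure) = ennreal (sphere_moment (DIM('b) + 1) q)"
  using nn_integral_sphere_measure_abs_inner_powr[OF assms] by (simp add: sphere_moment_def add.commute)

lemma stereo_weight:
  assumes "0 < t"
  shows "\<alpha> + \<beta> * (stereo a t y \<bullet> (0, 1)) = (\<alpha> + \<beta>) - \<beta> * (2 * t\<^sup>2 / stereo_denom a t y)"
  by (simp add: stereo_def inner_prod_def algebra_simps)

text \<open>The common endpoint for both domains. The Jacobian carries the integral to the sphere,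
  where the term with \<beta> is odd against an even factor and vanishes. This is why the value does
  not depend on \<open>l\<close>.\<close>

lemma nn_integral_stereo_moment:
  fixes l :: "'b::euclidean_space \<times> real"
  assumes t: "0 < t" and q: "0 \<le> q" and l: "norm l = 1" and \<alpha>\<beta>: "\<bar>\<beta>\<bar> \<le> \<alpha>"
  shows "(\<integral>\<^sup>+y. ennreal ((2 * t / stereo_denom a t y) ^ DIM('b) *
      (\<bar>stereo a t y \<bullet> l\<bar> powr q * (\<alpha> + \<beta> * (stereo a t y \<bullet> (0, 1))))) \<partial>lborel) =
    ennreal ((real DIM('b) + 1) * unit_ball_vol (real DIM('b) + 1) * (\<alpha> * sphere_moment (DIM('b) + 1) q))"
proof -
  let ?f = "\<lambda>\<zeta> :: 'b \<times> real. ennreal (\<bar>\<zeta> \<bullet> l\<bar> powr q)"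
  have pos: "0 \<le> (2 * t / stereo_denom a t y) ^ DIM('b)" for y
    using t by (intro zero_le_power divide_nonneg_nonneg) (simp_all add: stereo_denom_pos less_imp_le)
  have "(\<integral>\<^sup>+y. ennreal ((2 * t / stereo_denom a t y) ^ DIM('b) *
      (\<bar>stereo a t y \<bullet> l\<bar> powr q * (\<alpha> + \<beta> * (stereo a t y \<bullet> (0, 1))))) \<partial>lborel) =
    (\<integral>\<^sup>+y. ennreal ((2 * t / stereo_denom a t y) ^ DIM('b)) *
      (?f (stereo a t y) * ennreal (\<alpha> + \<beta> * (stereo a t y \<bullet> (0, 1)))) \<partial>lborel)"
    by (simp only: ennreal_mult'[OF pos] ennreal_mult'[OF powr_ge_zero])
  also have "\<dots> = ennreal ((real DIM('b) + 1) * unit_ball_vol (real DIM('b) + 1)) *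
      (\<integral>\<^sup>+\<zeta>. ?f \<zeta> * ennreal (\<alpha> + \<beta> * (\<zeta> \<bullet> (0, 1))) \<partial>sphere_measure)"
    by (rule nn_integral_stereo[OF t]) measurable
  also have "(\<integral>\<^sup>+\<zeta>. ?f \<zeta> * ennreal (\<alpha> + \<beta> * (\<zeta> \<bullet> (0, 1))) \<partial>sphere_measure) =
      ennreal \<alpha> * ennreal (sphere_moment (DIM('b) + 1) q)"
    unfolding nn_integral_sphere_moment[OF q l, symmetric] using \<alpha>\<beta>
    by (intro nn_integral_sphere_measure_reflect) (simp_all add: norm_Pair)
  finally show ?thesis
    using \<alpha>\<beta> q by (simp add: ennreal_mult[symmetric] sphere_moment_pos less_imp_le)
qed

text \<open>For exponent 1 the kernel is used up entirely as the Jacobian, so the affine weight is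
  constant, and \<open>half_space_const_eq\<close> cancels the normalizations.\<close>

theorem half_space_kernel_gradient_L1:
  fixes x l :: "'b::euclidean_space \<times> real"
  assumes x: "0 < snd x" and l: "norm l = 1"
  shows "(\<integral>\<^sup>+y. ennreal \<bar>half_space_kernel_gradient x y \<bullet> l\<bar> \<partial>lborel) =
    ennreal (real DIM('b) / snd x * sphere_moment (DIM('b) + 1) 1)"
proof -
  let ?m = "real DIM('b)" and ?c = "half_space_const (DIM('b) + 1)"
  let ?S = "stereo (fst x) (snd x)" and ?D = "stereo_denom (fst x) (snd x)"
  have c: "0 < ?c"
    using half_space_const_pos by simp
  have "(\<integral>\<^sup>+y. ennreal \<bar>half_space_kernel_gradient x y \<bullet> l\<bar> \<partial>lborel) =
    (\<integral>\<^sup>+y. ennreal (?c * ?m / (snd x * 2 ^ DIM('b))) * ennreal ((2 * snd x / ?D y) ^ DIM('b) *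
      (\<bar>?S y \<bullet> l\<bar> powr 1 * (1 + 0 * (?S y \<bullet> (0, 1))))) \<partial>lborel)"
  proof (rule nn_integral_cong)
    fix y
    have "\<bar>half_space_kernel_gradient x y \<bullet> l\<bar> = ?c * ?m / (snd x * 2 ^ DIM('b)) *
        ((2 * snd x / ?D y) ^ DIM('b) * (\<bar>?S y \<bullet> l\<bar> powr 1 * (1 + 0 * (?S y \<bullet> (0, 1)))))"
      using x c stereo_denom_pos[OF x, of "fst x" y]
      by (simp add: half_space_kernel_gradient_def abs_mult power_mult_distrib power_divide)
    then show "ennreal \<bar>half_space_kernel_gradient x y \<bullet> l\<bar> =
        ennreal (?c * ?m / (snd x * 2 ^ DIM('b))) * ennreal ((2 * snd x / ?D y) ^ DIM('b) *
          (\<bar>?S y \<bullet> l\<bar> powr 1 * (1 + 0 * (?S y \<bullet> (0, 1)))))"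
      using x c by (simp only: ennreal_mult' divide_nonneg_nonneg mult_nonneg_nonneg less_imp_le of_nat_0_le_iff zero_le_power zero_le_numeral)
  qed
  also have "\<dots> = ennreal (?c * ?m / (snd x * 2 ^ DIM('b))) * ennreal ((?m + 1) * unit_ball_vol (?m + 1) * (1 * sphere_moment (DIM('b) + 1) 1))"
    using x by (subst nn_integral_cmult, measurable, subst nn_integral_stereo_moment[OF x _ l]) simp_all
  also have "\<dots> = ennreal (?c * ?m / (snd x * 2 ^ DIM('b)) * ((?m + 1) * unit_ball_vol (?m + 1) * (1 * sphere_moment (DIM('b) + 1) 1)))"
    using x c by (intro ennreal_mult'[symmetric]) simp
  also have "?c * ?m / (snd x * 2 ^ DIM('b)) * ((?m + 1) * unit_ball_vol (?m + 1) * (1 * sphere_moment (DIM('b) + 1) 1)) =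
      (?c * ((?m + 1) * unit_ball_vol (?m + 1))) / 2 ^ DIM('b) * (?m / snd x * sphere_moment (DIM('b) + 1) 1)"
    by (simp only: times_divide_eq_left times_divide_eq_right divide_divide_eq_left mult_ac mult_1_left)
  also have "\<dots> = ?m / snd x * sphere_moment (DIM('b) + 1) 1"
    using half_space_const_eq[of "DIM('b)"] by (simp add: DIM_positive Suc_leI)
  finally show ?thesis .
qed

text \<open>Since \<open>m * q = m + 1\<close>, the power \<open>q\<close> of
  \<open>u ^ DIM('b)\<close> leaves one factor \<open>u\<close> beyond the Jacobian, and
  \<open>2 * snd x * u\<close> is the weight with \<alpha> = 1 and \<beta> = -1. Of the normalizing
  constant raised to \<open>q\<close>, one factor cancels against the area and \<open>1 / m\<close>
  remains in the exponent.\<close>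

theorem half_space_kernel_gradient_Lq:
  fixes x l :: "'b::euclidean_space \<times> real"
  defines "m \<equiv> real DIM('b)"
  defines "q \<equiv> (m + 1) / m"
  assumes x: "0 < snd x" and l: "norm l = 1"
  shows "(\<integral>\<^sup>+y. ennreal (\<bar>half_space_kernel_gradient x y \<bullet> l\<bar> powr q) \<partial>lborel) =
    ennreal ((m / snd x) powr q * half_space_const (DIM('b) + 1) powr (1 / m) *
      (sphere_moment (DIM('b) + 1) q / (2 * snd x)))"
proof -
  let ?c = "half_space_const (DIM('b) + 1)"
  let ?S = "stereo (fst x) (snd x)" and ?D = "stereo_denom (fst x) (snd x)"
  let ?A = "(?c * m / snd x) powr q / (2 * snd x * 2 ^ DIM('b))"
  have c: "0 < ?c"
    using half_space_const_pos by simp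
  have m: "0 < m"
    by (simp add: m_def)
  have q: "0 \<le> q" "m * q = m + 1" "q = 1 + 1 / m"
    using m by (simp_all add: q_def field_simps)
  have "(\<integral>\<^sup>+y. ennreal (\<bar>half_space_kernel_gradient x y \<bullet> l\<bar> powr q) \<partial>lborel) =
    (\<integral>\<^sup>+y. ennreal ?A * ennreal ((2 * snd x / ?D y) ^ DIM('b) *
      (\<bar>?S y \<bullet> l\<bar> powr q * (1 + (- 1) * (?S y \<bullet> (0, 1))))) \<partial>lborel)"
  proof (rule nn_integral_cong)
    fix y
    define u where "u = snd x / ?D y"
    have u: "0 < u"
      using x by (simp add: u_def divide_pos_pos stereo_denom_pos)
    have "(u ^ DIM('b)) powr q = u powr (m + 1)"
      using u q(2) by (simp add: powr_realpow[symmetric] powr_powr m_def)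
    also have "\<dots> = u ^ DIM('b) * u"
      using u by (simp add: powr_add powr_realpow m_def)
    finally have uq: "(u ^ DIM('b)) powr q = u ^ DIM('b) * u" .
    have w: "1 + (- 1) * (?S y \<bullet> (0, 1)) = 2 * snd x * u"
      unfolding stereo_weight[OF x] by (simp add: u_def power2_eq_square)
    have "\<bar>half_space_kernel_gradient x y \<bullet> l\<bar> = (?c * m / snd x) * (u ^ DIM('b) * \<bar>?S y \<bullet> l\<bar>)"
      using x c u m by (simp add: half_space_kernel_gradient_def abs_mult u_def[symmetric] m_def[symmetric])
    then have "\<bar>half_space_kernel_gradient x y \<bullet> l\<bar> powr q =
        (?c * m / snd x) powr q * (u ^ DIM('b) * u * \<bar>?S y \<bullet> l\<bar> powr q)"
      using x c u m by (simp only: powr_mult uq)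
    also have "\<dots> = ?A * ((2 * u) ^ DIM('b) * (\<bar>?S y \<bullet> l\<bar> powr q * (2 * snd x * u)))"
      using x by (simp add: power_mult_distrib)
    finally have "\<bar>half_space_kernel_gradient x y \<bullet> l\<bar> powr q =
      ?A * ((2 * snd x / ?D y) ^ DIM('b) * (\<bar>?S y \<bullet> l\<bar> powr q * (1 + (- 1) * (?S y \<bullet> (0, 1)))))"
      unfolding w by (simp add: u_def)
    moreover have "0 \<le> ?A"
      using x by simp
    ultimately show "ennreal (\<bar>half_space_kernel_gradient x y \<bullet> l\<bar> powr q) =
        ennreal ?A * ennreal ((2 * snd x / ?D y) ^ DIM('b) *
          (\<bar>?S y \<bullet> l\<bar> powr q * (1 + (- 1) * (?S y \<bullet> (0, 1)))))"
      by (simp only: ennreal_mult')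
  qed
  also have "\<dots> = ennreal ?A * ennreal ((m + 1) * unit_ball_vol (m + 1) * (1 * sphere_moment (DIM('b) + 1) q))"
    unfolding m_def
    using x q by (subst nn_integral_cmult, measurable, subst nn_integral_stereo_moment[OF x _ l]) (simp_all add: m_def)
  also have "\<dots> = ennreal (?A * ((m + 1) * unit_ball_vol (m + 1) * (1 * sphere_moment (DIM('b) + 1) q)))"
    using x by (intro ennreal_mult'[symmetric]) simp
  also have "?A * ((m + 1) * unit_ball_vol (m + 1) * (1 * sphere_moment (DIM('b) + 1) q)) =
      (m / snd x) powr q * ?c powr (1 / m) * (sphere_moment (DIM('b) + 1) q / (2 * snd x)) *
      (?c * ((m + 1) * unit_ball_vol (m + 1)) / 2 ^ DIM('b))"
  proof -
    have "(?c * m / snd x) powr q = ?c powr q * (m / snd x) powr q"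
      using c m x by (simp add: powr_mult[symmetric])
    also have "?c powr q = ?c * ?c powr (1 / m)"
      using c by (simp add: q(3) powr_add)
    finally show ?thesis
      by simp
  qed
  also have "?c * ((m + 1) * unit_ball_vol (m + 1)) / 2 ^ DIM('b) = 1"
    using half_space_const_eq[of "DIM('b)"] by (simp add: DIM_positive Suc_leI m_def)
  finally show ?thesis
    by simp
qed


section \<open>The ball kernel\<close>

definition ball_ratio :: "'a::euclidean_space \<Rightarrow> 'a \<Rightarrow> real" where
  "ball_ratio x \<zeta> = (1 - (norm x)\<^sup>2) / (norm (x - \<zeta>))\<^sup>2"

text \<open>For \<open>norm x < 1\<close> and \<open>norm \<zeta> = 1\<close> this is the antipode
  of the second point where the line through \<open>\<zeta>\<close> and \<open>x\<close> meets the
  sphere: the power of the point \<open>x\<close> is \<open>(norm x)\<^sup>2 - 1\<close>. At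
  \<open>x = 0\<close> it is \<open>\<zeta>\<close> itself.\<close>

definition ball_direction :: "'a::euclidean_space \<Rightarrow> 'a \<Rightarrow> 'a" where
  "ball_direction x \<zeta> = ball_ratio x \<zeta> *\<^sub>R (\<zeta> - x) - x"

definition ball_kernel_gradient :: "'a::euclidean_space \<Rightarrow> 'a \<Rightarrow> 'a" where
  "ball_kernel_gradient x \<zeta> =
    (2 * (real DIM('a) - 1) / (1 - (norm x)\<^sup>2) * ball_ratio x \<zeta> ^ (DIM('a) - 1)) *\<^sub>R ball_direction x \<zeta>"

lemma measurable_ball_ratio [measurable]: "ball_ratio x \<in> borel_measurable borel"
  unfolding ball_ratio_def by measurable

lemma measurable_ball_direction [measurable]: "ball_direction x \<in> borel_measurable borel"
  unfolding ball_direction_def by measurable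

lemma measurable_ball_kernel_gradient [measurable]: "ball_kernel_gradient x \<in> borel_measurable borel"
  unfolding ball_kernel_gradient_def by measurable

lemma one_minus_norm_square_pos: "norm x < 1 \<Longrightarrow> 0 < 1 - (norm x)\<^sup>2"
  by (simp add: abs_square_less_1)

lemma ball_ratio_pos: "norm x < 1 \<Longrightarrow> norm \<zeta> = 1 \<Longrightarrow> 0 < ball_ratio x \<zeta>"
  unfolding ball_ratio_def by (intro divide_pos_pos one_minus_norm_square_pos) auto

lemma norm_ball_direction:
  assumes "norm x < 1" "norm \<zeta> = 1"
  shows "norm (ball_direction x \<zeta>) = 1"
proof -
  define N R where "N = (norm (x - \<zeta>))\<^sup>2" and "R = 1 - (norm x)\<^sup>2"
  have N: "0 < N"
    using assms by (auto simp: N_def)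
  have xx: "x \<bullet> x = 1 - R" and zz: "\<zeta> \<bullet> \<zeta> = 1"
    using assms by (simp_all add: R_def power2_norm_eq_inner flip: norm_eq_1)
  have "N = \<zeta> \<bullet> \<zeta> - 2 * (\<zeta> \<bullet> x) + x \<bullet> x"
    by (simp add: N_def power2_norm_eq_inner inner_diff_left inner_diff_right inner_commute)
  then have zx: "\<zeta> \<bullet> x = (2 - R - N) / 2"
    by (simp add: xx zz)
  have expand: "(u *\<^sub>R (\<zeta> - x) - x) \<bullet> (u *\<^sub>R (\<zeta> - x) - x) =
      u\<^sup>2 * (\<zeta> \<bullet> \<zeta> - 2 * (\<zeta> \<bullet> x) + x \<bullet> x) - 2 * u * (\<zeta> \<bullet> x - x \<bullet> x) + x \<bullet> x" for u
    by (simp add: inner_diff_left inner_diff_right inner_commute[of x \<zeta>] power2_eq_square algebra_simps)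
  have "ball_direction x \<zeta> \<bullet> ball_direction x \<zeta> =
      (R / N)\<^sup>2 * (\<zeta> \<bullet> \<zeta> - 2 * (\<zeta> \<bullet> x) + x \<bullet> x) - 2 * (R / N) * (\<zeta> \<bullet> x - x \<bullet> x) + x \<bullet> x"
    unfolding ball_direction_def ball_ratio_def N_def[symmetric] R_def[symmetric] by (rule expand)
  also have "\<dots> = 1"
    unfolding xx zz zx using N by (simp add: field_simps power2_eq_square)
  finally show ?thesis
    by (simp add: norm_eq_1)
qed

lemma gderiv_ball_ratio:
  assumes "z \<noteq> \<zeta>"
  shows "GDERIV (\<lambda>z. ball_ratio z \<zeta>) z :> (2 / (norm (z - \<zeta>))\<^sup>2) *\<^sub>R ball_direction z \<zeta>"
proof -
  let ?N = "\<lambda>z. (z - \<zeta>) \<bullet> (z - \<zeta>)"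
  have N: "?N z \<noteq> 0"
    using assms by simp
  have a: "((\<lambda>z. 1 - z \<bullet> z) has_derivative (\<lambda>h. - (2 * (h \<bullet> z)))) (at z)"
    by (auto intro!: derivative_eq_intros simp: inner_commute)
  have b: "(?N has_derivative (\<lambda>h. 2 * (h \<bullet> (z - \<zeta>)))) (at z)"
    by (auto intro!: derivative_eq_intros simp: inner_commute)
  from has_derivative_divide'[OF a b N]
  have "((\<lambda>z. (1 - z \<bullet> z) / ?N z) has_derivative
    (\<lambda>h. (- (2 * (h \<bullet> z)) * ?N z - (1 - z \<bullet> z) * (2 * (h \<bullet> (z - \<zeta>)))) / (?N z * ?N z))) (at z)" .
  also have "(\<lambda>h. (- (2 * (h \<bullet> z)) * ?N z - (1 - z \<bullet> z) * (2 * (h \<bullet> (z - \<zeta>)))) / (?N z * ?N z)) =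
    (\<lambda>h. h \<bullet> ((2 / ?N z) *\<^sub>R (((1 - z \<bullet> z) / ?N z) *\<^sub>R (\<zeta> - z) - z)))"
  proof (rule ext)
    fix h
    have "h \<bullet> ((2 / n) *\<^sub>R ((r / n) *\<^sub>R (\<zeta> - z) - z)) = (- (2 * (h \<bullet> z)) * n - r * (2 * (h \<bullet> (z - \<zeta>)))) / (n * n)"
      if "n \<noteq> 0" for n r :: real
    proof -
      have "h \<bullet> ((2 / n) *\<^sub>R ((r / n) *\<^sub>R (\<zeta> - z) - z)) = (2 / n) * (- (r / n) * (h \<bullet> (z - \<zeta>)) - h \<bullet> z)"
        by (simp add: inner_diff_right algebra_simps)
      then show ?thesis
        using that by (simp add: field_simps)
    qed
    from this[OF N] show "(- (2 * (h \<bullet> z)) * ?N z - (1 - z \<bullet> z) * (2 * (h \<bullet> (z - \<zeta>)))) / (?N z * ?N z) =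
      h \<bullet> ((2 / ?N z) *\<^sub>R (((1 - z \<bullet> z) / ?N z) *\<^sub>R (\<zeta> - z) - z))" ..
  qed
  finally show ?thesis
    unfolding gderiv_def ball_ratio_def ball_direction_def power2_norm_eq_inner .
qed

lemma gderiv_ball_kernel:
  fixes z :: "'a::euclidean_space"
  assumes z: "norm z < 1" and \<zeta>: "norm \<zeta> = 1" and dim: "2 \<le> DIM('a)"
  shows "GDERIV (\<lambda>z. ball_ratio z \<zeta> ^ (DIM('a) - 1)) z :> ball_kernel_gradient z \<zeta>"
proof -
  let ?m = "DIM('a) - 1"
  have "z \<noteq> \<zeta>"
    using z \<zeta> by auto
  have "DERIV (\<lambda>s. s ^ ?m) s :> real ?m * s ^ (?m - 1)" for s :: real
    by (auto intro!: derivative_eq_intros)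
  from GDERIV_DERIV_compose[OF gderiv_ball_ratio[OF \<open>z \<noteq> \<zeta>\<close>] this]
  have "GDERIV (\<lambda>z. ball_ratio z \<zeta> ^ ?m) z :>
    (real ?m * ball_ratio z \<zeta> ^ (?m - 1)) *\<^sub>R (2 / (norm (z - \<zeta>))\<^sup>2) *\<^sub>R ball_direction z \<zeta>" .
  moreover have "s ^ ?m = s * s ^ (?m - 1)" for s :: real
    using dim by (metis power_eq_if Suc_1 Suc_le_lessD zero_less_diff less_numeral_extra(3))
  then have "ball_ratio z \<zeta> ^ ?m = (1 - (norm z)\<^sup>2) / (norm (z - \<zeta>))\<^sup>2 * ball_ratio z \<zeta> ^ (?m - 1)"
    by (simp only: ball_ratio_def[symmetric])
  moreover have "real ?m = real DIM('a) - 1"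
    using dim by (simp add: of_nat_diff)
  moreover have "2 * m / r * (r / n * p) = m * p * (2 / n)" if "0 < r" for m r n p :: real
    using that by simp
  ultimately show ?thesis
    using one_minus_norm_square_pos[OF z] by (simp only: ball_kernel_gradient_def scaleR_scaleR)
qed

lemma norm_ball_kernel_gradient:
  fixes x :: "'a::euclidean_space"
  assumes x: "norm x < 1" and \<zeta>: "norm \<zeta> = 1"
  shows "norm (ball_kernel_gradient x \<zeta>) =
    2 * (real DIM('a) - 1) / (1 - (norm x)\<^sup>2) * ball_ratio x \<zeta> ^ (DIM('a) - 1)"
proof -
  have "1 \<le> real DIM('a)"
    using DIM_positive[where 'a = 'a] by linarith
  then have "0 \<le> 2 * (real DIM('a) - 1) / (1 - (norm x)\<^sup>2) * ball_ratio x \<zeta> ^ (DIM('a) - 1)"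
    using ball_ratio_pos[OF assms] one_minus_norm_square_pos[OF x]
    by (intro mult_nonneg_nonneg divide_nonneg_nonneg zero_le_power) auto
  then show ?thesis
    by (simp only: ball_kernel_gradient_def norm_scaleR norm_ball_direction[OF assms] abs_of_nonneg mult_1_right)
qed

text \<open>The boundary is compact, so fixed bounds suffice: near \<open>x\<close> all distances to
  the sphere are at least \<open>d\<close>, which bounds the gradient at \<open>z\<close> from
  above, and no distance exceeds 2, which bounds the gradient at \<open>x\<close> from
  below.\<close>

lemma ball_kernel_gradient_Harnack:
  fixes x z :: "'a::euclidean_space"
  assumes x: "norm x < 1" and z: "z \<in> ball x ((1 - norm x) / 2)"
  defines "d \<equiv> (1 - norm x) / 2" and "k \<equiv> DIM('a) - 1"
  assumes \<zeta>: "norm \<zeta> = 1"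
  shows "norm (ball_kernel_gradient z \<zeta>) \<le>
    (1 / d) * (1 / d\<^sup>2) ^ k / (d / 2) ^ k * norm (ball_kernel_gradient x \<zeta>)"
proof -
  have d: "0 < d"
    using x by (simp add: d_def)
  have "norm (z - x) < d"
    using z by (simp add: d_def dist_norm norm_minus_commute)
  then have dz: "d \<le> 1 - norm z"
    using norm_triangle_ineq[of x "z - x"] by (simp add: d_def field_simps)
  then have z1: "norm z < 1"
    using d by simp
  have m: "0 \<le> 2 * (real DIM('a) - 1)"
    using DIM_positive[where 'a = 'a] by (simp add: Suc_leI)
  have le: "1 - norm w \<le> 1 - (norm w)\<^sup>2" if "norm w < 1" for w :: 'a
    using that by (simp add: power2_eq_square mult_left_le)
  have "norm (ball_kernel_gradient z \<zeta>) \<le> 2 * (real DIM('a) - 1) / d * (1 / d\<^sup>2) ^ k"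
    unfolding norm_ball_kernel_gradient[OF z1 \<zeta>] k_def
  proof (intro mult_mono divide_left_mono power_mono)
    show "d \<le> 1 - (norm z)\<^sup>2"
      using dz le[OF z1] by simp
    have "d \<le> norm (z - \<zeta>)"
      using dz norm_triangle_ineq2[of \<zeta> z] \<zeta> by (simp add: norm_minus_commute)
    then have "d\<^sup>2 \<le> (norm (z - \<zeta>))\<^sup>2"
      using d by (intro power_mono) auto
    then show "ball_ratio z \<zeta> \<le> 1 / d\<^sup>2"
      unfolding ball_ratio_def using d one_minus_norm_square_pos[OF z1] by (intro frac_le) auto
  qed (use m d one_minus_norm_square_pos[OF z1] ball_ratio_pos[OF z1 \<zeta>] in auto)
  also have "\<dots> = (1 / d) * (1 / d\<^sup>2) ^ k / (d / 2) ^ k * (2 * (real DIM('a) - 1) / 1 * (d / 2) ^ k)"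
    using d by simp
  also have "\<dots> \<le> (1 / d) * (1 / d\<^sup>2) ^ k / (d / 2) ^ k * norm (ball_kernel_gradient x \<zeta>)"
    unfolding norm_ball_kernel_gradient[OF x \<zeta>] k_def
  proof (intro mult_left_mono mult_mono divide_left_mono power_mono)
    have "norm (x - \<zeta>) \<le> 2"
      using norm_triangle_ineq4[of x \<zeta>] x \<zeta> by simp
    then have "(norm (x - \<zeta>))\<^sup>2 \<le> 2\<^sup>2"
      by (intro power_mono) auto
    moreover have "2 * d \<le> 1 - (norm x)\<^sup>2"
      using le[OF x] by (simp add: d_def)
    ultimately have "2 * d / 2\<^sup>2 \<le> ball_ratio x \<zeta>"
      unfolding ball_ratio_def using x \<zeta> d by (intro frac_le) auto
    then show "d / 2 \<le> ball_ratio x \<zeta>"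
      by simp
  qed (use m d one_minus_norm_square_pos[OF x] in auto)
  finally show ?thesis .
qed

lemma gradient_poisson_ball:
  fixes x :: "'a::euclidean_space"
  assumes x: "norm x < 1" and [measurable]: "\<phi> \<in> borel_measurable sphere_measure"
    and int: "integrable sphere_measure (\<lambda>\<zeta>. \<phi> \<zeta> *\<^sub>R ball_kernel_gradient x \<zeta>)" and dim: "2 \<le> DIM('a)"
  shows "gradient (poisson_ball \<phi>) x = (LINT \<zeta>|sphere_measure. \<phi> \<zeta> *\<^sub>R ball_kernel_gradient x \<zeta>)"
proof (rule gradient_eq)
  let ?k = "DIM('a) - 1" and ?d = "(1 - norm x) / 2"
  have [measurable]: "(\<lambda>\<zeta>. ball_ratio z \<zeta> ^ ?k) \<in> borel_measurable sphere_measure" for z :: 'a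
    by (rule borel_measurable_sphere_measure) measurable
  have "GDERIV (\<lambda>z. LINT \<zeta>|sphere_measure. ball_ratio z \<zeta> ^ ?k * \<phi> \<zeta>) x :>
      (LINT \<zeta>|sphere_measure. \<phi> \<zeta> *\<^sub>R ball_kernel_gradient x \<zeta>)"
  proof (rule gderiv_lebesgue_integral[where \<delta> = ?d and \<kappa>' = ball_kernel_gradient and
        C = "(1 / ?d) * (1 / ?d\<^sup>2) ^ ?k / (?d / 2) ^ ?k"])
    show "GDERIV (\<lambda>z. ball_ratio z \<zeta> ^ ?k) z :> ball_kernel_gradient z \<zeta>"
      if "z \<in> ball x ?d" "\<zeta> \<in> space sphere_measure" for z \<zeta>
    proof (rule gderiv_ball_kernel[OF _ _ dim])
      show "norm z < 1"
        using that(1) norm_triangle_ineq[of x "z - x"] x by (simp add: dist_norm norm_minus_commute field_simps)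
      show "norm \<zeta> = 1"
        using that(2) by simp
    qed
    show "norm (ball_kernel_gradient z \<zeta>) \<le>
        (1 / ?d) * (1 / ?d\<^sup>2) ^ ?k / (?d / 2) ^ ?k * norm (ball_kernel_gradient x \<zeta>)"
      if "z \<in> ball x ?d" "\<zeta> \<in> space sphere_measure" for z \<zeta>
      using that(2) by (intro ball_kernel_gradient_Harnack[OF x that(1)]) simp
    show "(\<lambda>\<zeta>. ball_ratio z \<zeta> ^ ?k) \<in> borel_measurable sphere_measure" for z :: 'a
      by measurable
    show "ball_kernel_gradient x \<in> borel_measurable sphere_measure"
      by (rule borel_measurable_sphere_measure) measurable
    show "integrable sphere_measure (\<lambda>\<zeta>. ball_ratio x \<zeta> ^ ?k * \<phi> \<zeta>)"
    proof (rule Bochner_Integration.integrable_bound)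
      let ?c = "(1 - (norm x)\<^sup>2) / (2 * (real DIM('a) - 1))"
      show "integrable sphere_measure (\<lambda>\<zeta>. ?c * norm (\<phi> \<zeta> *\<^sub>R ball_kernel_gradient x \<zeta>))"
        by (rule integrable_mult_right[OF integrable_norm[OF int]])
      have c: "?c * (2 * (real DIM('a) - 1) / (1 - (norm x)\<^sup>2)) = 1"
        using dim one_minus_norm_square_pos[OF x] by simp
      show "AE \<zeta> in sphere_measure. norm (ball_ratio x \<zeta> ^ ?k * \<phi> \<zeta>) \<le>
          norm (?c * norm (\<phi> \<zeta> *\<^sub>R ball_kernel_gradient x \<zeta>))"
      proof (rule AE_I2)
        fix \<zeta> :: 'a assume "\<zeta> \<in> space sphere_measure"
        then have \<zeta>: "norm \<zeta> = 1"
          by simp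
        have "?c * norm (\<phi> \<zeta> *\<^sub>R ball_kernel_gradient x \<zeta>) =
            (?c * (2 * (real DIM('a) - 1) / (1 - (norm x)\<^sup>2))) * (ball_ratio x \<zeta> ^ ?k * \<bar>\<phi> \<zeta>\<bar>)"
          by (simp only: norm_scaleR norm_ball_kernel_gradient[OF x \<zeta>] mult_ac)
        then show "norm (ball_ratio x \<zeta> ^ ?k * \<phi> \<zeta>) \<le> norm (?c * norm (\<phi> \<zeta> *\<^sub>R ball_kernel_gradient x \<zeta>))"
          unfolding c by (simp only:) (simp add: abs_mult)
      qed
    qed measurable
  qed (use x int in simp_all)
  then show "GDERIV (poisson_ball \<phi>) x :> (LINT \<zeta>|sphere_measure. \<phi> \<zeta> *\<^sub>R ball_kernel_gradient x \<zeta>)"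
    by (simp add: poisson_ball_def[abs_def] ball_ratio_def)
qed

text \<open>In stereographic coordinates the Moebius map belonging to a point on the axis is a
  dilation. It appears as the change of scale from 1 to \<open>t\<close>, because
  \<open>stereo 0 t y = stereo 0 1 (y /\<^sub>R t)\<close>.\<close>

lemma ball_ratio_stereo:
  fixes y :: "'b::euclidean_space"
  assumes r: "0 \<le> r" "r < 1"
  defines "t \<equiv> (1 + r) / (1 - r)"
  shows "ball_ratio (0, r) (stereo 0 1 y) = t * stereo_denom 0 1 y / stereo_denom 0 t y"
    and "ball_direction (0, r) (stereo 0 1 y) = stereo 0 t y"
proof -
  define Y where "Y = (norm y)\<^sup>2"
  have Y: "0 \<le> Y"
    by (simp add: Y_def)
  have t: "0 < t"
    using r by (simp add: t_def)
  have D: "stereo_denom 0 s y = Y + s\<^sup>2" for s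
    by (simp add: stereo_denom_def Y_def)
  have S: "stereo 0 1 y = ((2 / (Y + 1)) *\<^sub>R y, (Y - 1) / (Y + 1))"
    using Y by (simp add: stereo_def D) (simp add: field_simps)
  have pos: "0 < Y + 1" "0 < Y + t\<^sup>2" "0 < 1 - r" "0 < 1 + r"
    using Y t r by (auto intro: add_nonneg_pos)
  have rt: "(1 - r)\<^sup>2 * (Y + t\<^sup>2) = Y * (1 - r)\<^sup>2 + (1 + r)\<^sup>2"
    using pos by (simp add: t_def power_divide field_simps)
  have "(norm ((0, r) - stereo 0 1 y))\<^sup>2 = (2 / (Y + 1))\<^sup>2 * Y + (r - (Y - 1) / (Y + 1))\<^sup>2"
    by (simp add: S norm_Pair power_mult_distrib power_divide Y_def)
  also have "\<dots> = (Y * (1 - r)\<^sup>2 + (1 + r)\<^sup>2) / (Y + 1)"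
    using pos by (simp add: divide_simps) (simp add: power2_eq_square algebra_simps)
  finally have N: "(norm ((0, r) - stereo 0 1 y))\<^sup>2 = (1 - r)\<^sup>2 * (Y + t\<^sup>2) / (Y + 1)"
    by (simp add: rt)
  have "1 - (norm (0 :: 'b, r))\<^sup>2 = t * (1 - r)\<^sup>2"
    using pos by (simp add: t_def power2_eq_square field_simps norm_Pair)
  then have "ball_ratio (0, r) (stereo 0 1 y) = t * (1 - r)\<^sup>2 / ((1 - r)\<^sup>2 * (Y + t\<^sup>2) / (Y + 1))"
    unfolding ball_ratio_def N by (simp only:)
  then have u: "ball_ratio (0, r) (stereo 0 1 y) = t * (Y + 1) / (Y + t\<^sup>2)"
    using pos by simp
  then show "ball_ratio (0, r) (stereo 0 1 y) = t * stereo_denom 0 1 y / stereo_denom 0 t y"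
    by (simp add: D)
  have tr: "r = (t - 1) / (t + 1)" "0 < t + 1"
    using pos t by (simp_all add: t_def field_simps)
  have "t * (Y + 1) / (Y + t\<^sup>2) * ((Y - 1) / (Y + 1) - r) - r = 1 - 2 * t\<^sup>2 / (Y + t\<^sup>2)"
    unfolding tr(1) using pos tr(2) by (simp add: divide_simps) (simp add: power2_eq_square algebra_simps)
  then show "ball_direction (0, r) (stereo 0 1 y) = stereo 0 t y"
    unfolding ball_direction_def u unfolding S using pos by (simp add: stereo_def D)
qed

text \<open>The coefficients are fixed by the two poles: the ratio is \<open>1 / t\<close> at
  \<open>y = 0\<close>, where the height is -1, and tends to \<open>t\<close> at infinity, where the
  height tends to 1.\<close>

lemma ball_ratio_stereo_weight:
  fixes y :: "'b::euclidean_space"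
  assumes t: "0 < t"
  shows "t * stereo_denom 0 1 y / stereo_denom 0 t y = (t + 1 / t) / 2 + (t - 1 / t) / 2 * (stereo 0 t y \<bullet> (0, 1))"
proof -
  have D: "stereo_denom 0 1 y = stereo_denom 0 t y + 1 - t\<^sup>2"
    by (simp add: stereo_denom_def)
  show ?thesis
    unfolding stereo_weight[OF t] D using stereo_denom_pos[OF t, of 0 y] t
    by (simp add: divide_simps) (simp add: power2_eq_square algebra_simps)
qed

text \<open>An isometry puts \<open>x\<close> on the vertical axis of
  \<open>'b \<times> real\<close>, and stereographic coordinates then reduce everything to
  \<open>nn_integral_stereo_moment\<close>. The auxiliary type \<open>'b\<close> supplies the
  boundary of those coordinates. The weights used below are \<open>A = 1, B = 0\<close> for exponent
  1 and \<open>A = 0, B = 1\<close> for the critical exponent.\<close>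

theorem nn_integral_ball_direction:
  fixes x l :: "'a::euclidean_space" and A B :: real
  assumes dim: "DIM('a) = DIM('b::euclidean_space) + 1" and x: "norm x < 1" and l: "norm l = 1"
    and q: "0 \<le> q" and AB: "0 \<le> A" "0 \<le> B"
  shows "(\<integral>\<^sup>+\<zeta>. ennreal (ball_ratio x \<zeta> ^ (DIM('a) - 1) *
      (\<bar>ball_direction x \<zeta> \<bullet> l\<bar> powr q * (A + B * ball_ratio x \<zeta>))) \<partial>sphere_measure) =
    ennreal ((A + B * ((1 + (norm x)\<^sup>2) / (1 - (norm x)\<^sup>2))) * sphere_moment DIM('a) q)"
proof -
  define r where "r = norm x"
  have r: "0 \<le> r" "r < 1"
    using x by (simp_all add: r_def)
  define t where "t = (1 + r) / (1 - r)"
  have t: "0 < t"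
    using r by (simp add: t_def)
  have dim': "DIM('a) = DIM('b \<times> real)"
    using dim by simp
  obtain T0 :: "'a \<Rightarrow> 'b \<times> real" where T0: "linear T0" "\<And>x y. T0 x \<bullet> T0 y = x \<bullet> y"
    using exists_linear_isometry[OF dim'] by blast
  have "norm (T0 x) = norm x"
    unfolding norm_eq_sqrt_inner T0(2) ..
  then have T0x: "norm (T0 x) = norm (0 :: 'b, r)"
    by (simp add: norm_Pair r_def)
  obtain R :: "'b \<times> real \<Rightarrow> 'b \<times> real" where R: "orthogonal_transformation R" "R (T0 x) = (0, r)"
    using exists_orthogonal_transformation[OF T0x] by blast
  define T where "T = R \<circ> T0"
  have lin: "linear T"
    unfolding T_def by (intro linear_compose T0 orthogonal_transformation_linear R)
  have inner: "T v \<bullet> T w = v \<bullet> w" for v w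
    using R(1) unfolding orthogonal_transformation_def T_def comp_def by (simp only: T0(2))
  have Tx: "T x = (0, r)"
    by (simp add: T_def R)
  have norm: "norm (T v) = norm v" for v
    unfolding norm_eq_sqrt_inner inner ..
  have ratio: "ball_ratio (T v) (T w) = ball_ratio v w" for v w
    unfolding ball_ratio_def linear_diff[OF lin, symmetric] norm ..
  have direction: "ball_direction (T v) (T w) = T (ball_direction v w)" for v w
    unfolding ball_direction_def ratio by (simp add: linear_diff[OF lin] linear_scale[OF lin])
  let ?F = "\<lambda>\<eta>. ennreal (ball_ratio (0, r) \<eta> ^ (DIM('a) - 1) *
      (\<bar>ball_direction (0, r) \<eta> \<bullet> T l\<bar> powr q * (A + B * ball_ratio (0, r) \<eta>)))"
  let ?\<alpha> = "A + B * ((t + 1 / t) / 2)" and ?\<beta> = "B * ((t - 1 / t) / 2)"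
  let ?c = "(real DIM('b) + 1) * unit_ball_vol (real DIM('b) + 1)"
  have "(\<integral>\<^sup>+\<zeta>. ennreal (ball_ratio x \<zeta> ^ (DIM('a) - 1) *
      (\<bar>ball_direction x \<zeta> \<bullet> l\<bar> powr q * (A + B * ball_ratio x \<zeta>))) \<partial>sphere_measure) =
    (\<integral>\<^sup>+\<zeta>. ?F (T \<zeta>) \<partial>sphere_measure)"
    by (simp only: Tx[symmetric] ratio direction inner)
  also have "\<dots> = (\<integral>\<^sup>+\<eta>. ?F \<eta> \<partial>sphere_measure)"
    by (rule nn_integral_sphere_measure_isometry[OF lin inner dim']) measurable
  finally have eq: "(\<integral>\<^sup>+\<zeta>. ennreal (ball_ratio x \<zeta> ^ (DIM('a) - 1) *
      (\<bar>ball_direction x \<zeta> \<bullet> l\<bar> powr q * (A + B * ball_ratio x \<zeta>))) \<partial>sphere_measure) =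
    (\<integral>\<^sup>+\<eta>. ?F \<eta> \<partial>sphere_measure)" .
  have "ennreal ?c * (\<integral>\<^sup>+\<eta>. ?F \<eta> \<partial>sphere_measure) =
    (\<integral>\<^sup>+y. ennreal ((2 * 1 / stereo_denom 0 1 y) ^ DIM('b)) * ?F (stereo 0 1 y) \<partial>lborel)"
    by (rule nn_integral_stereo[symmetric]) (simp, measurable)
  also have "\<dots> = (\<integral>\<^sup>+y. ennreal ((2 * t / stereo_denom 0 t y) ^ DIM('b) *
      (\<bar>stereo 0 t y \<bullet> T l\<bar> powr q * (?\<alpha> + ?\<beta> * (stereo 0 t y \<bullet> (0, 1))))) \<partial>lborel)"
  proof (rule nn_integral_cong)
    fix y :: 'b
    have D: "0 < stereo_denom 0 1 y" "0 < stereo_denom 0 t y"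
      using t by (simp_all add: stereo_denom_pos)
    have "A + B * (t * stereo_denom 0 1 y / stereo_denom 0 t y) = ?\<alpha> + ?\<beta> * (stereo 0 t y \<bullet> (0, 1))"
      unfolding ball_ratio_stereo_weight[OF t] by (simp add: algebra_simps)
    \<comment> \<open>The kernel turns the Jacobian at scale 1 into the one at scale
      \<open>t\<close>: this is the statement that the direction field maps harmonic measure to
      \<open>sphere_measure\<close>.\<close>
    moreover have "(2 * 1 / stereo_denom 0 1 y) ^ DIM('b) * (t * stereo_denom 0 1 y / stereo_denom 0 t y) ^ DIM('b) =
        (2 * t / stereo_denom 0 t y) ^ DIM('b)"
      unfolding power_mult_distrib[symmetric] using D by simp
    ultimately have "(2 * 1 / stereo_denom 0 1 y) ^ DIM('b) * (ball_ratio (0, r) (stereo 0 1 y) ^ (DIM('a) - 1) *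
        (\<bar>ball_direction (0, r) (stereo 0 1 y) \<bullet> T l\<bar> powr q * (A + B * ball_ratio (0, r) (stereo 0 1 y)))) =
      (2 * t / stereo_denom 0 t y) ^ DIM('b) *
        (\<bar>stereo 0 t y \<bullet> T l\<bar> powr q * (?\<alpha> + ?\<beta> * (stereo 0 t y \<bullet> (0, 1))))"
      unfolding ball_ratio_stereo[OF r, folded t_def] dim add_diff_cancel_right'
      by (simp only: mult.assoc[symmetric])
    moreover have "0 \<le> (2 * 1 / stereo_denom 0 1 y) ^ DIM('b)"
      using D by simp
    ultimately show "ennreal ((2 * 1 / stereo_denom 0 1 y) ^ DIM('b)) * ?F (stereo 0 1 y) =
      ennreal ((2 * t / stereo_denom 0 t y) ^ DIM('b) *
        (\<bar>stereo 0 t y \<bullet> T l\<bar> powr q * (?\<alpha> + ?\<beta> * (stereo 0 t y \<bullet> (0, 1)))))"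
      by (metis ennreal_mult')
  qed
  also have "\<dots> = ennreal (?c * (?\<alpha> * sphere_moment (DIM('b) + 1) q))"
  proof (rule nn_integral_stereo_moment[OF t q])
    show "norm (T l) = 1"
      by (simp add: norm l)
    have "\<bar>(t - 1 / t) / 2\<bar> \<le> (t + 1 / t) / 2"
      using t by (simp add: abs_le_iff)
    then show "\<bar>?\<beta>\<bar> \<le> ?\<alpha>"
      using AB by (simp add: abs_mult add_increasing mult_left_mono)
  qed
  also have "\<dots> = ennreal ?c * ennreal (?\<alpha> * sphere_moment (DIM('b) + 1) q)"
    by (rule ennreal_mult') simp
  finally have "(\<integral>\<^sup>+\<eta>. ?F \<eta> \<partial>sphere_measure) = ennreal (?\<alpha> * sphere_moment (DIM('b) + 1) q)"
    by (rule ennreal_mult_left_cancel[rotated]) simp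
  \<comment> \<open>Origin of the factor \<open>1 + (norm x)\<^sup>2\<close> in the final
    constant.\<close>
  moreover have "(t + 1 / t) / 2 = (1 + (norm x)\<^sup>2) / (1 - (norm x)\<^sup>2)"
  proof -
    have "(a / b + 1 / (a / b)) / 2 = (a * a + b * b) / 2 / (a * b)" if "0 < a" "0 < b" for a b :: real
      using that by (simp add: field_simps)
    from this[of "1 + r" "1 - r"]
    have "(t + 1 / t) / 2 = ((1 + r) * (1 + r) + (1 - r) * (1 - r)) / 2 / ((1 + r) * (1 - r))"
      unfolding t_def using r by linarith
    also have "((1 + r) * (1 + r) + (1 - r) * (1 - r)) / 2 = 1 + (norm x)\<^sup>2"
      by (simp add: r_def power2_eq_square algebra_simps)
    also have "(1 + r) * (1 - r) = 1 - (norm x)\<^sup>2"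
      by (simp add: r_def power2_eq_square algebra_simps)
    finally show ?thesis .
  qed
  ultimately show ?thesis
    unfolding eq by (simp only: dim)
qed

theorem ball_kernel_gradient_L1:
  fixes x l :: "'a::euclidean_space"
  assumes dim: "DIM('a) = DIM('b::euclidean_space) + 1" and x: "norm x < 1" and l: "norm l = 1"
  shows "(\<integral>\<^sup>+\<zeta>. ennreal \<bar>ball_kernel_gradient x \<zeta> \<bullet> l\<bar> \<partial>sphere_measure) =
    ennreal (2 * (real DIM('a) - 1) / (1 - (norm x)\<^sup>2) * sphere_moment DIM('a) 1)"
proof -
  let ?A = "2 * (real DIM('a) - 1) / (1 - (norm x)\<^sup>2)"
  have A: "0 \<le> ?A"
    using one_minus_norm_square_pos[OF x] by (simp add: dim)
  have [measurable]: "g \<in> borel_measurable sphere_measure" if "g \<in> borel_measurable borel" for g :: "'a \<Rightarrow> ennreal"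
    using that by (rule borel_measurable_sphere_measure)
  have "(\<integral>\<^sup>+\<zeta>. ennreal \<bar>ball_kernel_gradient x \<zeta> \<bullet> l\<bar> \<partial>sphere_measure) =
    (\<integral>\<^sup>+\<zeta>. ennreal ?A * ennreal (ball_ratio x \<zeta> ^ (DIM('a) - 1) *
      (\<bar>ball_direction x \<zeta> \<bullet> l\<bar> powr 1 * (1 + 0 * ball_ratio x \<zeta>))) \<partial>sphere_measure)"
  proof (rule nn_integral_cong)
    fix \<zeta> :: 'a assume "\<zeta> \<in> space sphere_measure"
    then have "0 \<le> ball_ratio x \<zeta> ^ (DIM('a) - 1)"
      using ball_ratio_pos[OF x, of \<zeta>] by simp
    then have "\<bar>ball_kernel_gradient x \<zeta> \<bullet> l\<bar> =
        ?A * (ball_ratio x \<zeta> ^ (DIM('a) - 1) * \<bar>ball_direction x \<zeta> \<bullet> l\<bar>)"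
      using A by (simp only: ball_kernel_gradient_def inner_scaleR_left abs_mult abs_of_nonneg mult.assoc)
    then show "ennreal \<bar>ball_kernel_gradient x \<zeta> \<bullet> l\<bar> = ennreal ?A * ennreal (ball_ratio x \<zeta> ^ (DIM('a) - 1) *
      (\<bar>ball_direction x \<zeta> \<bullet> l\<bar> powr 1 * (1 + 0 * ball_ratio x \<zeta>)))"
      by (simp only: ennreal_mult'[OF A, symmetric]) simp
  qed
  also have "\<dots> = ennreal ?A * ennreal (sphere_moment DIM('a) 1)"
    by (subst nn_integral_cmult, measurable, subst nn_integral_ball_direction[OF dim x l]) simp_all
  finally show ?thesis
    by (simp only: ennreal_mult'[OF A])
qed

text \<open>As in the half-space, (n - 1) q = n leaves exactly one factor \<open>ball_ratio\<close>
  beyond the density of harmonic measure.\<close>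

theorem ball_kernel_gradient_Lq:
  fixes x l :: "'a::euclidean_space"
  defines "q \<equiv> real DIM('a) / (real DIM('a) - 1)"
  assumes dim: "DIM('a) = DIM('b::euclidean_space) + 1" and x: "norm x < 1" and l: "norm l = 1"
  shows "(\<integral>\<^sup>+\<zeta>. ennreal (\<bar>ball_kernel_gradient x \<zeta> \<bullet> l\<bar> powr q) \<partial>sphere_measure) =
    ennreal ((2 * (real DIM('a) - 1) / (1 - (norm x)\<^sup>2)) powr q *
      ((1 + (norm x)\<^sup>2) / (1 - (norm x)\<^sup>2) * sphere_moment DIM('a) q))"
proof -
  let ?A = "2 * (real DIM('a) - 1) / (1 - (norm x)\<^sup>2)"
  have A: "0 \<le> ?A"
    using one_minus_norm_square_pos[OF x] by (simp add: dim)
  have m: "real (DIM('a) - 1) = real DIM('a) - 1" "0 < real DIM('a) - 1"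
    by (simp_all add: dim)
  have q: "0 \<le> q" "real (DIM('a) - 1) * q = real (DIM('a) - 1) + 1"
    using m by (simp_all add: q_def)
  have [measurable]: "g \<in> borel_measurable sphere_measure" if "g \<in> borel_measurable borel" for g :: "'a \<Rightarrow> ennreal"
    using that by (rule borel_measurable_sphere_measure)
  have "(\<integral>\<^sup>+\<zeta>. ennreal (\<bar>ball_kernel_gradient x \<zeta> \<bullet> l\<bar> powr q) \<partial>sphere_measure) =
    (\<integral>\<^sup>+\<zeta>. ennreal (?A powr q) * ennreal (ball_ratio x \<zeta> ^ (DIM('a) - 1) *
      (\<bar>ball_direction x \<zeta> \<bullet> l\<bar> powr q * (0 + 1 * ball_ratio x \<zeta>))) \<partial>sphere_measure)"
  proof (rule nn_integral_cong)
    fix \<zeta> :: 'a assume "\<zeta> \<in> space sphere_measure"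
    then have u: "0 < ball_ratio x \<zeta>"
      using ball_ratio_pos[OF x, of \<zeta>] by simp
    then have u': "0 \<le> ball_ratio x \<zeta> ^ (DIM('a) - 1)"
      by simp
    have "(ball_ratio x \<zeta> ^ (DIM('a) - 1)) powr q = ball_ratio x \<zeta> powr (real (DIM('a) - 1) + 1)"
      using u by (simp only: powr_realpow[symmetric] powr_powr q(2))
    also have "\<dots> = ball_ratio x \<zeta> ^ (DIM('a) - 1) * ball_ratio x \<zeta>"
      using u by (simp only: powr_add powr_realpow powr_one less_imp_le)
    finally have uq: "(ball_ratio x \<zeta> ^ (DIM('a) - 1)) powr q = ball_ratio x \<zeta> ^ (DIM('a) - 1) * ball_ratio x \<zeta>" .
    have "\<bar>ball_kernel_gradient x \<zeta> \<bullet> l\<bar> =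
        ?A * (ball_ratio x \<zeta> ^ (DIM('a) - 1) * \<bar>ball_direction x \<zeta> \<bullet> l\<bar>)"
      using A u' by (simp only: ball_kernel_gradient_def inner_scaleR_left abs_mult abs_of_nonneg mult.assoc)
    then have "\<bar>ball_kernel_gradient x \<zeta> \<bullet> l\<bar> powr q =
        ?A powr q * (ball_ratio x \<zeta> ^ (DIM('a) - 1) * (\<bar>ball_direction x \<zeta> \<bullet> l\<bar> powr q * (0 + 1 * ball_ratio x \<zeta>)))"
      using A u' by (simp only: powr_mult abs_ge_zero mult_nonneg_nonneg uq add_0 mult_1_left mult_ac)
    then show "ennreal (\<bar>ball_kernel_gradient x \<zeta> \<bullet> l\<bar> powr q) = ennreal (?A powr q) *
        ennreal (ball_ratio x \<zeta> ^ (DIM('a) - 1) * (\<bar>ball_direction x \<zeta> \<bullet> l\<bar> powr q * (0 + 1 * ball_ratio x \<zeta>)))"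
      by (simp only: ennreal_mult'[OF powr_ge_zero])
  qed
  also have "\<dots> = ennreal (?A powr q) *
      ennreal ((0 + 1 * ((1 + (norm x)\<^sup>2) / (1 - (norm x)\<^sup>2))) * sphere_moment DIM('a) q)"
    using q(1) by (subst nn_integral_cmult, measurable, subst nn_integral_ball_direction[OF dim x l]) simp_all
  finally show ?thesis
    by (simp only: ennreal_mult'[OF powr_ge_zero] add_0 mult_1_left)
qed


section \<open>The optimal constants\<close>

lemma mult_powr_inverse_exponent:
  fixes a b m :: real
  assumes "0 < a" "0 < b" "0 < m"
  shows "(a * b powr (m / (m + 1))) powr ((m + 1) / m) = a powr ((m + 1) / m) * b"
  using assms by (simp add: powr_mult powr_powr)

theorem theorem1p3:
  fixes n :: nat
  assumes "n \<ge> 3"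
    and "CARD('n::finite) = n"
    and "CARD('m::finite) = n - 1"
  shows
    "(\<forall>x \<in> ball (0 :: real ^ 'n) 1. \<forall>l \<in> sphere 0 1.
       (let K = 2 * (real n - 1) / (1 - (norm x)\<^sup>2) powr ((2 * real n - 1) / real n) *
              (Gamma (real n / 2) * Gamma ((2 * real n - 1) / (2 * real n - 2)) /
                 (sqrt pi * Gamma ((real n)\<^sup>2 / (2 * real n - 2))) * (1 + (norm x)\<^sup>2))
              powr ((real n - 1) / real n)
        in C_ball (ennreal (real n / (real n - 1))) x = ennreal K \<and>
           C_ball_dir (ennreal (real n / (real n - 1))) x l = ennreal K) \<and>
       (let K = 2 * (real n - 1) * Gamma (real n / 2) /
              (sqrt pi * Gamma ((real n + 1) / 2) * (1 - (norm x)\<^sup>2))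
        in C_ball 1 x = ennreal K \<and> C_ball_dir 1 x l = ennreal K)) \<and>
     (\<forall>x \<in> (half_space :: ((real ^ 'm) \<times> real) set). \<forall>l \<in> sphere 0 1.
       (let K = (real n - 1) * Gamma (real n / 2) /
              (2 powr (1 / real n) * pi powr ((2 * real n - 1) / (2 * real n)) *
                 snd x powr ((2 * real n - 1) / real n)) *
              (Gamma ((2 * real n - 1) / (2 * real n - 2)) /
                 Gamma ((real n)\<^sup>2 / (2 * real n - 2)))
              powr ((real n - 1) / real n)
        in C_half_space (ennreal (real n / (real n - 1))) x = ennreal K \<and>
           C_half_space_dir (ennreal (real n / (real n - 1))) x l = ennreal K) \<and>
       (let K = 2 * Gamma (real n / 2) /
              (sqrt pi * Gamma ((real n - 1) / 2) * snd x)
        in C_half_space_dir 1 x l = ennreal K \<and> C_half_space 1 x = ennreal K))"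
proof -
  define m where "m = real n - 1"
  define q where "q = real n / (real n - 1)"
  have m: "0 < m" "real n = m + 1"
    using \<open>n \<ge> 3\<close> by (simp_all add: m_def)
  have qm: "real n / m = q"
    by (simp add: q_def m_def)
  have q: "1 < q" "q = (m + 1) / m"
    using m by (simp_all add: q_def)
  have dn: "DIM(real ^ 'n) = n" and dm: "DIM(real ^ 'm) = n - 1"
    using assms by simp_all
  \<comment> \<open>The boundary space of the half-space doubles as the space of stereographic
    coordinates for the ball.\<close>
  have dim: "DIM(real ^ 'n) = DIM(real ^ 'm) + 1"
    using assms by simp
  have rm: "real DIM(real ^ 'm) = m" "DIM(real ^ 'm) + 1 = n"
    using \<open>n \<ge> 3\<close> by (simp_all add: dm m_def of_nat_diff del: DIM_cart)
  have rn: "real DIM(real ^ 'n) - 1 = m"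
    by (simp only: dn m_def)
  define G G1 G2 where "G = Gamma (real n / 2)" and "G1 = Gamma ((2 * real n - 1) / (2 * real n - 2))"
    and "G2 = Gamma ((real n)\<^sup>2 / (2 * real n - 2))"
  have G: "0 < G" "0 < G1" "0 < G2"
    using m by (auto simp: G_def G1_def G2_def intro!: Gamma_real_pos)
  have km: "ball_kernel_gradient x \<in> borel_measurable sphere_measure" for x :: "real ^ 'n"
    by (rule borel_measurable_sphere_measure[OF measurable_ball_kernel_gradient])
  have M: "sphere_moment n q = G * G1 / (sqrt pi * G2)"
  proof -
    have "(q + 1) / 2 = (2 * real n - 1) / (2 * real n - 2)"
      using m by (simp add: q(2) field_simps)
    moreover have "(real n + q) / 2 = (real n)\<^sup>2 / (2 * real n - 2)"
      using m by (simp add: q(2) field_simps power2_eq_square)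
    ultimately show ?thesis
      by (simp only: sphere_moment_def G_def G1_def G2_def)
  qed
  have M1: "sphere_moment n 1 = G / (sqrt pi * Gamma ((real n + 1) / 2))"
    by (simp add: sphere_moment_def G_def)
  have M_pos: "0 < sphere_moment n q" "0 < sphere_moment n 1"
    using q m \<open>n \<ge> 3\<close> by (auto intro!: sphere_moment_pos)
  have ball_q: "C_ball (ennreal q) x = ennreal K \<and> C_ball_dir (ennreal q) x l = ennreal K"
    if x: "x \<in> ball 0 1" and l: "l \<in> sphere 0 1"
      and K: "K = 2 * (real n - 1) / (1 - (norm x)\<^sup>2) powr ((2 * real n - 1) / real n) *
        (G * G1 / (sqrt pi * G2) * (1 + (norm x)\<^sup>2)) powr ((real n - 1) / real n)"
    for x l :: "real ^ 'n" and K
  proof -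
    have x: "norm x < 1"
      using that by simp
    define R where "R = 1 - (norm x)\<^sup>2"
    have R: "0 < R"
      unfolding R_def by (rule one_minus_norm_square_pos[OF x])
    have X: "0 < 1 + (norm x)\<^sup>2"
      by (simp add: add_pos_nonneg)
    \<comment> \<open>One factor \<open>R\<close> belongs to the prefactor of the gradient; the
      other, under the root, is the denominator of the mean ratio.\<close>
    have "R powr ((2 * real n - 1) / real n) = R * R powr (m / (m + 1))"
    proof -
      have "(2 * real n - 1) / real n = 1 + m / (m + 1)"
        using m by (simp add: field_simps)
      then show ?thesis
        using R by (simp only: powr_add powr_one less_imp_le)
    qed
    then have K': "K = 2 * m / R * ((1 + (norm x)\<^sup>2) / R * sphere_moment n q) powr (m / (m + 1))"
      unfolding K M R_def[symmetric] using m R X G by (simp add: powr_divide powr_mult m_def[symmetric] mult_ac)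
    have pos: "0 < K"
      unfolding K' using m R X M_pos by simp
    have Kq: "K powr q = (2 * m / R) powr q * ((1 + (norm x)\<^sup>2) / R * sphere_moment n q)"
      unfolding K' q(2) using m R X M_pos by (intro mult_powr_inverse_exponent) (auto simp: q(2))
    have "(\<integral>\<^sup>+\<zeta>. ennreal (\<bar>ball_kernel_gradient x \<zeta> \<bullet> l\<bar> powr q) \<partial>sphere_measure) = ennreal (K powr q)"
      if "norm l = 1" for l
      using ball_kernel_gradient_Lq[OF dim x that] unfolding Kq
      by (simp only: dn R_def[symmetric] m_def[symmetric] qm)
    then have "C_ball (ennreal q) x = ennreal K \<and> (\<forall>l. norm l = 1 \<longrightarrow> C_ball_dir (ennreal q) x l = ennreal K)"
      using q(1) pos
      by (intro optimal_const_finite[where k = "ball_kernel_gradient x"] km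
          gradient_poisson_ball[OF x]) (use assms in auto)
    then show ?thesis
      using l by simp
  qed
  have ball_1: "C_ball 1 x = ennreal K \<and> C_ball_dir 1 x l = ennreal K"
    if x: "x \<in> ball 0 1" and l: "l \<in> sphere 0 1"
      and K: "K = 2 * (real n - 1) * G / (sqrt pi * Gamma ((real n + 1) / 2) * (1 - (norm x)\<^sup>2))"
    for x l :: "real ^ 'n" and K
  proof -
    have x: "norm x < 1"
      using that by simp
    have K': "K = 2 * m / (1 - (norm x)\<^sup>2) * sphere_moment n 1"
      unfolding K M1 by (simp add: m_def)
    have pos: "0 < K"
      unfolding K' using m M_pos one_minus_norm_square_pos[OF x] by simp
    have "(\<integral>\<^sup>+\<zeta>. ennreal \<bar>ball_kernel_gradient x \<zeta> \<bullet> l\<bar> \<partial>sphere_measure) = ennreal K"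
      if "norm l = 1" for l
      using ball_kernel_gradient_L1[OF dim x that] unfolding K' by (simp only: dn m_def)
    then have "C_ball 1 x = ennreal K \<and> (\<forall>l. norm l = 1 \<longrightarrow> C_ball_dir 1 x l = ennreal K)"
      using pos
      by (intro optimal_const_one[where k = "ball_kernel_gradient x"] km
          gradient_poisson_ball[OF x]) (use assms in auto)
    then show ?thesis
      using l by simp
  qed
  have half_q: "C_half_space (ennreal q) x = ennreal K \<and> C_half_space_dir (ennreal q) x l = ennreal K"
    if x: "x \<in> half_space" and l: "l \<in> sphere 0 1"
      and K: "K = (real n - 1) * G / (2 powr (1 / real n) * pi powr ((2 * real n - 1) / (2 * real n)) *
         snd x powr ((2 * real n - 1) / real n)) * (G1 / G2) powr ((real n - 1) / real n)"
    for x l :: "(real ^ 'm) \<times> real" and K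
  proof -
    define t where "t = snd x"
    have x: "0 < snd x" and t: "0 < t"
      using that by (simp_all add: half_space_def t_def)
    define c where "c = half_space_const n"
    have c: "0 < c"
      using half_space_const_pos[of "n - 1"] \<open>n \<ge> 3\<close> by (simp add: c_def)
    \<comment> \<open>The closed form is checked by logarithms, which turn it into an identity that
      is linear in \<open>ln 2\<close>, \<open>ln pi\<close>, \<open>ln t\<close> and the logarithms
      of \<open>m\<close> and the Gamma values.\<close>
    have lnc: "ln c = (m - 1) * ln 2 + ln G - (m + 1) / 2 * ln pi"
      using G \<open>n \<ge> 3\<close>
      by (simp add: c_def half_space_const_def G_def[symmetric] ln_mult ln_div ln_realpow ln_powr m_def of_nat_diff)
    \<comment> \<open>The right-hand side is the root of order \<open>q\<close> of the value in
      \<open>half_space_kernel_gradient_Lq\<close>. The power \<open>1 / n\<close> of the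
      normalizing constant completes \<open>G\<close> to its first power, and together with the root
      of the moment it leaves \<open>2 powr (1 / real n)\<close> and the stated power of
      \<open>pi\<close> in the denominator.\<close>
    have K': "K = m / t * c powr (1 / (m + 1)) * (sphere_moment n q / (2 * t)) powr (m / (m + 1))"
      (is "_ = ?K")
    proof -
      have pos: "0 < K" "0 < ?K"
        unfolding K t_def[symmetric] using m t c G M_pos by simp_all
      have "ln K = ln m + ln G - (1 / (m + 1) * ln 2 + (2 * m + 1) / (2 * (m + 1)) * ln pi +
          (2 * m + 1) / (m + 1) * ln t) + m / (m + 1) * (ln G1 - ln G2)"
        unfolding K t_def[symmetric] m(2) using m t G by (simp add: ln_mult ln_div ln_powr add.commute)
      moreover have "ln ?K = ln m - ln t + 1 / (m + 1) * ln c +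
          m / (m + 1) * (ln G + ln G1 - (ln pi / 2 + ln G2) - (ln 2 + ln t))"
        unfolding M using m t c G by (simp add: ln_mult ln_div ln_powr ln_sqrt)
      moreover have "1 / (m + 1) * ln c = (1 - 2 / (m + 1)) * ln 2 + 1 / (m + 1) * ln G - ln pi / 2"
        unfolding lnc using m(1) by (simp add: divide_simps)
      moreover have "m / (m + 1) = 1 - 1 / (m + 1)" "(2 * m + 1) / (m + 1) = 2 - 1 / (m + 1)"
        "(2 * m + 1) / (2 * (m + 1)) = 1 - 1 / (m + 1) / 2"
        using m(1) by (simp_all add: field_simps)
      ultimately have "ln K = ln ?K"
        by (simp only:) (simp add: algebra_simps add_divide_distrib diff_divide_distrib)
      then show ?thesis
        using pos by simp
    qed
    have pos: "0 < K"
      unfolding K' using m t c M_pos by simp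
    have Kq: "K powr q = (m / t) powr q * c powr (1 / m) * (sphere_moment n q / (2 * t))"
    proof -
      have "K powr q = (m / t * c powr (1 / (m + 1))) powr q * (sphere_moment n q / (2 * t))"
        unfolding K' q(2) using m t c M_pos by (intro mult_powr_inverse_exponent) (auto simp: q(2))
      also have "(m / t * c powr (1 / (m + 1))) powr q = (m / t) powr q * c powr (1 / m)"
        using m by (simp only: powr_mult powr_powr) (simp add: q(2))
      finally show ?thesis .
    qed
    have "(\<integral>\<^sup>+y. ennreal (\<bar>half_space_kernel_gradient x y \<bullet> l\<bar> powr q) \<partial>lborel) = ennreal (K powr q)"
      if "norm l = 1" for l
      using half_space_kernel_gradient_Lq[OF x that] unfolding Kq rm q(2)[symmetric] t_def c_def .
    then have "C_half_space (ennreal q) x = ennreal K \<and> (\<forall>l. norm l = 1 \<longrightarrow> C_half_space_dir (ennreal q) x l = ennreal K)"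
      using q(1) pos x
      by (intro optimal_const_finite[where k = "half_space_kernel_gradient x"]
          gradient_poisson_half_space[OF x]) auto
    moreover have "norm l = 1"
      using l by simp
    ultimately show ?thesis
      by blast
  qed
  have half_1: "C_half_space_dir 1 x l = ennreal K \<and> C_half_space 1 x = ennreal K"
    if x: "x \<in> half_space" and l: "l \<in> sphere 0 1"
      and K: "K = 2 * G / (sqrt pi * Gamma ((real n - 1) / 2) * snd x)"
    for x l :: "(real ^ 'm) \<times> real" and K
  proof -
    have x: "0 < snd x"
      using that by (simp add: half_space_def)
    \<comment> \<open>The functional equation cancels the factor n - 1 of the gradient and lowers
      the Gamma argument in the denominator to (n - 1)/2.\<close>
    have "Gamma (m / 2 + 1) = m / 2 * Gamma (m / 2)"
      by (rule Gamma_plus1) (use m in \<open>auto dest!: nonpos_Ints_nonpos\<close>)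
    moreover have "(real n + 1) / 2 = m / 2 + 1"
      by (simp add: m(2))
    ultimately have Gn: "Gamma ((real n + 1) / 2) = m / 2 * Gamma (m / 2)"
      by (simp only:)
    have "0 < Gamma (m / 2)"
      using m by (intro Gamma_real_pos) simp
    then have K': "K = m / snd x * sphere_moment n 1"
      unfolding K M1 m_def[symmetric] Gn using m(1) by (simp add: mult_ac)
    have pos: "0 < K"
      unfolding K' using m M_pos x by simp
    have "(\<integral>\<^sup>+y. ennreal \<bar>half_space_kernel_gradient x y \<bullet> l\<bar> \<partial>lborel) = ennreal K"
      if "norm l = 1" for l
      using half_space_kernel_gradient_L1[OF x that] unfolding K' rm .
    then have "C_half_space 1 x = ennreal K \<and> (\<forall>l. norm l = 1 \<longrightarrow> C_half_space_dir 1 x l = ennreal K)"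
      using pos x
      by (intro optimal_const_one[where k = "half_space_kernel_gradient x"]
          gradient_poisson_half_space[OF x]) auto
    moreover have "norm l = 1"
      using l by simp
    ultimately show ?thesis
      by blast
  qed
  show ?thesis
    unfolding Let_def q_def[symmetric] G_def[symmetric] G1_def[symmetric] G2_def[symmetric]
    using ball_q ball_1 half_q half_1 by blast
qed

end
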